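(* Let $G$ be a finite group. A calculus $\Omega^1$ on $\mathbb CG$ is $D^\vee(G)$-covariant if and only if $\Omega^1=\Omega^1_\rho$ (up to isomorphism of calculi) for some representation $\rho$ of $G$. In this case, if $\Omega^1_{D^\vee(G)}$ is a bicovariant calculus on $D^\vee(G)$, then the coaction $\Delta_L:\mathbb CG\to D^\vee(G)\otimes\mathbb CG$, $\Delta_Lg=\sum_{f\in G}\delta_f\otimes f^{-1}gf\otimes f^{-1}gf$, is differentiable with respect to $\Omega^1_{D^\vee(G)}$ if and only if the algebra map $\Phi:\mathbb CG\hookrightarrow D^\vee(G)$, $\Phi(g)=\sum_{f\in G}\delta_f\otimes f^{-1}gf$, is differentiable.
   Context: $D^\vee(G)$ is the Hopf algebra on $\mathbb C(G)\otimes\mathbb CG$ with tensor product algebra and counit, $\Delta(\delta_g\otimes h)=\sum_f\delta_f\otimes f^{-1}ghg^{-1}f\otimes\delta_{f^{-1}g}\otimes h$, $S(\delta_g\otimes h)=\delta_{g^{-1}}\otimes gh^{-1}g^{-1}$. A calculus on an algebra $A$ is an $A$-bimodule $\Omega^1$ with a linear map $d:A\to\Omega^1$ obeying the Leibniz rule, with $\Omega^1$ spanned by $A\,dA$. An algebra map $\phi:A\to B$ between algebras with calculi is differentiable if $\phi_*(a\,db)=\phi(a)d\phi(b)$ is well defined as an $A$-bimodule map $\Omega^1_A\to\Omega^1_B$. On a tensor product $A\otimes B$ one uses $\Omega^1_{A\otimes B}=(\Omega^1_A\otimes B)\oplus(A\otimes\Omega^1_B)$ with $d=d_A\otimes\mathrm{id}\oplus\mathrm{id}\otimes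 d_B$. A calculus on a Hopf algebra $H$ is bicovariant if $h\,dg\mapsto h_1g_1\otimes h_2dg_2$ and $h\,dg\mapsto h_1dg_1\otimes h_2g_2$ are well-defined on $\Omega^1$. A calculus on $\mathbb CG$ is $D^\vee(G)$-covariant if $\Delta_L(h\,dg)=\sum_{f\in G}\delta_f\otimes f^{-1}hgf\otimes f^{-1}hf\,d(f^{-1}gf)$ is a well-defined map $\Omega^1\to D^\vee(G)\otimes\Omega^1$. For a representation $\rho:G\to\mathrm{End}(V)$, $\Omega^1_\rho=\mathbb CG\otimes\rho(\mathbb CG^+)$, where $\mathbb CG^+=\ker\epsilon$, with free left module structure, $x\cdot g=g\otimes x\rho(g)$, $dg=g\otimes(\rho(g)-1)$. *)

theory Defs
  imports Complex_Main "HOL-Algebra.Group" "HOL-Library.Function_Algebras" "HOL-Library.Product_Plus"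
    "HOL-Library.FuncSet"
begin

section \<open>Complex vector spaces\<close>

class complex_vector = ab_group_add +
  fixes scaleC :: "complex \<Rightarrow> 'a \<Rightarrow> 'a"  (infixr "*\<^sub>C" 75)
  assumes scaleC_add_right: "c *\<^sub>C (x + y) = c *\<^sub>C x + c *\<^sub>C y"
    and scaleC_add_left: "(c + c') *\<^sub>C x = c *\<^sub>C x + c' *\<^sub>C x"
    and scaleC_scaleC: "c *\<^sub>C c' *\<^sub>C x = (c * c') *\<^sub>C x"
    and scaleC_one: "1 *\<^sub>C x = x"

global_interpretation complex_vec: vector_space "scaleC :: complex \<Rightarrow> 'a \<Rightarrow> 'a::complex_vector"
  by unfold_locales
    (simp_all add: scaleC_add_right scaleC_add_left scaleC_scaleC scaleC_one)

instantiation complex :: complex_vector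
begin
definition scaleC_complex :: "complex \<Rightarrow> complex \<Rightarrow> complex" where
  "c *\<^sub>C z = c * z"
instance by standard (simp_all add: scaleC_complex_def algebra_simps)
end

instantiation "fun" :: (type, complex_vector) complex_vector
begin
definition scaleC_fun :: "complex \<Rightarrow> ('a \<Rightarrow> 'b) \<Rightarrow> 'a \<Rightarrow> 'b" where
  "c *\<^sub>C f = (\<lambda>x. c *\<^sub>C f x)"
instance by standard
    (simp_all add: scaleC_fun_def fun_eq_iff scaleC_add_right scaleC_add_left scaleC_scaleC scaleC_one)
end

instantiation prod :: (complex_vector, complex_vector) complex_vector
begin
definition scaleC_prod :: "complex \<Rightarrow> 'a \<times> 'b \<Rightarrow> 'a \<times> 'b" where
  "c *\<^sub>C p = (c *\<^sub>C fst p, c *\<^sub>C snd p)"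
instance by standard
    (simp_all add: scaleC_prod_def prod_eq_iff scaleC_add_right scaleC_add_left scaleC_scaleC scaleC_one)
end

definition clinear_on :: "'a::complex_vector set \<Rightarrow> 'b::complex_vector set \<Rightarrow> ('a \<Rightarrow> 'b) \<Rightarrow> bool" where
  "clinear_on V W f \<longleftrightarrow> f \<in> V \<rightarrow> W \<and>
     (\<forall>x\<in>V. \<forall>y\<in>V. f (x + y) = f x + f y) \<and>
     (\<forall>c. \<forall>x\<in>V. f (c *\<^sub>C x) = c *\<^sub>C f x)"

definition finite_dimensional :: "'a::complex_vector set \<Rightarrow> bool" where
  "finite_dimensional V \<longleftrightarrow> (\<exists>S. finite S \<and> V = complex_vec.span S)"

section \<open>Algebras with a finite basis and tensor products\<close>

text \<open>
  The vector space with finite basis \<open>X\<close> is the space of complex functions vanishing off \<open>X\<close>.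
  Accordingly, its tensor product (in either order) with a vector space \<open>M\<close> is the space of
  \<open>M\<close>-valued functions vanishing off \<open>X\<close>, where \<open>x \<otimes> m\<close> (or \<open>m \<otimes> x\<close>) is the function
  with value \<open>m\<close> at \<open>x\<close> and \<open>0\<close> elsewhere. The tensor product of the spaces with bases \<open>X\<close> and \<open>Y\<close>
  is the space with basis \<open>X \<times> Y\<close>.
\<close>

definition tensor_space :: "'b set \<Rightarrow> 'm::complex_vector set \<Rightarrow> ('b \<Rightarrow> 'm) set" where
  "tensor_space X M = {F. (\<forall>x\<in>X. F x \<in> M) \<and> (\<forall>x. x \<notin> X \<longrightarrow> F x = 0)}"

definition tens :: "('b \<Rightarrow> complex) \<Rightarrow> 'm::complex_vector \<Rightarrow> 'b \<Rightarrow> 'm" where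
  "tens u m = (\<lambda>x. u x *\<^sub>C m)"

definition bvec :: "'b \<Rightarrow> 'b \<Rightarrow> complex" where
  "bvec x = (\<lambda>y. if y = x then 1 else 0)"

text \<open>An algebra is given by its products of basis elements and its unit.\<close>

record 'b based_algebra =
  basis :: "'b set"
  bmult :: "'b \<Rightarrow> 'b \<Rightarrow> 'b \<Rightarrow> complex"
  aone :: "'b \<Rightarrow> complex"

definition elems :: "('b, 'z) based_algebra_scheme \<Rightarrow> ('b \<Rightarrow> complex) set" where
  "elems A = tensor_space (basis A) UNIV"

definition amult :: "('b, 'z) based_algebra_scheme \<Rightarrow> ('b \<Rightarrow> complex) \<Rightarrow> ('b \<Rightarrow> complex) \<Rightarrow> 'b \<Rightarrow> complex" where
  "amult A a b = (\<Sum>x\<in>basis A. \<Sum>y\<in>basis A. (a x * b y) *\<^sub>C bmult A x y)"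

definition tensor_algebra ::
  "('b, 'y) based_algebra_scheme \<Rightarrow> ('c, 'z) based_algebra_scheme \<Rightarrow> ('b \<times> 'c) based_algebra" where
  "tensor_algebra A B = \<lparr>
     basis = basis A \<times> basis B,
     bmult = (\<lambda>(x, y) (x', y') (p, q). bmult A x x' p * bmult B y y' q),
     aone = (\<lambda>(p, q). aone A p * aone B q)\<rparr>"

text \<open>Comultiplication, counit and antipode are also given by their values on basis elements.\<close>

record 'b based_hopf_algebra = "'b based_algebra" +
  bcomult :: "'b \<Rightarrow> 'b \<times> 'b \<Rightarrow> complex"
  bcounit :: "'b \<Rightarrow> complex"
  bantipode :: "'b \<Rightarrow> 'b \<Rightarrow> complex"

definition comult :: "('b, 'z) based_hopf_algebra_scheme \<Rightarrow> ('b \<Rightarrow> complex) \<Rightarrow> 'b \<times> 'b \<Rightarrow> complex" where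
  "comult H a = (\<Sum>x\<in>basis H. a x *\<^sub>C bcomult H x)"

section \<open>Differential calculi\<close>

record ('b, 'm) calculus =
  forms :: "'m set"
  lact :: "('b \<Rightarrow> complex) \<Rightarrow> 'm \<Rightarrow> 'm"
  ract :: "'m \<Rightarrow> ('b \<Rightarrow> complex) \<Rightarrow> 'm"
  dif :: "('b \<Rightarrow> complex) \<Rightarrow> 'm"

definition is_bimodule :: "('b, 'y) based_algebra_scheme \<Rightarrow> ('b, 'm::complex_vector) calculus \<Rightarrow> bool" where
  "is_bimodule A C \<longleftrightarrow>
     complex_vec.subspace (forms C) \<and>
     (\<forall>a\<in>elems A. clinear_on (forms C) (forms C) (\<lambda>w. lact C a w)) \<and>
     (\<forall>a\<in>elems A. clinear_on (forms C) (forms C) (\<lambda>w. ract C w a)) \<and>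
     (\<forall>w\<in>forms C. clinear_on (elems A) (forms C) (\<lambda>a. lact C a w)) \<and>
     (\<forall>w\<in>forms C. clinear_on (elems A) (forms C) (\<lambda>a. ract C w a)) \<and>
     (\<forall>w\<in>forms C. lact C (aone A) w = w \<and> ract C w (aone A) = w) \<and>
     (\<forall>w\<in>forms C. \<forall>a\<in>elems A. \<forall>b\<in>elems A.
        lact C (amult A a b) w = lact C a (lact C b w) \<and>
        ract C w (amult A a b) = ract C (ract C w a) b \<and>
        lact C a (ract C w b) = ract C (lact C a w) b)"

definition is_calculus :: "('b, 'y) based_algebra_scheme \<Rightarrow> ('b, 'm::complex_vector) calculus \<Rightarrow> bool" where
  "is_calculus A C \<longleftrightarrow>
     is_bimodule A C \<and>
     clinear_on (elems A) (forms C) (dif C) \<and>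
     (\<forall>a\<in>elems A. \<forall>b\<in>elems A. dif C (amult A a b) = ract C (dif C a) b + lact C a (dif C b)) \<and>
     forms C = complex_vec.span {lact C a (dif C b) | a b. a \<in> elems A \<and> b \<in> elems A}"

text \<open>Maps of bimodules along an algebra map \<open>\<phi>\<close>, whose target is a bimodule over the domain of
  \<open>\<phi>\<close> by pullback.\<close>

definition bimodule_map ::
  "('b, 'y) based_algebra_scheme \<Rightarrow> ('b, 'm::complex_vector) calculus \<Rightarrow> ('c, 'n::complex_vector) calculus
   \<Rightarrow> (('b \<Rightarrow> complex) \<Rightarrow> 'c \<Rightarrow> complex) \<Rightarrow> ('m \<Rightarrow> 'n) \<Rightarrow> bool" where
  "bimodule_map A C C' \<phi> \<theta> \<longleftrightarrow>
     clinear_on (forms C) (forms C') \<theta> \<and>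
     (\<forall>a\<in>elems A. \<forall>w\<in>forms C.
        \<theta> (lact C a w) = lact C' (\<phi> a) (\<theta> w) \<and> \<theta> (ract C w a) = ract C' (\<theta> w) (\<phi> a))"

definition differentiable_map ::
  "('b, 'y) based_algebra_scheme \<Rightarrow> ('b, 'm::complex_vector) calculus \<Rightarrow> ('c, 'n::complex_vector) calculus
   \<Rightarrow> (('b \<Rightarrow> complex) \<Rightarrow> 'c \<Rightarrow> complex) \<Rightarrow> bool" where
  "differentiable_map A C C' \<phi> \<longleftrightarrow>
     (\<exists>\<theta>. bimodule_map A C C' \<phi> \<theta> \<and>
        (\<forall>a\<in>elems A. \<forall>b\<in>elems A. \<theta> (lact C a (dif C b)) = lact C' (\<phi> a) (dif C' (\<phi> b))))"

definition calculus_iso ::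
  "('b, 'y) based_algebra_scheme \<Rightarrow> ('b, 'm::complex_vector) calculus \<Rightarrow> ('b, 'n::complex_vector) calculus \<Rightarrow> bool" where
  "calculus_iso A C C' \<longleftrightarrow>
     (\<exists>\<theta>. bimodule_map A C C' (\<lambda>a. a) \<theta> \<and> bij_betw \<theta> (forms C) (forms C') \<and>
        (\<forall>a\<in>elems A. \<theta> (dif C a) = dif C' a))"

text \<open>
  The calculus \<open>(\<Omega>\<^sub>A \<otimes> B) \<oplus> (A \<otimes> \<Omega>\<^sub>B)\<close> on \<open>A \<otimes> B\<close>. The actions are the bilinear extensions of
  \<open>(a \<otimes> b)(\<omega> \<otimes> b') = a\<omega> \<otimes> bb'\<close>, \<open>(a \<otimes> b)(a' \<otimes> \<omega>) = aa' \<otimes> b\<omega>\<close> and their right-hand versions;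
  \<open>d(a \<otimes> b) = da \<otimes> b + a \<otimes> db\<close>, so that the value of \<open>d F\<close> at a basis element is the
  differential of a partial evaluation of \<open>F\<close>.
\<close>

definition tensor_calculus ::
  "('b, 'y) based_algebra_scheme \<Rightarrow> ('b, 'm::complex_vector) calculus
   \<Rightarrow> ('c, 'z) based_algebra_scheme \<Rightarrow> ('c, 'n::complex_vector) calculus
   \<Rightarrow> ('b \<times> 'c, ('c \<Rightarrow> 'm) \<times> ('b \<Rightarrow> 'n)) calculus" where
  "tensor_calculus A C B C' = \<lparr>
     forms = tensor_space (basis B) (forms C) \<times> tensor_space (basis A) (forms C'),
     lact = (\<lambda>F (W, Z).
       \<Sum>x\<in>basis A. \<Sum>y\<in>basis B. F (x, y) *\<^sub>C
         (\<Sum>q\<in>basis B. tens (bmult B y q) (lact C (bvec x) (W q)),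
          \<Sum>p\<in>basis A. tens (bmult A x p) (lact C' (bvec y) (Z p)))),
     ract = (\<lambda>(W, Z) F.
       \<Sum>x\<in>basis A. \<Sum>y\<in>basis B. F (x, y) *\<^sub>C
         (\<Sum>q\<in>basis B. tens (bmult B q y) (ract C (W q) (bvec x)),
          \<Sum>p\<in>basis A. tens (bmult A p x) (ract C' (Z p) (bvec y)))),
     dif = (\<lambda>F. (\<lambda>y. dif C (\<lambda>x. F (x, y)), \<lambda>x. dif C' (\<lambda>y. F (x, y))))\<rparr>"

text \<open>``Well defined on \<open>\<Omega>\<^sup>1\<close>'' means that a linear map on \<open>\<Omega>\<^sup>1\<close> with the given values exists; it is then
  unique as the elements \<open>h dg\<close> span. Below, \<open>comult H h (x, y)\<close> and \<open>comult H g (x', y')\<close> are the coefficients of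
  \<open>x \<otimes> y\<close> in \<open>\<Delta> h\<close> and of \<open>x' \<otimes> y'\<close> in \<open>\<Delta> g\<close>.\<close>

definition bicovariant ::
  "('b, 'y) based_hopf_algebra_scheme \<Rightarrow> ('b, 'm::complex_vector) calculus \<Rightarrow> bool" where
  "bicovariant H C \<longleftrightarrow>
     (\<exists>L. clinear_on (forms C) (tensor_space (basis H) (forms C)) L \<and>
        (\<forall>h\<in>elems H. \<forall>g\<in>elems H. L (lact C h (dif C g)) =
           (\<Sum>(x, y)\<in>basis H \<times> basis H. \<Sum>(x', y')\<in>basis H \<times> basis H.
              (comult H h (x, y) * comult H g (x', y')) *\<^sub>C
                tens (bmult H x x') (lact C (bvec y) (dif C (bvec y')))))) \<and>
     (\<exists>R. clinear_on (forms C) (tensor_space (basis H) (forms C)) R \<and>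
        (\<forall>h\<in>elems H. \<forall>g\<in>elems H. R (lact C h (dif C g)) =
           (\<Sum>(x, y)\<in>basis H \<times> basis H. \<Sum>(x', y')\<in>basis H \<times> basis H.
              (comult H h (x, y) * comult H g (x', y')) *\<^sub>C
                tens (bmult H y y') (lact C (bvec x) (dif C (bvec x'))))))"

section \<open>The group algebra and the codouble\<close>

definition group_algebra :: "('g, 'z) monoid_scheme \<Rightarrow> 'g based_algebra" where
  "group_algebra G = \<lparr>
     basis = carrier G,
     bmult = (\<lambda>g h. bvec (g \<otimes>\<^bsub>G\<^esub> h)),
     aone = bvec \<one>\<^bsub>G\<^esub>\<rparr>"

definition function_algebra :: "('g, 'z) monoid_scheme \<Rightarrow> 'g based_algebra" where
  "function_algebra G = \<lparr>
     basis = carrier G,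
     bmult = (\<lambda>f g. if f = g then bvec f else 0),
     aone = (\<Sum>f\<in>carrier G. bvec f)\<rparr>"

definition conj_by :: "('g, 'z) monoid_scheme \<Rightarrow> 'g \<Rightarrow> 'g \<Rightarrow> 'g" where
  "conj_by G f g = inv\<^bsub>G\<^esub> f \<otimes>\<^bsub>G\<^esub> g \<otimes>\<^bsub>G\<^esub> f"

text \<open>The Hopf algebra \<open>D\<^sup>\<or>(G)\<close>; the basis element \<open>(g, h)\<close> is \<open>\<delta>\<^sub>g \<otimes> h\<close>.\<close>

definition codouble :: "('g, 'z) monoid_scheme \<Rightarrow> ('g \<times> 'g) based_hopf_algebra" where
  "codouble G = based_algebra.extend (tensor_algebra (function_algebra G) (group_algebra G))
     (based_hopf_algebra.fields
       (\<lambda>(g, h). \<Sum>f\<in>carrier G.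
          bvec ((f, inv\<^bsub>G\<^esub> f \<otimes>\<^bsub>G\<^esub> g \<otimes>\<^bsub>G\<^esub> h \<otimes>\<^bsub>G\<^esub> inv\<^bsub>G\<^esub> g \<otimes>\<^bsub>G\<^esub> f), (inv\<^bsub>G\<^esub> f \<otimes>\<^bsub>G\<^esub> g, h)))
       (\<lambda>(g, h). if g = \<one>\<^bsub>G\<^esub> then 1 else 0)
       (\<lambda>(g, h). bvec (inv\<^bsub>G\<^esub> g, g \<otimes>\<^bsub>G\<^esub> inv\<^bsub>G\<^esub> h \<otimes>\<^bsub>G\<^esub> inv\<^bsub>G\<^esub> g)))"

definition codouble_covariant :: "('g, 'z) monoid_scheme \<Rightarrow> ('g, 'm::complex_vector) calculus \<Rightarrow> bool" where
  "codouble_covariant G C \<longleftrightarrow>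
     (\<exists>L. clinear_on (forms C) (tensor_space (basis (codouble G)) (forms C)) L \<and>
        (\<forall>h\<in>carrier G. \<forall>g\<in>carrier G. L (lact C (bvec h) (dif C (bvec g))) =
           (\<Sum>f\<in>carrier G. tens (bvec (f, conj_by G f (h \<otimes>\<^bsub>G\<^esub> g)))
              (lact C (bvec (conj_by G f h)) (dif C (bvec (conj_by G f g)))))))"

definition coaction :: "('g, 'z) monoid_scheme \<Rightarrow> ('g \<Rightarrow> complex) \<Rightarrow> ('g \<times> 'g) \<times> 'g \<Rightarrow> complex" where
  "coaction G a =
     (\<Sum>g\<in>carrier G. a g *\<^sub>C (\<Sum>f\<in>carrier G. bvec ((f, conj_by G f g), conj_by G f g)))"

definition codouble_embed :: "('g, 'z) monoid_scheme \<Rightarrow> ('g \<Rightarrow> complex) \<Rightarrow> 'g \<times> 'g \<Rightarrow> complex" where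
  "codouble_embed G a = (\<Sum>g\<in>carrier G. a g *\<^sub>C (\<Sum>f\<in>carrier G. bvec (f, conj_by G f g)))"

section \<open>Calculi from representations\<close>

text \<open>Endomorphisms of a subspace \<open>V\<close> are functions on the ambient type, normalised to be \<open>0\<close> off \<open>V\<close>,
  so that they are equal iff they agree on \<open>V\<close>.\<close>

definition End_space :: "'v::complex_vector set \<Rightarrow> ('v \<Rightarrow> 'v) set" where
  "End_space V = {T. clinear_on V V T \<and> (\<forall>x. x \<notin> V \<longrightarrow> T x = 0)}"

definition id_End :: "'v::complex_vector set \<Rightarrow> 'v \<Rightarrow> 'v" where
  "id_End V = (\<lambda>x. if x \<in> V then x else 0)"

definition group_rep ::
  "('g, 'z) monoid_scheme \<Rightarrow> 'v::complex_vector set \<Rightarrow> ('g \<Rightarrow> 'v \<Rightarrow> 'v) \<Rightarrow> bool" where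
  "group_rep G V \<rho> \<longleftrightarrow>
     complex_vec.subspace V \<and> \<rho> \<in> carrier G \<rightarrow> End_space V \<and>
     \<rho> \<one>\<^bsub>G\<^esub> = id_End V \<and>
     (\<forall>g\<in>carrier G. \<forall>h\<in>carrier G. \<rho> (g \<otimes>\<^bsub>G\<^esub> h) = \<rho> g \<circ> \<rho> h)"

definition rep_ext ::
  "('g, 'z) monoid_scheme \<Rightarrow> ('g \<Rightarrow> 'v \<Rightarrow> 'v::complex_vector) \<Rightarrow> ('g \<Rightarrow> complex) \<Rightarrow> 'v \<Rightarrow> 'v" where
  "rep_ext G \<rho> a = (\<Sum>g\<in>carrier G. a g *\<^sub>C \<rho> g)"

definition augmentation_ideal :: "('g, 'z) monoid_scheme \<Rightarrow> ('g \<Rightarrow> complex) set" where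
  "augmentation_ideal G = {a \<in> elems (group_algebra G). (\<Sum>g\<in>carrier G. a g) = 0}"

text \<open>The actions are the linear extensions of \<open>g(h \<otimes> x) = gh \<otimes> x\<close> and
  \<open>(h \<otimes> x)g = hg \<otimes> x \<rho>(g)\<close>.\<close>

definition rep_calculus ::
  "('g, 'z) monoid_scheme \<Rightarrow> 'v::complex_vector set \<Rightarrow> ('g \<Rightarrow> 'v \<Rightarrow> 'v) \<Rightarrow> ('g, 'g \<Rightarrow> 'v \<Rightarrow> 'v) calculus" where
  "rep_calculus G V \<rho> = \<lparr>
     forms = tensor_space (carrier G) (rep_ext G \<rho> ` augmentation_ideal G),
     lact = (\<lambda>a W. \<Sum>g\<in>carrier G. \<Sum>h\<in>carrier G. a g *\<^sub>C tens (bvec (g \<otimes>\<^bsub>G\<^esub> h)) (W h)),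
     ract = (\<lambda>W a. \<Sum>g\<in>carrier G. \<Sum>h\<in>carrier G. a g *\<^sub>C tens (bvec (h \<otimes>\<^bsub>G\<^esub> g)) (W h \<circ> \<rho> g)),
     dif = (\<lambda>a. \<Sum>g\<in>carrier G. a g *\<^sub>C tens (bvec g) (\<rho> g - id_End V))\<rparr>"

end

theory Submission
  imports Defs
begin

text \<open>
  A covariant calculus is graded by the group: the components of the coaction at the unit project onto the
  spans of the \<open>h dg\<close> with \<open>hg\<close> fixed. Hence the calculus is determined by the linear relations
  between the Maurer--Cartan forms \<open>g\<^sup>-\<^sup>1 dg\<close>. By the bimodule structure these form a right ideal inside
  the augmentation ideal, and the remaining components of the coaction make it stable under conjugation, hence
  two-sided. Right translation on the functions annihilated by a two-sided ideal inside the augmentation ideal is a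
  representation whose kernel meets the augmentation ideal exactly in the given ideal.

  The component of the coaction on \<open>\<Omega>\<^sup>1\<close> with values in \<open>D\<^sup>\<or>(G) \<otimes> \<Omega>\<^sup>1\<close> exists by covariance. The other
  component becomes \<open>\<Phi>(h) d\<Phi>(g)\<close> after applying the counit, and conversely it is obtained from
  \<open>\<Phi>(h) d\<Phi>(g)\<close> by the right coaction of the codouble, since \<open>\<Phi>\<close> intertwines the
  coproduct with the coaction.
\<close>

section \<open>Linear maps on spans of finite families\<close>

text \<open>No quotient is ever formed: a linear map with prescribed values on the finitely many
  forms \<open>h dg\<close> exists exactly when those values satisfy every linear relation among the
  \<open>h dg\<close>. Each existence claim thus becomes a comparison of relations. In
  \<open>\<Omega>\<^sub>\<rho>\<close> the form \<open>h dg\<close> sits in degree \<open>hg\<close>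
  with value \<open>\<rho>(g) - 1\<close>, so the relations split by degree there as well; an
  isomorphism asks for operators \<open>\<rho>(g) - 1\<close> with the same relations as the
  Maurer--Cartan forms. Conversely, conjugation by \<open>\<rho>(f)\<close> maps relations of
  \<open>\<Omega>\<^sub>\<rho>\<close> to relations, which is covariance.

  The functions annihilated by the ideal are the dual of \<open>CG\<close> modulo the ideal. Taking
  functions instead of cosets lets the representation live on a fixed type once the group is
  numbered.

  In the differentiability claim, compatibility with the actions comes for free: by the Leibniz
  rule, the prescribed values are multiplied by group elements according to the same formulas as the
  \<open>h dg\<close>. Only the existence of a linear map is at stake.\<close>

lemma scaleC_fun_apply [simp]: "(c *\<^sub>C f) x = c *\<^sub>C f x"
  by (simp add: scaleC_fun_def)

lemma minus_fun_apply [simp]: "(f - g) x = f x - g x" for f g :: "'a \<Rightarrow> 'b::ab_group_add"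
  by (metis fun_diff_def)

lemma sum_fun_apply [simp]: "(\<Sum>i\<in>I. F i) x = (\<Sum>i\<in>I. F i x)"
  for F :: "'i \<Rightarrow> 'a \<Rightarrow> 'b::comm_monoid_add"
  by (induction I rule: infinite_finite_induct) auto

lemma scaleC_complex [simp]: "c *\<^sub>C z = c * z" for z :: complex
  by (simp add: scaleC_complex_def)

lemma scaleC_pair [simp]: "c *\<^sub>C (a, b) = (c *\<^sub>C a, c *\<^sub>C b)"
  by (simp add: scaleC_prod_def)

lemmas scaleC_simps [simp] = scaleC_one complex_vec.scale_zero_left complex_vec.scale_zero_right
  scaleC_scaleC

lemma scaleC_if [simp]: "(if P then 1 else 0) *\<^sub>C x = (if P then x else 0)"
  by simp

text \<open>A single nonzero vector is independent, so the value 1 on it extends linearly. The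
  functional later turns a nonzero combination of Maurer--Cartan forms into a function on the group
  that detects it.\<close>

lemma separating_functional:
  fixes x :: "'a::complex_vector"
  assumes "x \<noteq> 0"
  obtains l :: "'a \<Rightarrow> complex" where "clinear_on UNIV UNIV l" "l x = 1"
proof -
  interpret P: vector_space_pair "scaleC :: complex \<Rightarrow> 'a \<Rightarrow> 'a" "scaleC :: complex \<Rightarrow> complex \<Rightarrow> complex"
    by unfold_locales
  have "complex_vec.independent {x}"
    using assms by simp
  from P.linear_independent_extend[OF this, of "\<lambda>_. 1"]
  obtain g :: "'a \<Rightarrow> complex" where g: "Vector_Spaces.linear (scaleC :: complex \<Rightarrow> 'a \<Rightarrow> 'a) scaleC g" "g x = 1"
    by auto
  then interpret g: Vector_Spaces.linear "scaleC :: complex \<Rightarrow> 'a \<Rightarrow> 'a" scaleC g by simp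
  show ?thesis
    by (rule that[of g]) (auto simp: clinear_on_def g.add g.scale g(2) scaleC_complex[symmetric] simp del: scaleC_complex)
qed

lemma clinear_onD:
  assumes "clinear_on V W f"
  shows "x \<in> V \<Longrightarrow> f x \<in> W" "x \<in> V \<Longrightarrow> y \<in> V \<Longrightarrow> f (x + y) = f x + f y" "x \<in> V \<Longrightarrow> f (c *\<^sub>C x) = c *\<^sub>C f x"
  using assms by (auto simp: clinear_on_def)

lemma clinear_on_zero:
  assumes "clinear_on V W f" "complex_vec.subspace V"
  shows "f 0 = 0"
  using clinear_onD(3)[OF assms(1), of 0 0] complex_vec.subspace_0[OF assms(2)] by simp

lemma if_zero_linear:
  assumes "clinear_on V W f" "complex_vec.subspace V"
  shows "f (if P then x else 0) = (if P then f x else 0)"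
  using clinear_on_zero[OF assms] by simp

lemma if_zero_in:
  "complex_vec.subspace W \<Longrightarrow> x \<in> W \<Longrightarrow> (if P then x else 0) \<in> W"
  by (simp add: complex_vec.subspace_0)

lemma clinear_on_sum:
  assumes f: "clinear_on V W f" and V: "complex_vec.subspace V" and x: "\<And>i. i \<in> I \<Longrightarrow> x i \<in> V"
  shows "f (\<Sum>i\<in>I. x i) = (\<Sum>i\<in>I. f (x i))"
  using x
proof (induction I rule: infinite_finite_induct)
  case (insert i I)
  then show ?case
    by (simp add: clinear_onD(2)[OF f] complex_vec.subspace_sum[OF V])
qed (simp_all add: clinear_on_zero[OF f V])

lemma clinear_on_lincomb:
  assumes f: "clinear_on V W f" and V: "complex_vec.subspace V" and x: "\<And>i. i \<in> I \<Longrightarrow> x i \<in> V"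
  shows "f (\<Sum>i\<in>I. c i *\<^sub>C x i) = (\<Sum>i\<in>I. c i *\<^sub>C f (x i))"
proof -
  have "f (\<Sum>i\<in>I. c i *\<^sub>C x i) = (\<Sum>i\<in>I. f (c i *\<^sub>C x i))"
    by (rule clinear_on_sum[OF f V]) (simp add: complex_vec.subspace_scale[OF V] x)
  then show ?thesis
    using x by (simp add: clinear_onD(3)[OF f])
qed

lemma clinear_on_diff:
  assumes f: "clinear_on V W f" and V: "complex_vec.subspace V" and xy: "x \<in> V" "y \<in> V"
  shows "f (x - y) = f x - f y"
proof -
  have "f ((x - y) + y) = f (x - y) + f y"
    by (rule clinear_onD(2)[OF f]) (use xy complex_vec.subspace_diff[OF V] in auto)
  then show ?thesis
    by simp
qed

lemma clinear_on_compose: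
  assumes "clinear_on U V f" "clinear_on V W g"
  shows "clinear_on U W (\<lambda>x. g (f x))"
  using assms by (auto simp: clinear_on_def Pi_iff)

lemma clinear_on_sumI:
  assumes "complex_vec.subspace W" "\<And>i. i \<in> I \<Longrightarrow> clinear_on V W (f i)"
  shows "clinear_on V W (\<lambda>x. \<Sum>i\<in>I. f i x)"
  unfolding clinear_on_def
proof (intro conjI ballI allI Pi_I)
  fix x assume "x \<in> V"
  then show "(\<Sum>i\<in>I. f i x) \<in> W"
    using clinear_onD(1)[OF assms(2)] assms(1) by (simp add: complex_vec.subspace_sum[OF assms(1)])
next
  fix x y assume "x \<in> V" "y \<in> V"
  then show "(\<Sum>i\<in>I. f i (x + y)) = (\<Sum>i\<in>I. f i x) + (\<Sum>i\<in>I. f i y)"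
    by (simp add: clinear_onD(2)[OF assms(2)] sum.distrib)
next
  fix c x assume "x \<in> V"
  then show "(\<Sum>i\<in>I. f i (c *\<^sub>C x)) = c *\<^sub>C (\<Sum>i\<in>I. f i x)"
    by (simp add: clinear_onD(3)[OF assms(2)] complex_vec.scale_sum_right)
qed

text \<open>Coefficients belong to indices, not to vectors: the \<open>h dg\<close> may coincide for
  different pairs, and relations among them are stated over the pairs.\<close>

lemma span_image_lincomb:
  assumes "finite I"
  shows "complex_vec.span (e ` I) = {\<Sum>i\<in>I. t i *\<^sub>C e i | t. True}" (is "_ = ?R")
proof (rule complex_vec.span_subspace)
  show "e ` I \<subseteq> ?R"
  proof
    fix x assume "x \<in> e ` I"
    then obtain j where j: "j \<in> I" "x = e j" by auto
    have "x = (\<Sum>i\<in>I. (if i = j then 1 else 0) *\<^sub>C e i)"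
      using assms j by simp
    then show "x \<in> ?R"
      by (intro CollectI exI[of _ "\<lambda>i. if i = j then 1 else 0"]) auto
  qed
  show "?R \<subseteq> complex_vec.span (e ` I)"
    by (auto intro!: complex_vec.span_sum complex_vec.span_scale intro: complex_vec.span_base)
  show "complex_vec.subspace ?R"
  proof (rule complex_vec.subspaceI)
    show "0 \<in> ?R"
      by (intro CollectI exI[of _ "\<lambda>_. 0"]) simp
  next
    fix x y assume "x \<in> ?R" "y \<in> ?R"
    then obtain t u where "x = (\<Sum>i\<in>I. t i *\<^sub>C e i)" "y = (\<Sum>i\<in>I. u i *\<^sub>C e i)" by auto
    then show "x + y \<in> ?R"
      by (intro CollectI exI[of _ "\<lambda>i. t i + u i"]) (simp add: scaleC_add_left sum.distrib)
  next
    fix c x assume "x \<in> ?R"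
    then obtain t where "x = (\<Sum>i\<in>I. t i *\<^sub>C e i)" by auto
    then show "c *\<^sub>C x \<in> ?R"
      by (intro CollectI exI[of _ "\<lambda>i. c * t i"]) (simp add: complex_vec.scale_sum_right)
  qed
qed

text \<open>Two coefficient families for the same vector differ by a relation of \<open>e\<close>,
  which \<open>wd\<close> carries over to \<open>v\<close>; so the coefficients picked by
  \<open>SOME\<close> are as good as any others. The family \<open>e\<close> may be linearly
  dependent.\<close>

lemma linear_extension:
  fixes e :: "'i \<Rightarrow> 'a::complex_vector" and v :: "'i \<Rightarrow> 'b::complex_vector"
  assumes fin: "finite I"
    and wd: "\<And>t. (\<Sum>i\<in>I. t i *\<^sub>C e i) = 0 \<Longrightarrow> (\<Sum>i\<in>I. t i *\<^sub>C v i) = 0"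
    and W: "complex_vec.subspace W" "\<And>i. i \<in> I \<Longrightarrow> v i \<in> W"
  obtains L where "clinear_on (complex_vec.span (e ` I)) W L"
    "\<And>t. L (\<Sum>i\<in>I. t i *\<^sub>C e i) = (\<Sum>i\<in>I. t i *\<^sub>C v i)" "\<And>i. i \<in> I \<Longrightarrow> L (e i) = v i"
proof -
  define L where "L w = (\<Sum>i\<in>I. (SOME t. w = (\<Sum>i\<in>I. t i *\<^sub>C e i)) i *\<^sub>C v i)" for w
  have L: "L (\<Sum>i\<in>I. t i *\<^sub>C e i) = (\<Sum>i\<in>I. t i *\<^sub>C v i)" for t
  proof -
    define u where "u = (SOME u. (\<Sum>i\<in>I. t i *\<^sub>C e i) = (\<Sum>i\<in>I. u i *\<^sub>C e i))"
    have "(\<Sum>i\<in>I. t i *\<^sub>C e i) = (\<Sum>i\<in>I. u i *\<^sub>C e i)"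
      unfolding u_def by (rule someI[of _ t]) simp
    then have "(\<Sum>i\<in>I. (u i - t i) *\<^sub>C e i) = 0"
      by (simp add: complex_vec.scale_left_diff_distrib sum_subtractf)
    then have "(\<Sum>i\<in>I. (u i - t i) *\<^sub>C v i) = 0"
      by (rule wd)
    then show ?thesis
      by (simp add: L_def u_def complex_vec.scale_left_diff_distrib sum_subtractf)
  qed
  have lin: "clinear_on (complex_vec.span (e ` I)) W L"
    unfolding clinear_on_def
  proof (intro conjI ballI allI Pi_I)
    fix x assume "x \<in> complex_vec.span (e ` I)"
    then obtain t where "x = (\<Sum>i\<in>I. t i *\<^sub>C e i)" by (auto simp: span_image_lincomb[OF fin])
    then show "L x \<in> W"
      using W by (auto simp: L intro!: complex_vec.subspace_sum complex_vec.subspace_scale)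
  next
    fix x y assume "x \<in> complex_vec.span (e ` I)" "y \<in> complex_vec.span (e ` I)"
    then obtain t u where tu: "x = (\<Sum>i\<in>I. t i *\<^sub>C e i)" "y = (\<Sum>i\<in>I. u i *\<^sub>C e i)"
      by (auto simp: span_image_lincomb[OF fin])
    then have "x + y = (\<Sum>i\<in>I. (t i + u i) *\<^sub>C e i)"
      by (simp add: scaleC_add_left sum.distrib)
    then show "L (x + y) = L x + L y"
      by (simp only: L tu) (simp add: scaleC_add_left sum.distrib)
  next
    fix c x assume "x \<in> complex_vec.span (e ` I)"
    then obtain t where t: "x = (\<Sum>i\<in>I. t i *\<^sub>C e i)" by (auto simp: span_image_lincomb[OF fin])
    then have "c *\<^sub>C x = (\<Sum>i\<in>I. (c * t i) *\<^sub>C e i)"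
      by (simp add: complex_vec.scale_sum_right)
    then show "L (c *\<^sub>C x) = c *\<^sub>C L x"
      by (simp only: L t) (simp add: complex_vec.scale_sum_right)
  qed
  have "L (e j) = v j" if "j \<in> I" for j
    using L[of "\<lambda>i. if i = j then 1 else 0"] fin that by simp
  with lin L show ?thesis by (rule that)
qed

lemma clinear_on_eq_span:
  assumes f: "clinear_on (complex_vec.span S) W f" and g: "clinear_on (complex_vec.span S) W' g"
    and eq: "\<And>x. x \<in> S \<Longrightarrow> f x = g x" and x: "x \<in> complex_vec.span S"
  shows "f x = g x"
proof -
  have "x \<in> complex_vec.span S \<and> f x = g x"
    using x
  proof (induction rule: complex_vec.span_induct_alt)
    case base
    then show ?case
      using clinear_on_zero[OF f] clinear_on_zero[OF g] complex_vec.span_zero by simp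
  next
    case (step c x y)
    then have "x \<in> complex_vec.span S" "c *\<^sub>C x \<in> complex_vec.span S"
      by (auto intro: complex_vec.span_base complex_vec.span_scale)
    with step eq show ?case
      by (simp add: clinear_onD[OF f] clinear_onD[OF g] complex_vec.span_add)
  qed
  then show ?thesis ..
qed

section \<open>Tensor products and calculi on based algebras\<close>

lemma bvec_apply: "bvec x y = (if y = x then 1 else 0)"
  by (simp add: bvec_def)

lemma tens_bvec: "tens (bvec x) m = (\<lambda>y. if y = x then m else 0)"
  by (auto simp: tens_def bvec_apply)

lemma subspace_tensor_space:
  "complex_vec.subspace M \<Longrightarrow> complex_vec.subspace (tensor_space X M)"
  by (rule complex_vec.subspaceI)
    (auto simp: tensor_space_def complex_vec.subspace_0 complex_vec.subspace_add complex_vec.subspace_scale)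

lemma subspace_elems: "complex_vec.subspace (elems A)"
  unfolding elems_def by (rule subspace_tensor_space) simp

lemma bvec_in_elems: "x \<in> basis A \<Longrightarrow> bvec x \<in> elems A"
  by (auto simp: elems_def tensor_space_def bvec_apply)

lemma elems_expand:
  assumes "finite (basis A)" "a \<in> elems A"
  shows "a = (\<Sum>x\<in>basis A. a x *\<^sub>C bvec x)"
proof
  fix y
  have "(\<Sum>x\<in>basis A. a x * bvec x y) = (\<Sum>x\<in>basis A. if y = x then a x else 0)"
    by (rule sum.cong) (auto simp: bvec_apply)
  then show "a y = (\<Sum>x\<in>basis A. a x *\<^sub>C bvec x) y"
    using assms by (auto simp: elems_def tensor_space_def)
qed

lemma amult_bvec:
  assumes "finite (basis A)" "x \<in> basis A" "y \<in> basis A"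
  shows "amult A (bvec x) (bvec y) = bmult A x y"
proof -
  have "amult A (bvec x) (bvec y) =
      (\<Sum>x'\<in>basis A. if x' = x then \<Sum>y'\<in>basis A. (if y' = y then bmult A x y' else 0) else 0)"
    unfolding amult_def by (intro sum.cong refl) (auto simp: bvec_apply intro!: sum.cong)
  also have "\<dots> = bmult A x y"
    using assms by (simp add: sum.delta)
  finally show ?thesis .
qed

lemma bimoduleD:
  assumes "is_bimodule A C"
  shows "complex_vec.subspace (forms C)"
    "a \<in> elems A \<Longrightarrow> clinear_on (forms C) (forms C) (\<lambda>w. lact C a w)"
    "a \<in> elems A \<Longrightarrow> clinear_on (forms C) (forms C) (\<lambda>w. ract C w a)"
    "w \<in> forms C \<Longrightarrow> clinear_on (elems A) (forms C) (\<lambda>a. lact C a w)"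
    "w \<in> forms C \<Longrightarrow> clinear_on (elems A) (forms C) (\<lambda>a. ract C w a)"
    "w \<in> forms C \<Longrightarrow> lact C (aone A) w = w"
    "w \<in> forms C \<Longrightarrow> ract C w (aone A) = w"
    "w \<in> forms C \<Longrightarrow> a \<in> elems A \<Longrightarrow> b \<in> elems A \<Longrightarrow> lact C (amult A a b) w = lact C a (lact C b w)"
    "w \<in> forms C \<Longrightarrow> a \<in> elems A \<Longrightarrow> b \<in> elems A \<Longrightarrow> ract C w (amult A a b) = ract C (ract C w a) b"
    "w \<in> forms C \<Longrightarrow> a \<in> elems A \<Longrightarrow> b \<in> elems A \<Longrightarrow> lact C a (ract C w b) = ract C (lact C a w) b"
  using assms by (auto simp: is_bimodule_def)

lemma calculusD:
  assumes "is_calculus A C"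
  shows "is_bimodule A C" "clinear_on (elems A) (forms C) (dif C)"
    "a \<in> elems A \<Longrightarrow> b \<in> elems A \<Longrightarrow> dif C (amult A a b) = ract C (dif C a) b + lact C a (dif C b)"
    "forms C = complex_vec.span {lact C a (dif C b) | a b. a \<in> elems A \<and> b \<in> elems A}"
  using assms by (auto simp: is_calculus_def)

lemma lact_expand:
  assumes C: "is_bimodule A C" and fin: "finite (basis A)" and a: "a \<in> elems A" and w: "w \<in> forms C"
  shows "lact C a w = (\<Sum>x\<in>basis A. a x *\<^sub>C lact C (bvec x) w)"
  using clinear_on_lincomb[OF bimoduleD(4)[OF C w] subspace_elems, of "basis A" bvec a]
    elems_expand[OF fin a] by (simp add: bvec_in_elems)

lemma ract_expand:
  assumes C: "is_bimodule A C" and fin: "finite (basis A)" and a: "a \<in> elems A" and w: "w \<in> forms C"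
  shows "ract C w a = (\<Sum>x\<in>basis A. a x *\<^sub>C ract C w (bvec x))"
  using clinear_on_lincomb[OF bimoduleD(5)[OF C w] subspace_elems, of "basis A" bvec a]
    elems_expand[OF fin a] by (simp add: bvec_in_elems)

lemma dif_expand:
  assumes C: "is_calculus A C" and fin: "finite (basis A)" and a: "a \<in> elems A"
  shows "dif C a = (\<Sum>x\<in>basis A. a x *\<^sub>C dif C (bvec x))"
  using clinear_on_lincomb[OF calculusD(2)[OF C] subspace_elems, of "basis A" bvec a]
    elems_expand[OF fin a] by (simp add: bvec_in_elems)

lemma lact_dif_expand:
  assumes C: "is_calculus A C" and fin: "finite (basis A)" and ab: "a \<in> elems A" "b \<in> elems A"
  shows "lact C a (dif C b) = (\<Sum>(x, y)\<in>basis A \<times> basis A. (a x * b y) *\<^sub>C lact C (bvec x) (dif C (bvec y)))"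
proof -
  note B = calculusD(1)[OF C]
  have d: "dif C b' \<in> forms C" if "b' \<in> elems A" for b'
    using clinear_onD(1)[OF calculusD(2)[OF C] that] .
  have "lact C (bvec x) (dif C b) = (\<Sum>y\<in>basis A. b y *\<^sub>C lact C (bvec x) (dif C (bvec y)))"
    if "x \<in> basis A" for x
    unfolding dif_expand[OF C fin ab(2)]
    by (rule clinear_on_lincomb[OF bimoduleD(2)[OF B] bimoduleD(1)[OF B]]) (simp_all add: that bvec_in_elems d)
  then show ?thesis
    by (simp add: lact_expand[OF B fin ab(1) d[OF ab(2)]] complex_vec.scale_sum_right
        sum.cartesian_product)
qed

text \<open>Bilinearity of \<open>a db\<close> in \<open>a\<close> and \<open>b\<close> replaces the
  infinite spanning set by a finite family, on which maps can be prescribed.\<close>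

lemma forms_eq_span_basis:
  assumes C: "is_calculus A C" and fin: "finite (basis A)"
  shows "forms C = complex_vec.span ((\<lambda>(x, y). lact C (bvec x) (dif C (bvec y))) ` (basis A \<times> basis A))"
    (is "_ = complex_vec.span ?B")
proof (rule antisym)
  let ?S = "{lact C a (dif C b) | a b. a \<in> elems A \<and> b \<in> elems A}"
  have "lact C (bvec x) (dif C (bvec y)) \<in> complex_vec.span ?B" if "x \<in> basis A" "y \<in> basis A" for x y
    by (rule complex_vec.span_base) (use that in force)
  then have "?S \<subseteq> complex_vec.span ?B"
    by (auto simp: lact_dif_expand[OF C fin] intro!: complex_vec.span_sum complex_vec.span_scale)
  then show "forms C \<subseteq> complex_vec.span ?B"
    unfolding calculusD(4)[OF C] by (intro complex_vec.span_minimal) auto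
  have "?B \<subseteq> ?S"
    using bvec_in_elems by fastforce
  then show "complex_vec.span ?B \<subseteq> forms C"
    unfolding calculusD(4)[OF C] by (rule complex_vec.span_mono)
qed

section \<open>Calculi on the group algebra of a finite group\<close>

lemma group_algebra_simps [simp]:
  "basis (group_algebra G) = carrier G"
  "bmult (group_algebra G) g h = bvec (g \<otimes>\<^bsub>G\<^esub> h)"
  "aone (group_algebra G) = bvec \<one>\<^bsub>G\<^esub>"
  by (simp_all add: group_algebra_def)

locale finite_group = group G for G (structure) +
  assumes finite_carrier [simp, intro]: "finite (carrier G)"
begin

abbreviation cj :: "'a \<Rightarrow> 'a \<Rightarrow> 'a" where "cj \<equiv> conj_by G"

lemma conj_closed [simp, intro]: "f \<in> carrier G \<Longrightarrow> g \<in> carrier G \<Longrightarrow> cj f g \<in> carrier G"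
  by (simp add: conj_by_def)

lemma mult_inv_cancel [simp]:
  "f \<in> carrier G \<Longrightarrow> x \<in> carrier G \<Longrightarrow> f \<otimes> (inv f \<otimes> x) = x"
  "f \<in> carrier G \<Longrightarrow> x \<in> carrier G \<Longrightarrow> inv f \<otimes> (f \<otimes> x) = x"
  by (simp_all add: m_assoc[symmetric])

lemma conj_mult:
  "f \<in> carrier G \<Longrightarrow> g \<in> carrier G \<Longrightarrow> h \<in> carrier G \<Longrightarrow> cj f (g \<otimes> h) = cj f g \<otimes> cj f h"
  by (simp add: conj_by_def m_assoc)

lemma conj_one [simp]: "f \<in> carrier G \<Longrightarrow> cj f \<one> = \<one>"
  by (simp add: conj_by_def)

lemma conj_by_one [simp]: "g \<in> carrier G \<Longrightarrow> cj \<one> g = g"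
  by (simp add: conj_by_def)

lemma conj_inv: "f \<in> carrier G \<Longrightarrow> g \<in> carrier G \<Longrightarrow> inv (cj f g) = cj f (inv g)"
  by (simp add: conj_by_def inv_mult_group m_assoc)

lemma conj_inv_conj [simp]: "f \<in> carrier G \<Longrightarrow> g \<in> carrier G \<Longrightarrow> cj (inv f) (cj f g) = g"
  by (simp add: conj_by_def m_assoc)

lemma conj_conj_inv [simp]: "f \<in> carrier G \<Longrightarrow> g \<in> carrier G \<Longrightarrow> cj f (cj (inv f) g) = g"
  using conj_inv_conj[of "inv f" g] by simp

lemma amult_group_bvec:
  "g \<in> carrier G \<Longrightarrow> h \<in> carrier G \<Longrightarrow> amult (group_algebra G) (bvec g) (bvec h) = bvec (g \<otimes> h)"
  by (simp add: amult_bvec)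

lemma sum_mult_left:
  "g \<in> carrier G \<Longrightarrow> (\<Sum>h\<in>carrier G. f (g \<otimes> h)) = (\<Sum>h\<in>carrier G. f h)" for f :: "'a \<Rightarrow> 'n::comm_monoid_add"
  by (rule sum.reindex_bij_witness[where i="\<lambda>h. inv g \<otimes> h" and j="\<lambda>h. g \<otimes> h"])
    (simp_all add: m_assoc[symmetric])

lemma sum_mult_right:
  "g \<in> carrier G \<Longrightarrow> (\<Sum>h\<in>carrier G. f (h \<otimes> g)) = (\<Sum>h\<in>carrier G. f h)" for f :: "'a \<Rightarrow> 'n::comm_monoid_add"
  by (rule sum.reindex_bij_witness[where i="\<lambda>h. h \<otimes> inv g" and j="\<lambda>h. h \<otimes> g"])
    (simp_all add: m_assoc)

text \<open>Moves a translation to the other side of an equation, so that the support conditions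
  produced by an action become conditions on a product, the form in which the expected values are
  written.\<close>

lemma translate_iff:
  assumes "k \<in> carrier G" "x \<in> carrier G" "q \<in> carrier G"
  shows "x = inv k \<otimes> q \<longleftrightarrow> k \<otimes> x = q" "x = q \<otimes> inv k \<longleftrightarrow> x \<otimes> k = q"
proof -
  show "x = inv k \<otimes> q \<longleftrightarrow> k \<otimes> x = q"
    using assms by auto
  show "x = q \<otimes> inv k \<longleftrightarrow> x \<otimes> k = q"
    using inv_solve_right[of x q k] assms by metis
qed

text \<open>Left translation permutes the basis, so only \<open>q = inv k \<otimes> x\<close>
  contributes at \<open>x\<close>.\<close>

lemma sum_tens_left:
  assumes "k \<in> carrier G"
  shows "(\<Sum>q\<in>carrier G. tens (bvec (k \<otimes> q)) (F q)) x = (if x \<in> carrier G then F (inv k \<otimes> x) else 0)"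
proof -
  have "(\<Sum>q\<in>carrier G. tens (bvec (k \<otimes> q)) (F q)) x = (\<Sum>q\<in>carrier G. if q = inv k \<otimes> x \<and> x \<in> carrier G then F q else 0)"
    using assms by (subst sum_fun_apply, intro sum.cong refl) (auto simp: tens_bvec)
  then show ?thesis
    using assms by (cases "x \<in> carrier G") simp_all
qed

lemma sum_tens_right:
  assumes "k \<in> carrier G"
  shows "(\<Sum>q\<in>carrier G. tens (bvec (q \<otimes> k)) (F q)) x = (if x \<in> carrier G then F (x \<otimes> inv k) else 0)"
proof -
  have "(\<Sum>q\<in>carrier G. tens (bvec (q \<otimes> k)) (F q)) x = (\<Sum>q\<in>carrier G. if q = x \<otimes> inv k \<and> x \<in> carrier G then F q else 0)"
    using assms by (subst sum_fun_apply, intro sum.cong refl) (auto simp: tens_bvec m_assoc)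
  then show ?thesis
    using assms by (cases "x \<in> carrier G") simp_all
qed

end

section \<open>The generators h dg of a calculus on the group algebra\<close>

locale group_calculus = finite_group G for G :: "('g, 'z) monoid_scheme" (structure) +
  fixes \<Omega> :: "('g, 'm::complex_vector) calculus"
  assumes calculus: "is_calculus (group_algebra G) \<Omega>"
begin

lemmas bimod = calculusD(1)[OF calculus]

lemmas subspace_forms = bimoduleD(1)[OF bimod]

lemma group_bvec_in_elems [simp]: "g \<in> carrier G \<Longrightarrow> bvec g \<in> elems (group_algebra G)"
  by (simp add: bvec_in_elems)

definition gen :: "'g \<Rightarrow> 'g \<Rightarrow> 'm" where
  "gen h g = lact \<Omega> (bvec h) (dif \<Omega> (bvec g))"

abbreviation gact :: "'g \<Rightarrow> 'm \<Rightarrow> 'm" where "gact g \<equiv> lact \<Omega> (bvec g)"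
abbreviation gactr :: "'m \<Rightarrow> 'g \<Rightarrow> 'm" where "gactr w g \<equiv> ract \<Omega> w (bvec g)"

lemma gact_linear: "g \<in> carrier G \<Longrightarrow> clinear_on (forms \<Omega>) (forms \<Omega>) (gact g)"
  using bimoduleD(2)[OF bimod] by simp

lemma gactr_linear: "g \<in> carrier G \<Longrightarrow> clinear_on (forms \<Omega>) (forms \<Omega>) (\<lambda>w. gactr w g)"
  using bimoduleD(3)[OF bimod] by simp

lemma dif_bvec_in [simp]: "g \<in> carrier G \<Longrightarrow> dif \<Omega> (bvec g) \<in> forms \<Omega>"
  using clinear_onD(1)[OF calculusD(2)[OF calculus]] by simp

lemma gact_in [simp]: "g \<in> carrier G \<Longrightarrow> w \<in> forms \<Omega> \<Longrightarrow> gact g w \<in> forms \<Omega>"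
  using clinear_onD(1)[OF gact_linear] .

lemma gactr_in [simp]: "g \<in> carrier G \<Longrightarrow> w \<in> forms \<Omega> \<Longrightarrow> gactr w g \<in> forms \<Omega>"
  using clinear_onD(1)[OF gactr_linear] .

lemma gen_in [simp]: "h \<in> carrier G \<Longrightarrow> g \<in> carrier G \<Longrightarrow> gen h g \<in> forms \<Omega>"
  by (simp add: gen_def)

lemma gact_mult:
  "g \<in> carrier G \<Longrightarrow> h \<in> carrier G \<Longrightarrow> w \<in> forms \<Omega> \<Longrightarrow> gact (g \<otimes> h) w = gact g (gact h w)"
  using bimoduleD(8)[OF bimod, of w "bvec g" "bvec h"] by (simp add: amult_group_bvec)

lemma gact_one [simp]: "w \<in> forms \<Omega> \<Longrightarrow> gact \<one> w = w"
  using bimoduleD(6)[OF bimod] by simp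

lemma gact_gen: "k \<in> carrier G \<Longrightarrow> h \<in> carrier G \<Longrightarrow> g \<in> carrier G \<Longrightarrow> gact k (gen h g) = gen (k \<otimes> h) g"
  by (simp add: gen_def gact_mult)

lemma dif_mult:
  "g \<in> carrier G \<Longrightarrow> h \<in> carrier G \<Longrightarrow>
    dif \<Omega> (bvec (g \<otimes> h)) = gactr (dif \<Omega> (bvec g)) h + gact g (dif \<Omega> (bvec h))"
  using calculusD(3)[OF calculus, of "bvec g" "bvec h"] by (simp add: amult_group_bvec)

lemma dif_bvec: "g \<in> carrier G \<Longrightarrow> dif \<Omega> (bvec g) = gen \<one> g"
  by (simp add: gen_def)

text \<open>The Leibniz rule in the form \<open>(dg) k = d(gk) - g dk\<close>, multiplied by
  \<open>h\<close> from the left. It expresses the right action on the generators through generators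
  again; every family of values for the \<open>h dg\<close> met below obeys the same
  formula.\<close>

lemma gactr_gen:
  assumes "h \<in> carrier G" "g \<in> carrier G" "k \<in> carrier G"
  shows "gactr (gen h g) k = gen h (g \<otimes> k) - gen (h \<otimes> g) k"
proof -
  have "gactr (gen h g) k = gact h (gactr (dif \<Omega> (bvec g)) k)"
    unfolding gen_def using bimoduleD(10)[OF bimod, of "dif \<Omega> (bvec g)" "bvec h" "bvec k"] assms by simp
  also have "gactr (dif \<Omega> (bvec g)) k = dif \<Omega> (bvec (g \<otimes> k)) - gact g (dif \<Omega> (bvec k))"
    using dif_mult[of g k] assms by simp
  also have "gact h \<dots> = gen h (g \<otimes> k) - gact h (gact g (dif \<Omega> (bvec k)))"
    unfolding gen_def using assms by (simp add: clinear_on_diff[OF gact_linear subspace_forms])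
  also have "gact h (gact g (dif \<Omega> (bvec k))) = gen (h \<otimes> g) k"
    unfolding gen_def using assms by (simp add: gact_mult)
  finally show ?thesis .
qed

text \<open>This is \<open>d1 = 0\<close>: at \<open>g = k = \<one>\<close> the formula for the
  right action has two equal terms on the right, while the unit acts trivially on the left.\<close>

lemma gen_one_right: "h \<in> carrier G \<Longrightarrow> gen h \<one> = 0"
  using gactr_gen[of h \<one> \<one>] bimoduleD(7)[OF bimod, of "gen h \<one>"] by simp

abbreviation gens :: "'m set" where
  "gens \<equiv> (\<lambda>(h, g). gen h g) ` (carrier G \<times> carrier G)"

lemma forms_eq_span: "forms \<Omega> = complex_vec.span gens"
  using forms_eq_span_basis[OF calculus] by (simp add: gen_def)

lemma forms_eq_lincomb:
  "forms \<Omega> = {\<Sum>(h, g)\<in>carrier G \<times> carrier G. t (h, g) *\<^sub>C gen h g | t. True}"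
  using span_image_lincomb[of "carrier G \<times> carrier G" "\<lambda>(h, g). gen h g"]
  by (simp add: forms_eq_span case_prod_unfold)

lemma linear_eqI:
  assumes "clinear_on (forms \<Omega>) W f" "clinear_on (forms \<Omega>) W' f'"
    and "\<And>h g. h \<in> carrier G \<Longrightarrow> g \<in> carrier G \<Longrightarrow> f (gen h g) = f' (gen h g)"
    and "w \<in> forms \<Omega>"
  shows "f w = f' w"
proof (rule clinear_on_eq_span[where f = f and g = f' and x = w and S = gens])
  show "clinear_on (complex_vec.span gens) W f" "clinear_on (complex_vec.span gens) W' f'"
    "w \<in> complex_vec.span gens"
    using assms by (simp_all add: forms_eq_span)
  show "f x = f' x" if "x \<in> gens" for x
    using that assms(3) by auto
qed

text \<open>The working form of "well defined on the forms". The last conjunct gives the image of a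
  combination with the same coefficients, from which kernel and image of the map can be read
  off.\<close>

lemma linear_exists:
  assumes "complex_vec.subspace W" "\<And>h g. h \<in> carrier G \<Longrightarrow> g \<in> carrier G \<Longrightarrow> v h g \<in> W"
    and "\<And>t. (\<Sum>(h, g)\<in>carrier G \<times> carrier G. t (h, g) *\<^sub>C gen h g) = 0 \<Longrightarrow>
          (\<Sum>(h, g)\<in>carrier G \<times> carrier G. t (h, g) *\<^sub>C v h g) = 0"
  shows "\<exists>L. clinear_on (forms \<Omega>) W L \<and>
    (\<forall>h\<in>carrier G. \<forall>g\<in>carrier G. L (gen h g) = v h g) \<and>
    (\<forall>t. L (\<Sum>(h, g)\<in>carrier G \<times> carrier G. t (h, g) *\<^sub>C gen h g)
       = (\<Sum>(h, g)\<in>carrier G \<times> carrier G. t (h, g) *\<^sub>C v h g))"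
proof -
  obtain L where L: "clinear_on (complex_vec.span ((\<lambda>(h, g). gen h g) ` (carrier G \<times> carrier G))) W L"
    "\<And>t. L (\<Sum>i\<in>carrier G \<times> carrier G. t i *\<^sub>C (case i of (h, g) \<Rightarrow> gen h g))
       = (\<Sum>i\<in>carrier G \<times> carrier G. t i *\<^sub>C (case i of (h, g) \<Rightarrow> v h g))"
    "\<And>i. i \<in> carrier G \<times> carrier G \<Longrightarrow> L (case i of (h, g) \<Rightarrow> gen h g) = (case i of (h, g) \<Rightarrow> v h g)"
    by (rule linear_extension[of "carrier G \<times> carrier G" "\<lambda>(h, g). gen h g" "\<lambda>(h, g). v h g" W])
      (use assms in \<open>auto simp: case_prod_unfold\<close>)
  show ?thesis
    by (intro exI[of _ L]) (use L in \<open>auto simp: forms_eq_span case_prod_unfold\<close>)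
qed

text \<open>Both sides of each compatibility are linear in the form, so they need only be compared
  on the generators, where \<open>lg\<close> and \<open>rg\<close> mirror \<open>gact_gen\<close>
  and \<open>gactr_gen\<close>. The target is not assumed to be a bimodule, only to act linearly
  along \<open>\<phi>\<close>; this makes the rule applicable to the tensor product calculus without
  proving its bimodule axioms.\<close>

lemma bimodule_mapI:
  fixes C' :: "('c, 'n::complex_vector) calculus"
  assumes W: "complex_vec.subspace (forms C')"
    and \<theta>: "clinear_on (forms \<Omega>) (forms C') \<theta>"
    and l: "\<And>a w. a \<in> elems (group_algebra G) \<Longrightarrow> w \<in> forms C' \<Longrightarrow>
        lact C' (\<phi> a) w = (\<Sum>g\<in>carrier G. a g *\<^sub>C lact C' (\<phi> (bvec g)) w)"
    and r: "\<And>a w. a \<in> elems (group_algebra G) \<Longrightarrow> w \<in> forms C' \<Longrightarrow>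
        ract C' w (\<phi> a) = (\<Sum>g\<in>carrier G. a g *\<^sub>C ract C' w (\<phi> (bvec g)))"
    and ll: "\<And>g. g \<in> carrier G \<Longrightarrow> clinear_on (forms C') (forms C') (lact C' (\<phi> (bvec g)))"
    and rl: "\<And>g. g \<in> carrier G \<Longrightarrow> clinear_on (forms C') (forms C') (\<lambda>w. ract C' w (\<phi> (bvec g)))"
    and lg: "\<And>g h k. g \<in> carrier G \<Longrightarrow> h \<in> carrier G \<Longrightarrow> k \<in> carrier G \<Longrightarrow>
        lact C' (\<phi> (bvec g)) (\<theta> (gen h k)) = \<theta> (gen (g \<otimes> h) k)"
    and rg: "\<And>g h k. g \<in> carrier G \<Longrightarrow> h \<in> carrier G \<Longrightarrow> k \<in> carrier G \<Longrightarrow>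
        ract C' (\<theta> (gen h k)) (\<phi> (bvec g)) = \<theta> (gen h (k \<otimes> g)) - \<theta> (gen (h \<otimes> k) g)"
  shows "bimodule_map (group_algebra G) \<Omega> C' \<phi> \<theta>"
  unfolding bimodule_map_def
proof (intro conjI ballI \<theta>)
  fix a w assume a: "a \<in> elems (group_algebra G)" and w: "w \<in> forms \<Omega>"
  have "\<theta> (gact g w) = lact C' (\<phi> (bvec g)) (\<theta> w)" if "g \<in> carrier G" for g
    using clinear_on_compose[OF gact_linear[OF that] \<theta>] clinear_on_compose[OF \<theta> ll[OF that]] _ w
    by (rule linear_eqI) (simp add: gact_gen lg that)
  then show "\<theta> (lact \<Omega> a w) = lact C' (\<phi> a) (\<theta> w)"
    using w l[OF a clinear_onD(1)[OF \<theta> w]] r[OF a clinear_onD(1)[OF \<theta> w]]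
    by (simp add: lact_expand[OF bimod _ a w] clinear_on_lincomb[OF \<theta> subspace_forms])
  have "\<theta> (gactr w g) = ract C' (\<theta> w) (\<phi> (bvec g))" if "g \<in> carrier G" for g
    using clinear_on_compose[OF gactr_linear[OF that] \<theta>] clinear_on_compose[OF \<theta> rl[OF that]] _ w
    by (rule linear_eqI) (simp add: gactr_gen rg that clinear_on_diff[OF \<theta> subspace_forms])
  then show "\<theta> (ract \<Omega> w a) = ract C' (\<theta> w) (\<phi> a)"
    using w l[OF a clinear_onD(1)[OF \<theta> w]] r[OF a clinear_onD(1)[OF \<theta> w]]
    by (simp add: ract_expand[OF bimod _ a w] clinear_on_lincomb[OF \<theta> subspace_forms])
qed

end

lemma basis_codouble [simp]: "basis (codouble G) = carrier G \<times> carrier G"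
  by (simp add: codouble_def based_algebra.defs tensor_algebra_def function_algebra_def)

text \<open>For each \<open>g\<close> the equation \<open>h \<otimes> g = x\<close> has the single
  solution \<open>h = x \<otimes> inv g\<close>. This is where the coefficients
  \<open>t (x \<otimes> inv g, g)\<close> of a homogeneous component come from.\<close>

lemma (in finite_group) sum_fibre:
  fixes F :: "'a \<Rightarrow> 'a \<Rightarrow> 'n::comm_monoid_add"
  assumes "x \<in> carrier G"
  shows "(\<Sum>(h, g)\<in>carrier G \<times> carrier G. if h \<otimes> g = x then F h g else 0) = (\<Sum>g\<in>carrier G. F (x \<otimes> inv g) g)"
proof -
  have "(\<Sum>(h, g)\<in>carrier G \<times> carrier G. if h \<otimes> g = x then F h g else 0)
      = (\<Sum>g\<in>carrier G. \<Sum>h\<in>carrier G. if h \<otimes> g = x then F h g else 0)"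
    unfolding sum.cartesian_product[symmetric] by (rule sum.swap)
  also have "\<dots> = (\<Sum>g\<in>carrier G. \<Sum>h\<in>carrier G. if h = x \<otimes> inv g then F h g else 0)"
    using assms by (intro sum.cong refl if_cong) (auto simp: m_assoc)
  finally show ?thesis
    using assms by simp
qed

section \<open>The calculus of a representation\<close>

locale finite_group_rep = finite_group G for G :: "('g, 'z) monoid_scheme" (structure) +
  fixes V :: "'v::complex_vector set" and \<rho> :: "'g \<Rightarrow> 'v \<Rightarrow> 'v"
  assumes rep: "group_rep G V \<rho>"
begin

abbreviation "\<Omega>\<rho> \<equiv> rep_calculus G V \<rho>"

lemma subspace_V: "complex_vec.subspace V"
  using rep by (simp add: group_rep_def)

lemma rep_linear: "g \<in> carrier G \<Longrightarrow> clinear_on V V (\<rho> g)"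
  using rep by (auto simp: group_rep_def End_space_def)

lemma rep_outside: "g \<in> carrier G \<Longrightarrow> v \<notin> V \<Longrightarrow> \<rho> g v = 0"
  using rep by (auto simp: group_rep_def End_space_def)

lemma rep_in: "g \<in> carrier G \<Longrightarrow> \<rho> g v \<in> V"
  using clinear_onD(1)[OF rep_linear, of g v] rep_outside[of g v] complex_vec.subspace_0[OF subspace_V]
  by metis

lemma rep_one: "\<rho> \<one> = id_End V"
  using rep by (simp add: group_rep_def)

lemma rep_mult: "g \<in> carrier G \<Longrightarrow> h \<in> carrier G \<Longrightarrow> \<rho> (g \<otimes> h) = \<rho> g \<circ> \<rho> h"
  using rep by (simp add: group_rep_def)

lemma rep_mult_apply: "g \<in> carrier G \<Longrightarrow> h \<in> carrier G \<Longrightarrow> \<rho> g (\<rho> h v) = \<rho> (g \<otimes> h) v"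
  by (simp add: rep_mult)

text \<open>The form \<open>h dg\<close> of the representation calculus, already multiplied out:
  since \<open>dg\<close> is \<open>g \<otimes> (\<rho>(g) - 1)\<close>, it is concentrated at the
  group element \<open>hg\<close>.\<close>

definition rgen :: "'g \<Rightarrow> 'g \<Rightarrow> 'g \<Rightarrow> 'v \<Rightarrow> 'v" where
  "rgen h g = tens (bvec (h \<otimes> g)) (\<rho> g - id_End V)"

lemma rgen_apply: "rgen h g x = (if h \<otimes> g = x then \<rho> g - id_End V else 0)"
  by (auto simp: rgen_def tens_bvec)

lemma lact_rep:
  assumes "g \<in> carrier G"
  shows "lact \<Omega>\<rho> (bvec g) W = (\<lambda>x. if x \<in> carrier G then W (inv g \<otimes> x) else 0)"
  by (rule ext) (simp add: rep_calculus_def bvec_apply assms sum_tens_left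
      del: sum_fun_apply flip: complex_vec.scale_sum_right)

lemma ract_rep:
  assumes "g \<in> carrier G"
  shows "ract \<Omega>\<rho> W (bvec g) = (\<lambda>x. if x \<in> carrier G then W (x \<otimes> inv g) \<circ> \<rho> g else 0)"
  by (rule ext) (simp add: rep_calculus_def bvec_apply assms sum_tens_right
      del: sum_fun_apply flip: complex_vec.scale_sum_right)

lemma dif_rep: "g \<in> carrier G \<Longrightarrow> dif \<Omega>\<rho> (bvec g) = rgen \<one> g"
  by (simp add: rep_calculus_def bvec_apply rgen_def)

lemma lact_expand_rep: "lact \<Omega>\<rho> a W = (\<Sum>g\<in>carrier G. a g *\<^sub>C lact \<Omega>\<rho> (bvec g) W)"
  by (simp add: rep_calculus_def bvec_apply flip: complex_vec.scale_sum_right)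

lemma ract_expand_rep: "ract \<Omega>\<rho> W a = (\<Sum>g\<in>carrier G. a g *\<^sub>C ract \<Omega>\<rho> W (bvec g))"
  by (simp add: rep_calculus_def bvec_apply flip: complex_vec.scale_sum_right)

lemma lact_rgen:
  "k \<in> carrier G \<Longrightarrow> h \<in> carrier G \<Longrightarrow> g \<in> carrier G \<Longrightarrow> lact \<Omega>\<rho> (bvec k) (rgen h g) = rgen (k \<otimes> h) g"
proof
  assume assms: "k \<in> carrier G" "h \<in> carrier G" "g \<in> carrier G"
  show "lact \<Omega>\<rho> (bvec k) (rgen h g) x = rgen (k \<otimes> h) g x" for x
  proof (cases "x \<in> carrier G")
    case True
    then have "h \<otimes> g = inv k \<otimes> x \<longleftrightarrow> k \<otimes> h \<otimes> g = x"
      using assms by (auto simp: m_assoc inv_solve_left)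
    then show ?thesis
      using True assms by (simp add: lact_rep rgen_apply)
  next
    case False
    then have "k \<otimes> h \<otimes> g \<noteq> x"
      using assms by auto
    then show ?thesis
      using False assms by (simp add: lact_rep rgen_apply)
  qed
qed

text \<open>The operator identity behind it is \<open>(\<rho>(g) - 1) \<rho>(k) = (\<rho>(gk) - 1) -
  (\<rho>(k) - 1)\<close>; all three terms sit at the same group element \<open>hgk\<close>.\<close>

lemma ract_rgen:
  assumes "k \<in> carrier G" "h \<in> carrier G" "g \<in> carrier G"
  shows "ract \<Omega>\<rho> (rgen h g) (bvec k) = rgen h (g \<otimes> k) - rgen (h \<otimes> g) k"
proof
  fix x
  have "(\<rho> g - id_End V) \<circ> \<rho> k = \<rho> (g \<otimes> k) - \<rho> k"
    using assms by (simp add: rep_mult fun_eq_iff id_End_def rep_in)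
  then have comp: "(\<rho> g - id_End V) \<circ> \<rho> k = (\<rho> (g \<otimes> k) - id_End V) - (\<rho> k - id_End V)"
    by simp
  show "ract \<Omega>\<rho> (rgen h g) (bvec k) x = (rgen h (g \<otimes> k) - rgen (h \<otimes> g) k) x"
  proof (cases "h \<otimes> g \<otimes> k = x")
    case True
    then have "x \<in> carrier G" "h \<otimes> g = x \<otimes> inv k" "h \<otimes> (g \<otimes> k) = x"
      using assms by (auto simp: m_assoc)
    then show ?thesis
      using assms comp by (simp add: ract_rep rgen_apply m_assoc)
  next
    case False
    then have "x \<in> carrier G \<Longrightarrow> h \<otimes> g \<noteq> x \<otimes> inv k"
      using assms by (auto simp: m_assoc dest: arg_cong[where f = "\<lambda>y. y \<otimes> k"])
    then show ?thesis
      using False assms by (simp add: ract_rep rgen_apply m_assoc fun_eq_iff)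
  qed
qed

abbreviation "coeffs \<equiv> rep_ext G \<rho> ` augmentation_ideal G"

lemma subspace_coeffs: "complex_vec.subspace coeffs"
proof (rule complex_vec.subspaceI)
  have "rep_ext G \<rho> 0 = 0"
    by (simp add: rep_ext_def)
  moreover have "0 \<in> augmentation_ideal G"
    by (simp add: augmentation_ideal_def complex_vec.subspace_0[OF subspace_elems])
  ultimately show "0 \<in> coeffs"
    by (metis image_eqI)
next
  fix x y assume "x \<in> coeffs" "y \<in> coeffs"
  then obtain a b where ab: "a \<in> augmentation_ideal G" "x = rep_ext G \<rho> a"
    "b \<in> augmentation_ideal G" "y = rep_ext G \<rho> b" by auto
  have "x + y = rep_ext G \<rho> (a + b)"
    by (simp add: ab rep_ext_def scaleC_add_left sum.distrib)
  moreover have "a + b \<in> augmentation_ideal G"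
    using ab by (simp add: augmentation_ideal_def complex_vec.subspace_add[OF subspace_elems] sum.distrib)
  ultimately show "x + y \<in> coeffs" by simp
next
  fix c x assume "x \<in> coeffs"
  then obtain a where a: "a \<in> augmentation_ideal G" "x = rep_ext G \<rho> a" by auto
  have "c *\<^sub>C x = rep_ext G \<rho> (c *\<^sub>C a)"
    by (simp add: a rep_ext_def complex_vec.scale_sum_right)
  moreover have "c *\<^sub>C a \<in> augmentation_ideal G"
    using a by (simp add: augmentation_ideal_def complex_vec.subspace_scale[OF subspace_elems] flip: sum_distrib_left)
  ultimately show "c *\<^sub>C x \<in> coeffs" by simp
qed

lemma forms_rep: "forms \<Omega>\<rho> = tensor_space (carrier G) coeffs"
  by (simp add: rep_calculus_def)

lemma subspace_forms_rep: "complex_vec.subspace (forms \<Omega>\<rho>)"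
  by (simp add: forms_rep subspace_tensor_space subspace_coeffs)

text \<open>On the augmentation ideal, subtracting the identity from each \<open>\<rho> g\<close>
  changes nothing because the coefficients add up to 0; conversely
  \<open>\<rho> g - id_End V\<close> is the image of \<open>g - 1\<close>. In this description the
  coefficients are unconstrained.\<close>

lemma coeffs_eq: "coeffs = {\<Sum>g\<in>carrier G. b g *\<^sub>C (\<rho> g - id_End V) | b. True}"
proof (intro equalityI subsetI)
  fix x assume "x \<in> coeffs"
  then obtain a where a: "a \<in> augmentation_ideal G" "x = rep_ext G \<rho> a" by auto
  then have "x = (\<Sum>g\<in>carrier G. a g *\<^sub>C (\<rho> g - id_End V))"
    by (simp add: augmentation_ideal_def rep_ext_def complex_vec.scale_right_diff_distrib sum_subtractf
        flip: complex_vec.scale_sum_left)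
  then show "x \<in> {\<Sum>g\<in>carrier G. b g *\<^sub>C (\<rho> g - id_End V) | b. True}"
    by auto
next
  fix x assume "x \<in> {\<Sum>g\<in>carrier G. b g *\<^sub>C (\<rho> g - id_End V) | b. True}"
  then obtain b where b: "x = (\<Sum>g\<in>carrier G. b g *\<^sub>C (\<rho> g - id_End V))"
    by auto
  have "\<rho> g - id_End V \<in> coeffs" if g: "g \<in> carrier G" for g
  proof (rule image_eqI)
    show "\<rho> g - id_End V = rep_ext G \<rho> (bvec g - bvec \<one>)"
      using g by (simp add: rep_ext_def complex_vec.scale_left_diff_distrib sum_subtractf bvec_apply rep_one)
    show "bvec g - bvec \<one> \<in> augmentation_ideal G"
      using g by (simp add: augmentation_ideal_def complex_vec.subspace_diff[OF subspace_elems]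
          bvec_in_elems sum_subtractf bvec_apply)
  qed
  then show "x \<in> coeffs"
    unfolding b by (intro complex_vec.subspace_sum complex_vec.subspace_scale subspace_coeffs) auto
qed

lemma rgen_in: "h \<in> carrier G \<Longrightarrow> g \<in> carrier G \<Longrightarrow> rgen h g \<in> forms \<Omega>\<rho>"
proof -
  assume hg: "h \<in> carrier G" "g \<in> carrier G"
  have "\<rho> g - id_End V = (\<Sum>k\<in>carrier G. (if k = g then 1 else 0) *\<^sub>C (\<rho> k - id_End V))"
    using hg by simp
  then have "\<rho> g - id_End V \<in> coeffs"
    unfolding coeffs_eq by (intro CollectI exI[of _ "\<lambda>k. if k = g then 1 else 0"]) simp
  then show ?thesis
    using hg complex_vec.subspace_0[OF subspace_coeffs] by (auto simp: forms_rep tensor_space_def rgen_apply)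
qed

text \<open>Evaluation at \<open>x\<close> selects the generators with \<open>hg = x\<close>, so a
  relation among the \<open>rgen\<close> amounts to one independent operator relation for each group
  element.\<close>

lemma sum_rgen_apply:
  assumes "x \<in> carrier G"
  shows "(\<Sum>(h, g)\<in>carrier G \<times> carrier G. t (h, g) *\<^sub>C rgen h g) x
    = (\<Sum>g\<in>carrier G. t (x \<otimes> inv g, g) *\<^sub>C (\<rho> g - id_End V))"
proof -
  have "(\<Sum>(h, g)\<in>carrier G \<times> carrier G. t (h, g) *\<^sub>C rgen h g) x
      = (\<Sum>(h, g)\<in>carrier G \<times> carrier G. if h \<otimes> g = x then t (h, g) *\<^sub>C (\<rho> g - id_End V) else 0)"
    by (subst sum_fun_apply, rule sum.cong) (auto simp: rgen_apply)
  then show ?thesis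
    by (simp add: sum_fibre[OF assms])
qed

lemma forms_rep_lincomb:
  assumes W: "W \<in> forms \<Omega>\<rho>"
  obtains t where "W = (\<Sum>(h, g)\<in>carrier G \<times> carrier G. t (h, g) *\<^sub>C rgen h g)"
proof -
  have "\<forall>x\<in>carrier G. \<exists>b. W x = (\<Sum>g\<in>carrier G. b g *\<^sub>C (\<rho> g - id_End V))"
    using W unfolding forms_rep coeffs_eq tensor_space_def by blast
  then obtain b where b: "\<And>x. x \<in> carrier G \<Longrightarrow> W x = (\<Sum>g\<in>carrier G. b x g *\<^sub>C (\<rho> g - id_End V))"
    by metis
  \<comment> \<open>Evaluation at \<open>x\<close> reads \<open>t\<close> at the pairs
    \<open>(x \<otimes> inv g, g)\<close>, whose product is \<open>x\<close>; there this choice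
    returns \<open>b x g\<close>.\<close>
  define t where "t = (\<lambda>(h, g). b (h \<otimes> g) g)"
  have "W x = (\<Sum>(h, g)\<in>carrier G \<times> carrier G. t (h, g) *\<^sub>C rgen h g) x" for x
  proof (cases "x \<in> carrier G")
    case True
    then show ?thesis
      unfolding sum_rgen_apply[OF True] by (auto simp: b t_def m_assoc intro!: sum.cong)
  next
    case False
    then have "rgen h g x = 0" if "h \<in> carrier G" "g \<in> carrier G" for h g
      using that by (auto simp: rgen_apply)
    then have "(\<Sum>(h, g)\<in>carrier G \<times> carrier G. t (h, g) *\<^sub>C rgen h g) x = 0"
      by (subst sum_fun_apply, intro sum.neutral) auto
    then show ?thesis
      using False W by (simp add: forms_rep tensor_space_def)
  qed
  then show ?thesis
    using that by blast
qed

lemma lact_rep_linear: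
  assumes g: "g \<in> carrier G"
  shows "clinear_on (forms \<Omega>\<rho>) (forms \<Omega>\<rho>) (lact \<Omega>\<rho> (bvec g))"
  unfolding clinear_on_def
proof (intro conjI ballI allI Pi_I)
  fix W assume "W \<in> forms \<Omega>\<rho>"
  then show "lact \<Omega>\<rho> (bvec g) W \<in> forms \<Omega>\<rho>"
    using g by (auto simp: forms_rep tensor_space_def lact_rep)
qed (use g in \<open>auto simp: lact_rep fun_eq_iff\<close>)

text \<open>Linearity is pointwise. That composing with \<open>\<rho> g\<close> keeps the values in
  \<open>coeffs\<close> is seen on the spanning forms, which the right action sends to differences
  of such forms.\<close>

lemma ract_rep_linear:
  assumes g: "g \<in> carrier G"
  shows "clinear_on (forms \<Omega>\<rho>) (forms \<Omega>\<rho>) (\<lambda>W. ract \<Omega>\<rho> W (bvec g))"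
proof -
  have add: "ract \<Omega>\<rho> (W + W') (bvec g) = ract \<Omega>\<rho> W (bvec g) + ract \<Omega>\<rho> W' (bvec g)" for W W'
    using g by (auto simp: ract_rep fun_eq_iff)
  have scale: "ract \<Omega>\<rho> (c *\<^sub>C W) (bvec g) = c *\<^sub>C ract \<Omega>\<rho> W (bvec g)" for c W
    using g by (auto simp: ract_rep fun_eq_iff)
  have lin: "clinear_on UNIV UNIV (\<lambda>W. ract \<Omega>\<rho> W (bvec g))"
    by (simp add: clinear_on_def add scale)
  have "ract \<Omega>\<rho> W (bvec g) \<in> forms \<Omega>\<rho>" if W: "W \<in> forms \<Omega>\<rho>" for W
  proof -
    obtain t where t: "W = (\<Sum>(h, k)\<in>carrier G \<times> carrier G. t (h, k) *\<^sub>C rgen h k)"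
      using forms_rep_lincomb[OF W] .
    have "ract \<Omega>\<rho> W (bvec g) = (\<Sum>(h, k)\<in>carrier G \<times> carrier G. t (h, k) *\<^sub>C ract \<Omega>\<rho> (rgen h k) (bvec g))"
      unfolding t case_prod_unfold by (rule clinear_on_lincomb[OF lin]) simp_all
    then show ?thesis
      using g by (auto intro!: complex_vec.subspace_sum complex_vec.subspace_scale complex_vec.subspace_diff
          subspace_forms_rep rgen_in simp: ract_rgen)
  qed
  then show ?thesis
    by (simp add: clinear_on_def add scale)
qed

end

section \<open>Covariance in components\<close>

context group_calculus
begin

text \<open>\<open>K f k\<close> is the coefficient of the coaction at the basis element
  \<open>\<delta>\<^sub>f \<otimes> k\<close>. The summand indexed by \<open>f\<close> has nonzero
  coefficients only at pairs with first entry \<open>f\<close>, so the sum over the group separates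
  into independent components.\<close>

lemma covariant_iff:
  "codouble_covariant G \<Omega> \<longleftrightarrow> (\<exists>K. \<forall>f\<in>carrier G. \<forall>k\<in>carrier G. clinear_on (forms \<Omega>) (forms \<Omega>) (K f k) \<and>
     (\<forall>h\<in>carrier G. \<forall>g\<in>carrier G. K f k (gen h g) = (if cj f (h \<otimes> g) = k then gen (cj f h) (cj f g) else 0)))"
  (is "_ \<longleftrightarrow> (\<exists>K. ?P K)")
proof
  have comp: "(\<Sum>f\<in>carrier G. tens (bvec (f, cj f (h \<otimes> g))) (gen (cj f h) (cj f g))) (f, k) =
      (if f \<in> carrier G \<and> cj f (h \<otimes> g) = k then gen (cj f h) (cj f g) else 0)" for h g f k
  proof -
    have "(\<Sum>f'\<in>carrier G. tens (bvec (f', cj f' (h \<otimes> g))) (gen (cj f' h) (cj f' g))) (f, k) =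
        (\<Sum>f'\<in>carrier G. if f' = f then (if cj f (h \<otimes> g) = k then gen (cj f h) (cj f g) else 0) else 0)"
      by (subst sum_fun_apply, rule sum.cong) (auto simp: tens_bvec)
    then show ?thesis
      by simp
  qed
  {
    assume "codouble_covariant G \<Omega>"
    then obtain L where L: "clinear_on (forms \<Omega>) (tensor_space (basis (codouble G)) (forms \<Omega>)) L"
      "\<And>h g. h \<in> carrier G \<Longrightarrow> g \<in> carrier G \<Longrightarrow> L (gen h g) =
        (\<Sum>f\<in>carrier G. tens (bvec (f, cj f (h \<otimes> g))) (gen (cj f h) (cj f g)))"
      unfolding codouble_covariant_def by (auto simp: gen_def)
    have "clinear_on (forms \<Omega>) (forms \<Omega>) (\<lambda>w. L w (f, k))" if "f \<in> carrier G" "k \<in> carrier G" for f k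
      using L(1) that by (auto simp: clinear_on_def tensor_space_def Pi_iff)
    then have "?P (\<lambda>f k w. L w (f, k))"
      by (simp add: L(2) comp del: sum_fun_apply)
    then show "\<exists>K. ?P K" by (rule exI[of _ "\<lambda>f k w. L w (f, k)"])
  }
  {
    assume "\<exists>K. ?P K"
    then obtain K where K: "?P K" ..
    then have K_lin: "clinear_on (forms \<Omega>) (forms \<Omega>) (K f k)" if "f \<in> carrier G" "k \<in> carrier G" for f k
      using that by simp
    define L where "L w = (\<lambda>(f, k). if f \<in> carrier G \<and> k \<in> carrier G then K f k w else 0)" for w
    have "clinear_on (forms \<Omega>) (tensor_space (basis (codouble G)) (forms \<Omega>)) L"
      unfolding clinear_on_def
    proof (intro conjI ballI allI Pi_I)
      fix w assume "w \<in> forms \<Omega>"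
      then show "L w \<in> tensor_space (basis (codouble G)) (forms \<Omega>)"
        using K by (auto simp: tensor_space_def L_def intro: clinear_onD(1))
    qed (use K in \<open>auto simp: L_def fun_eq_iff clinear_onD(2,3)[OF K_lin]\<close>)
    moreover have "L (gen h g) = (\<Sum>f\<in>carrier G. tens (bvec (f, cj f (h \<otimes> g))) (gen (cj f h) (cj f g)))"
      if "h \<in> carrier G" "g \<in> carrier G" for h g
    proof
      fix y :: "'g \<times> 'g"
      obtain f k where y: "y = (f, k)" by fastforce
      show "L (gen h g) y = (\<Sum>f\<in>carrier G. tens (bvec (f, cj f (h \<otimes> g))) (gen (cj f h) (cj f g))) y"
        using K that unfolding y comp by (auto simp: L_def)
    qed
    ultimately show "codouble_covariant G \<Omega>"
      unfolding codouble_covariant_def by (auto simp: gen_def)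
  }
qed

text \<open>Every \<open>h dg\<close> with \<open>hg = x\<close> equals \<open>x\<close> times the
  Maurer--Cartan form \<open>g^-1 dg\<close>, because \<open>h = x g^-1\<close>; the factor
  \<open>x\<close> is common to the whole component.\<close>

lemma sum_gen_fibre:
  assumes "x \<in> carrier G"
  shows "(\<Sum>(h, g)\<in>carrier G \<times> carrier G. t (h, g) *\<^sub>C (if h \<otimes> g = x then gen h g else 0))
    = gact x (\<Sum>g\<in>carrier G. t (x \<otimes> inv g, g) *\<^sub>C gen (inv g) g)"
proof -
  have "(\<Sum>(h, g)\<in>carrier G \<times> carrier G. t (h, g) *\<^sub>C (if h \<otimes> g = x then gen h g else 0))
      = (\<Sum>(h, g)\<in>carrier G \<times> carrier G. if h \<otimes> g = x then t (h, g) *\<^sub>C gen h g else 0)"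
    by (rule sum.cong) auto
  also have "\<dots> = (\<Sum>g\<in>carrier G. t (x \<otimes> inv g, g) *\<^sub>C gen (x \<otimes> inv g) g)"
    by (rule sum_fibre[OF assms])
  also have "\<dots> = (\<Sum>g\<in>carrier G. t (x \<otimes> inv g, g) *\<^sub>C gact x (gen (inv g) g))"
    using assms by (simp add: gact_gen)
  finally show ?thesis
    using assms by (simp add: clinear_on_lincomb[OF gact_linear subspace_forms])
qed

end

text \<open>Covariance holds because \<open>\<rho>(f)^-1 (\<rho>(g) - 1) \<rho>(f) = \<rho>(f^-1 g
  f) - 1\<close>: a relation among the generators of one degree, conjugated by
  \<open>\<rho>(f)\<close>, is the same relation among the conjugated generators in the conjugated
  degree.\<close>

lemma (in group_calculus) covariant_if_iso:
  assumes rep: "group_rep G V \<rho>" and iso: "calculus_iso (group_algebra G) \<Omega> (rep_calculus G V \<rho>)"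
  shows "codouble_covariant G \<Omega>"
proof -
  interpret R: finite_group_rep G V \<rho>
    by unfold_locales (rule rep)
  obtain \<theta> where bm: "bimodule_map (group_algebra G) \<Omega> R.\<Omega>\<rho> (\<lambda>a. a) \<theta>"
    and bij: "bij_betw \<theta> (forms \<Omega>) (forms R.\<Omega>\<rho>)"
    and d: "\<And>a. a \<in> elems (group_algebra G) \<Longrightarrow> \<theta> (dif \<Omega> a) = dif R.\<Omega>\<rho> a"
    using iso by (auto simp: calculus_iso_def)
  have lin: "clinear_on (forms \<Omega>) (forms R.\<Omega>\<rho>) \<theta>"
    using bm by (simp add: bimodule_map_def)
  have gen: "\<theta> (gen h g) = R.rgen h g" if "h \<in> carrier G" "g \<in> carrier G" for h g
    using bm that by (simp add: bimodule_map_def gen_def d R.dif_rep R.lact_rgen)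
  have sum_\<theta>: "\<theta> (\<Sum>(h, g)\<in>carrier G \<times> carrier G. t (h, g) *\<^sub>C w h g)
      = (\<Sum>(h, g)\<in>carrier G \<times> carrier G. t (h, g) *\<^sub>C \<theta> (w h g))"
    if "\<And>h g. h \<in> carrier G \<Longrightarrow> g \<in> carrier G \<Longrightarrow> w h g \<in> forms \<Omega>" for t w
    unfolding case_prod_unfold by (rule clinear_on_lincomb[OF lin subspace_forms]) (use that in auto)
  have "\<exists>L. clinear_on (forms \<Omega>) (forms \<Omega>) L \<and> (\<forall>h\<in>carrier G. \<forall>g\<in>carrier G.
      L (gen h g) = (if cj f (h \<otimes> g) = k then gen (cj f h) (cj f g) else 0))"
    if f: "f \<in> carrier G" and k: "k \<in> carrier G" for f k
  proof -
    define v where "v h g = (if cj f (h \<otimes> g) = k then gen (cj f h) (cj f g) else 0)" for h g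
    have v_in: "v h g \<in> forms \<Omega>" if "h \<in> carrier G" "g \<in> carrier G" for h g
      using that f complex_vec.subspace_0[OF subspace_forms] by (simp add: v_def)
    have wd: "(\<Sum>(h, g)\<in>carrier G \<times> carrier G. t (h, g) *\<^sub>C v h g) = 0" (is "?s = 0")
      if t: "(\<Sum>(h, g)\<in>carrier G \<times> carrier G. t (h, g) *\<^sub>C gen h g) = 0" for t
    proof -
      \<comment> \<open>The degree that conjugation by \<open>f\<close> sends to \<open>k\<close>;
        the component at \<open>(f, k)\<close> sees just the generators of this degree.\<close>
      let ?k' = "cj (inv f) k"
      let ?I = "carrier G \<times> carrier G"
      have "(\<Sum>(h, g)\<in>?I. t (h, g) *\<^sub>C R.rgen h g) = (\<Sum>(h, g)\<in>?I. t (h, g) *\<^sub>C \<theta> (gen h g))"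
        by (rule sum.cong) (auto simp: gen)
      also have "\<dots> = \<theta> 0"
        by (simp add: sum_\<theta> flip: t)
      finally have "(\<Sum>(h, g)\<in>?I. t (h, g) *\<^sub>C R.rgen h g) = 0"
        by (simp add: clinear_on_zero[OF lin subspace_forms])
      then have zero: "(\<Sum>(h, g)\<in>?I. t (h, g) *\<^sub>C R.rgen h g ?k' u) = 0" for u
        by (auto simp: fun_eq_iff case_prod_unfold)
      have "(\<Sum>(h, g)\<in>?I. t (h, g) *\<^sub>C \<theta> (v h g)) x u = 0" for x u
      proof (cases "u \<in> V")
        case True
        have in_V: "R.rgen h g ?k' (\<rho> f u) \<in> V" if "h \<in> carrier G" "g \<in> carrier G" for h g
          using that f R.subspace_V
          by (auto simp: R.rgen_apply id_End_def R.rep_in complex_vec.subspace_0 complex_vec.subspace_diff)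
        \<comment> \<open>The right side applies one linear map, the same for all \<open>h\<close>
          and \<open>g\<close>, to the value of \<open>rgen h g\<close> in degree \<open>k'\<close>.
          Hence it can be pulled out of the sum, where the given relation applies.\<close>
        have "\<theta> (v h g) x u = (if x = k then \<rho> (inv f) (R.rgen h g ?k' (\<rho> f u)) else 0)"
          if hg: "h \<in> carrier G" "g \<in> carrier G" for h g
        proof (cases "cj f (h \<otimes> g) = k")
          case eq: True
          then have "R.rgen h g ?k' (\<rho> f u) = \<rho> g (\<rho> f u) - \<rho> f u"
            using hg f by (auto simp: R.rgen_apply id_End_def R.rep_in)
          moreover have "\<rho> (inv f) \<dots> = \<rho> (cj f g) u - u"
            using hg f True
            by (simp add: clinear_on_diff[OF R.rep_linear R.subspace_V] R.rep_in R.rep_mult_apply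
                R.rep_one id_End_def conj_by_def m_assoc)
          moreover have "\<theta> (v h g) x u = (if x = k then \<rho> (cj f g) u - u else 0)"
            using eq hg f True by (auto simp: v_def gen R.rgen_apply conj_mult[symmetric] id_End_def)
          ultimately show ?thesis by simp
        next
          case False
          then have "h \<otimes> g \<noteq> ?k'"
            using f hg k by auto
          then show ?thesis
            using False hg f by (simp add: v_def R.rgen_apply clinear_on_zero[OF lin subspace_forms]
                clinear_on_zero[OF R.rep_linear R.subspace_V])
        qed
        then have "(\<Sum>(h, g)\<in>?I. t (h, g) *\<^sub>C \<theta> (v h g)) x u
            = (\<Sum>(h, g)\<in>?I. t (h, g) *\<^sub>C (if x = k then \<rho> (inv f) (R.rgen h g ?k' (\<rho> f u)) else 0))"
          unfolding sum_fun_apply case_prod_unfold by (intro sum.cong) auto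
        also have "\<dots> = (if x = k then \<rho> (inv f) (\<Sum>(h, g)\<in>?I. t (h, g) *\<^sub>C R.rgen h g ?k' (\<rho> f u)) else 0)"
          unfolding case_prod_unfold using f
          by (subst clinear_on_lincomb[OF R.rep_linear R.subspace_V]) (auto simp: in_V)
        finally show ?thesis
          using f by (simp add: zero clinear_on_zero[OF R.rep_linear R.subspace_V])
      next
        \<comment> \<open>Off \<open>V\<close> every \<open>\<rho> g\<close> and
          \<open>id_End V\<close> are 0 by normalisation.\<close>
        case False
        have "\<theta> (v h g) x u = 0" if "h \<in> carrier G" "g \<in> carrier G" for h g
          using that f False clinear_on_zero[OF lin subspace_forms]
          by (simp add: v_def gen R.rgen_apply R.rep_outside id_End_def)
        then show ?thesis
          unfolding sum_fun_apply case_prod_unfold by (intro sum.neutral) auto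
      qed
      \<comment> \<open>The vanishing was computed in the representation calculus; injectivity of
        \<open>\<theta>\<close> brings it back.\<close>
      then have "\<theta> ?s = 0"
        by (simp add: sum_\<theta> v_in fun_eq_iff)
      then have "\<theta> ?s = \<theta> 0"
        by (simp add: clinear_on_zero[OF lin subspace_forms])
      moreover have "?s \<in> forms \<Omega>"
        by (auto intro!: complex_vec.subspace_sum complex_vec.subspace_scale subspace_forms v_in)
      ultimately show ?thesis
        using bij complex_vec.subspace_0[OF subspace_forms] by (auto simp: bij_betw_def dest: inj_onD)
    qed
    have "\<exists>L. clinear_on (forms \<Omega>) (forms \<Omega>) L \<and>
        (\<forall>h\<in>carrier G. \<forall>g\<in>carrier G. L (gen h g) = v h g) \<and>
        (\<forall>t. L (\<Sum>(h, g)\<in>carrier G \<times> carrier G. t (h, g) *\<^sub>C gen h g)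
           = (\<Sum>(h, g)\<in>carrier G \<times> carrier G. t (h, g) *\<^sub>C v h g))"
      by (rule linear_exists) (fact subspace_forms v_in wd)+
    then show ?thesis
      unfolding v_def by blast
  qed
  then show ?thesis
    unfolding covariant_iff
    by (intro bchoice[where Q = "\<lambda>f K. \<forall>k\<in>carrier G. Q f k (K k)" for Q] ballI bchoice) simp
qed

section \<open>Maurer--Cartan forms of a covariant calculus\<close>

locale covariant_group_calculus = group_calculus +
  fixes K :: "'a \<Rightarrow> 'a \<Rightarrow> 'c \<Rightarrow> 'c"
  assumes K_linear: "f \<in> carrier G \<Longrightarrow> k \<in> carrier G \<Longrightarrow> clinear_on (forms \<Omega>) (forms \<Omega>) (K f k)"
    and K_gen: "f \<in> carrier G \<Longrightarrow> k \<in> carrier G \<Longrightarrow> h \<in> carrier G \<Longrightarrow> g \<in> carrier G \<Longrightarrow>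
      K f k (gen h g) = (if cj f (h \<otimes> g) = k then gen (cj f h) (cj f g) else 0)"
begin

definition mc :: "'a \<Rightarrow> 'c" where
  "mc g = gen (inv g) g"

lemma mc_in [simp]: "g \<in> carrier G \<Longrightarrow> mc g \<in> forms \<Omega>"
  by (simp add: mc_def)

lemma mc_one: "mc \<one> = 0"
  by (simp add: mc_def gen_one_right)

text \<open>The Leibniz rule for \<open>(gf)^-1 d(gf)\<close>: the Maurer--Cartan forms are a
  cocycle for the action of \<open>f\<close> sending \<open>w\<close> to
  \<open>f^-1 w f\<close>.\<close>

lemma mc_mult: "g \<in> carrier G \<Longrightarrow> f \<in> carrier G \<Longrightarrow> mc (g \<otimes> f) = gact (inv f) (gactr (mc g) f) + mc f"
  by (simp add: mc_def gactr_gen clinear_on_diff[OF gact_linear subspace_forms] gact_gen inv_mult_group m_assoc)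

text \<open>From left to right, \<open>K \<one> x\<close> keeps the generators of degree
  \<open>x\<close> unchanged and kills the others, since conjugation by \<open>\<one>\<close> is
  trivial; the common factor \<open>x\<close> is then undone by acting with its inverse. From right
  to left, each generator has exactly one degree, so the sum can be regrouped.\<close>

lemma relation_iff:
  "(\<Sum>(h, g)\<in>carrier G \<times> carrier G. t (h, g) *\<^sub>C gen h g) = 0
    \<longleftrightarrow> (\<forall>x\<in>carrier G. (\<Sum>g\<in>carrier G. t (x \<otimes> inv g, g) *\<^sub>C mc g) = 0)" (is "?s = 0 \<longleftrightarrow> _")
proof
  assume s: "?s = 0"
  show "\<forall>x\<in>carrier G. (\<Sum>g\<in>carrier G. t (x \<otimes> inv g, g) *\<^sub>C mc g) = 0" (is "\<forall>x\<in>_. ?m x = 0")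
  proof
    fix x assume x: "x \<in> carrier G"
    have "0 = K \<one> x ?s"
      using s clinear_on_zero[OF K_linear subspace_forms] x by simp
    also have "\<dots> = (\<Sum>(h, g)\<in>carrier G \<times> carrier G. t (h, g) *\<^sub>C K \<one> x (gen h g))"
      unfolding case_prod_unfold using x
      by (intro clinear_on_lincomb[OF K_linear subspace_forms]) auto
    also have "\<dots> = (\<Sum>(h, g)\<in>carrier G \<times> carrier G. t (h, g) *\<^sub>C (if h \<otimes> g = x then gen h g else 0))"
      using x by (intro sum.cong) (auto simp: K_gen)
    also have "\<dots> = gact x (?m x)"
      using sum_gen_fibre[OF x] by (simp add: mc_def)
    finally have eq: "gact x (?m x) = 0" ..
    have m: "?m x \<in> forms \<Omega>"
      by (intro complex_vec.subspace_sum complex_vec.subspace_scale subspace_forms) simp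
    have "?m x = gact (inv x) (gact x (?m x))"
      using x m gact_mult[of "inv x" x "?m x"] by simp
    then show "?m x = 0"
      using x by (simp add: eq clinear_on_zero[OF gact_linear subspace_forms])
  qed
next
  assume r: "\<forall>x\<in>carrier G. (\<Sum>g\<in>carrier G. t (x \<otimes> inv g, g) *\<^sub>C mc g) = 0"
  have "?s = (\<Sum>(h, g)\<in>carrier G \<times> carrier G. \<Sum>x\<in>carrier G. t (h, g) *\<^sub>C (if h \<otimes> g = x then gen h g else 0))"
    by (rule sum.cong) (auto simp flip: complex_vec.scale_sum_right)
  also have "\<dots> = (\<Sum>x\<in>carrier G. \<Sum>(h, g)\<in>carrier G \<times> carrier G. t (h, g) *\<^sub>C (if h \<otimes> g = x then gen h g else 0))"
    unfolding case_prod_unfold by (rule sum.swap)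
  also have "\<dots> = (\<Sum>x\<in>carrier G. gact x (\<Sum>g\<in>carrier G. t (x \<otimes> inv g, g) *\<^sub>C mc g))"
    by (simp add: sum_gen_fibre mc_def)
  also have "\<dots> = 0"
    using r by (simp add: clinear_on_zero[OF gact_linear subspace_forms])
  finally show "?s = 0" .
qed

text \<open>The vanishing total of \<open>b\<close> removes the inhomogeneous term
  \<open>mc f\<close> of the cocycle rule, and what remains is a linear map applied to the given
  relation.\<close>

lemma null_right:
  assumes f: "f \<in> carrier G" and b: "(\<Sum>g\<in>carrier G. b g) = 0" "(\<Sum>g\<in>carrier G. b g *\<^sub>C mc g) = 0"
  shows "(\<Sum>g\<in>carrier G. b g *\<^sub>C mc (g \<otimes> f)) = 0"
proof -
  have lin: "clinear_on (forms \<Omega>) (forms \<Omega>) (\<lambda>w. gact (inv f) (gactr w f))"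
    using f by (intro clinear_on_compose[OF gactr_linear gact_linear]) auto
  have "(\<Sum>g\<in>carrier G. b g *\<^sub>C mc (g \<otimes> f)) = (\<Sum>g\<in>carrier G. b g *\<^sub>C gact (inv f) (gactr (mc g) f))
      + (\<Sum>g\<in>carrier G. b g) *\<^sub>C mc f"
    using f by (simp add: mc_mult scaleC_add_right sum.distrib complex_vec.scale_sum_left)
  also have "\<dots> = gact (inv f) (gactr (\<Sum>g\<in>carrier G. b g *\<^sub>C mc g) f)"
    using b by (subst clinear_on_lincomb[OF lin subspace_forms]) auto
  also have "\<dots> = 0"
    using b clinear_on_zero[OF lin subspace_forms] by simp
  finally show ?thesis .
qed

text \<open>\<open>f \<otimes> g\<close> is the conjugate \<open>cj (inv f) (g \<otimes> f)\<close>,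
  so a component of the coaction turns the right translate of a relation into the left translate. It
  is the component at \<open>\<one>\<close> because Maurer--Cartan forms have degree
  \<open>\<one>\<close>, which conjugation fixes.\<close>

lemma null_left:
  assumes f: "f \<in> carrier G" and b: "(\<Sum>g\<in>carrier G. b g) = 0" "(\<Sum>g\<in>carrier G. b g *\<^sub>C mc g) = 0"
  shows "(\<Sum>g\<in>carrier G. b g *\<^sub>C mc (f \<otimes> g)) = 0"
proof -
  have lin: "clinear_on (forms \<Omega>) (forms \<Omega>) (K (inv f) \<one>)"
    using f by (intro K_linear) auto
  have "K (inv f) \<one> (mc (g \<otimes> f)) = mc (f \<otimes> g)" if "g \<in> carrier G" for g
  proof -
    have "cj (inv f) (g \<otimes> f) = f \<otimes> g"
      using f that by (simp add: conj_by_def m_assoc)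
    then show ?thesis
      using f that by (simp add: mc_def K_gen flip: conj_inv)
  qed
  then have "(\<Sum>g\<in>carrier G. b g *\<^sub>C mc (f \<otimes> g)) = (\<Sum>g\<in>carrier G. b g *\<^sub>C K (inv f) \<one> (mc (g \<otimes> f)))"
    by simp
  also have "\<dots> = K (inv f) \<one> (\<Sum>g\<in>carrier G. b g *\<^sub>C mc (g \<otimes> f))"
    using f by (subst clinear_on_lincomb[OF lin subspace_forms]) auto
  also have "\<dots> = 0"
    by (simp add: null_right[OF f b] clinear_on_zero[OF lin subspace_forms])
  finally show ?thesis .
qed

end

text \<open>\<open>V\<close> must equal the span of a finite set, and containment in the span of the
  \<open>bvec n\<close> does not give this directly. A maximal independent subset of
  \<open>V\<close> spans it and is finite by the exchange bound.\<close>

lemma finite_dimensional_supported: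
  assumes V: "complex_vec.subspace V" and fin: "finite S" and supp: "\<And>\<phi> n. \<phi> \<in> V \<Longrightarrow> n \<notin> S \<Longrightarrow> \<phi> n = 0"
  shows "finite_dimensional (V :: ('n \<Rightarrow> complex) set)"
proof -
  have "V \<subseteq> complex_vec.span (bvec ` S)"
  proof
    fix \<phi> assume "\<phi> \<in> V"
    then have "\<phi> = (\<Sum>n\<in>S. \<phi> n *\<^sub>C bvec n)"
      using supp fin by (auto simp: fun_eq_iff bvec_apply if_distrib[of "times _"] cong: if_cong)
    then show "\<phi> \<in> complex_vec.span (bvec ` S)"
      by (metis (no_types, lifting) complex_vec.span_base complex_vec.span_scale complex_vec.span_sum imageI)
  qed
  then obtain B where "B \<subseteq> V" "complex_vec.independent B" "V \<subseteq> complex_vec.span B"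
    "B \<subseteq> complex_vec.span (bvec ` S)"
    using complex_vec.maximal_independent_subset[of V] by (metis order_trans)
  then show ?thesis
    unfolding finite_dimensional_def
    using complex_vec.independent_span_bound[of "bvec ` S" B] fin complex_vec.span_minimal[OF _ V, of B]
    by (intro exI[of _ B]) auto
qed

section \<open>From covariance to a representation\<close>

context covariant_group_calculus
begin

text \<open>
  The representation space is the annihilator, among the functions on the group, of the ideal of relations
  between the Maurer--Cartan forms; the group acts by right translation.
\<close>

lemma rep_exists:
  obtains V :: "(nat \<Rightarrow> complex) set" and \<rho> where "finite_dimensional V" "group_rep G V \<rho>"
    "\<And>b. (\<Sum>g\<in>carrier G. b g *\<^sub>C (\<rho> g - id_End V)) = 0 \<longleftrightarrow> (\<Sum>g\<in>carrier G. b g *\<^sub>C mc g) = 0"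
proof -
  \<comment> \<open>The numbering carries functions on the group to functions on the natural
    numbers, so the type of the representation space does not depend on \<open>G\<close>.\<close>
  obtain \<iota> :: "'a \<Rightarrow> nat" where inj: "inj_on \<iota> (carrier G)"
    using finite_imp_inj_to_nat_seg[OF finite_carrier] by auto
  \<comment> \<open>Since \<open>mc \<one> = 0\<close>, a relation leaves the coefficient at
    \<open>\<one>\<close> free; total 0 fixes it and puts the relation into the augmentation
    ideal.\<close>
  define null where "null b \<longleftrightarrow> (\<Sum>g\<in>carrier G. b g) = 0 \<and> (\<Sum>g\<in>carrier G. b g *\<^sub>C mc g) = 0" for b :: "'a \<Rightarrow> complex"
  define V :: "(nat \<Rightarrow> complex) set" where "V = {\<phi>. (\<forall>n. n \<notin> \<iota> ` carrier G \<longrightarrow> \<phi> n = 0) \<and>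
      (\<forall>b. null b \<longrightarrow> (\<Sum>g\<in>carrier G. b g * \<phi> (\<iota> g)) = 0)}"
  \<comment> \<open>Right translation \<open>h\<close> to \<open>\<phi>(hg)\<close>, read through
    \<open>\<iota>\<close>, and 0 off \<open>V\<close> as endomorphisms are normalised.\<close>
  define \<rho> where "\<rho> g \<phi> = (if \<phi> \<in> V then (\<lambda>n. if n \<in> \<iota> ` carrier G
      then \<phi> (\<iota> (inv_into (carrier G) \<iota> n \<otimes> g)) else 0) else 0)" for g and \<phi> :: "nat \<Rightarrow> complex"
  have V_eqI: "\<phi> = \<psi>" if "\<phi> \<in> V" "\<psi> \<in> V" "\<And>g. g \<in> carrier G \<Longrightarrow> \<phi> (\<iota> g) = \<psi> (\<iota> g)" for \<phi> \<psi>
  proof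
    show "\<phi> n = \<psi> n" for n
      using that by (cases "n \<in> \<iota> ` carrier G") (auto simp: V_def)
  qed
  have VD: "(\<Sum>g\<in>carrier G. b g * \<phi> (\<iota> g)) = 0" if "\<phi> \<in> V" "null b" for \<phi> b
    using that by (simp add: V_def)
  have \<rho>_apply: "\<rho> g \<phi> (\<iota> h) = \<phi> (\<iota> (h \<otimes> g))" if "\<phi> \<in> V" "h \<in> carrier G" for g \<phi> h
    using that inj by (simp add: \<rho>_def)
  \<comment> \<open>The shifted coefficients are those of the product of \<open>b\<close> with
    \<open>g\<close> from the right. That the ideal is closed under this product makes
    \<open>V\<close> stable under right translation.\<close>
  have null_shift: "null (\<lambda>h. b (h \<otimes> inv g))" if "null b" "g \<in> carrier G" for b g
  proof -
    have "(\<Sum>h\<in>carrier G. b (h \<otimes> inv g)) = (\<Sum>h\<in>carrier G. b h)"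
      using that by (intro sum_mult_right) simp
    moreover have "(\<Sum>h\<in>carrier G. b (h \<otimes> inv g) *\<^sub>C mc h)
        = (\<Sum>h\<in>carrier G. b ((h \<otimes> g) \<otimes> inv g) *\<^sub>C mc (h \<otimes> g))"
      using that by (intro sum_mult_right[symmetric])
    moreover have "\<dots> = (\<Sum>h\<in>carrier G. b h *\<^sub>C mc (h \<otimes> g))"
      using that by (intro sum.cong) (auto simp: m_assoc)
    ultimately show ?thesis
      using that null_right[of g b] by (simp add: null_def)
  qed
  have sub: "complex_vec.subspace V"
    by (rule complex_vec.subspaceI)
      (auto simp: V_def distrib_left sum.distrib mult.left_commute simp flip: sum_distrib_left)
  have \<rho>_in: "\<rho> g \<phi> \<in> V" if g: "g \<in> carrier G" for g \<phi>
  proof (cases "\<phi> \<in> V")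
    case True
    have "(\<Sum>h\<in>carrier G. b h * \<rho> g \<phi> (\<iota> h)) = 0" if b: "null b" for b
    proof -
      have "(\<Sum>h\<in>carrier G. b h * \<rho> g \<phi> (\<iota> h)) = (\<Sum>h\<in>carrier G. b ((h \<otimes> g) \<otimes> inv g) * \<phi> (\<iota> (h \<otimes> g)))"
        using True g by (intro sum.cong) (auto simp: \<rho>_apply m_assoc)
      also have "\<dots> = (\<Sum>h\<in>carrier G. b (h \<otimes> inv g) * \<phi> (\<iota> h))"
        using g by (rule sum_mult_right)
      finally show ?thesis
        using VD[OF True null_shift[OF b g]] by simp
    qed
    then show ?thesis
      using True unfolding V_def by (auto simp: \<rho>_def)
  next
    case False
    then show ?thesis
      using sub by (simp add: \<rho>_def complex_vec.subspace_0)
  qed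
  have "\<rho> g \<in> End_space V" if g: "g \<in> carrier G" for g
  proof -
    have "clinear_on V V (\<rho> g)"
      unfolding clinear_on_def
    proof (intro conjI ballI allI Pi_I)
      show "\<rho> g \<phi> \<in> V" for \<phi>
        using g by (rule \<rho>_in)
    qed (auto simp: \<rho>_def complex_vec.subspace_add[OF sub] complex_vec.subspace_scale[OF sub] fun_eq_iff)
    then show ?thesis
      by (simp add: End_space_def \<rho>_def)
  qed
  moreover have "\<rho> \<one> \<phi> = id_End V \<phi>" for \<phi>
  proof (cases "\<phi> \<in> V")
    case True
    then show ?thesis
      by (intro V_eqI) (auto simp: \<rho>_in id_End_def \<rho>_apply)
  qed (simp add: \<rho>_def id_End_def)
  moreover have "\<rho> (g \<otimes> h) \<phi> = \<rho> g (\<rho> h \<phi>)" if "g \<in> carrier G" "h \<in> carrier G" for g h \<phi>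
  proof (cases "\<phi> \<in> V")
    case True
    then show ?thesis
      using that by (intro V_eqI) (auto simp: \<rho>_in \<rho>_apply m_assoc)
  next
    case False
    then show ?thesis
      using complex_vec.subspace_0[OF sub] by (simp add: \<rho>_def fun_eq_iff)
  qed
  ultimately have rep: "group_rep G V \<rho>"
    using sub by (auto simp: group_rep_def)
  have kernel: "(\<Sum>g\<in>carrier G. b g *\<^sub>C \<rho> g) = 0 \<longleftrightarrow> (\<Sum>g\<in>carrier G. b g *\<^sub>C mc g) = 0"
    if b: "(\<Sum>g\<in>carrier G. b g) = 0" for b
  proof
    assume m: "(\<Sum>g\<in>carrier G. b g *\<^sub>C mc g) = 0"
    have "(\<Sum>g\<in>carrier G. b g * \<rho> g \<phi> n) = 0" for \<phi> n
    proof (cases "\<phi> \<in> V \<and> n \<in> \<iota> ` carrier G")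
      case True
      then obtain h where h: "h \<in> carrier G" "n = \<iota> h" and \<phi>: "\<phi> \<in> V" by auto
      \<comment> \<open>The operator applied to \<open>\<phi>\<close> and evaluated at
        \<open>h\<close> pairs \<open>\<phi>\<close> with the product of \<open>h\<close> and
        \<open>b\<close>. This product is again in the ideal by \<open>null_left\<close>, and
        \<open>\<phi>\<close> annihilates it.\<close>
      have "(\<Sum>g\<in>carrier G. b (inv h \<otimes> g)) = 0"
        using h b by (subst sum_mult_left) auto
      moreover have "(\<Sum>g\<in>carrier G. b (inv h \<otimes> g) *\<^sub>C mc g)
          = (\<Sum>g\<in>carrier G. b (inv h \<otimes> (h \<otimes> g)) *\<^sub>C mc (h \<otimes> g))"
        using h by (intro sum_mult_left[symmetric]) auto
      moreover have "\<dots> = (\<Sum>g\<in>carrier G. b g *\<^sub>C mc (h \<otimes> g))"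
        using h by (intro sum.cong) auto
      ultimately have "null (\<lambda>g. b (inv h \<otimes> g))"
        using null_left[OF h(1) b m] by (simp add: null_def)
      then have "0 = (\<Sum>g\<in>carrier G. b (inv h \<otimes> g) * \<phi> (\<iota> g))"
        using VD[OF \<phi>] by simp
      also have "\<dots> = (\<Sum>g\<in>carrier G. b (inv h \<otimes> (h \<otimes> g)) * \<phi> (\<iota> (h \<otimes> g)))"
        using h by (intro sum_mult_left[symmetric]) auto
      also have "\<dots> = (\<Sum>g\<in>carrier G. b g * \<rho> g \<phi> n)"
        using h \<phi> by (intro sum.cong) (auto simp: \<rho>_apply)
      finally show ?thesis ..
    next
      case False
      then show ?thesis
        by (auto simp: \<rho>_def intro!: sum.neutral)
    qed
    then show "(\<Sum>g\<in>carrier G. b g *\<^sub>C \<rho> g) = 0"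
      by (simp add: fun_eq_iff)
  next
    assume z: "(\<Sum>g\<in>carrier G. b g *\<^sub>C \<rho> g) = 0"
    show "(\<Sum>g\<in>carrier G. b g *\<^sub>C mc g) = 0" (is "?x = 0")
    proof (rule ccontr)
      assume "?x \<noteq> 0"
      then obtain l :: "'c \<Rightarrow> complex" where l: "clinear_on UNIV UNIV l" "l ?x = 1"
        by (rule separating_functional)
      have l_sum: "l (\<Sum>g\<in>carrier G. a g *\<^sub>C mc g) = (\<Sum>g\<in>carrier G. a g * l (mc g))" for a
        by (subst clinear_on_lincomb[OF l(1)]) simp_all
      \<comment> \<open>The function \<open>g\<close> to \<open>l(mc g)\<close> annihilates every
        relation because \<open>l\<close> is linear, so it lies in \<open>V\<close>. At the unit the
        operator takes it to \<open>l ?x = 1\<close>, so the operator is not 0.\<close>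
      define \<phi> where "\<phi> n = (if n \<in> \<iota> ` carrier G then l (mc (inv_into (carrier G) \<iota> n)) else 0)" for n
      have \<phi>: "\<phi> (\<iota> g) = l (mc g)" if "g \<in> carrier G" for g
        using that inj by (simp add: \<phi>_def)
      have "(\<Sum>g\<in>carrier G. a g * \<phi> (\<iota> g)) = 0" if "null a" for a
        using that clinear_on_zero[OF l(1)] by (simp add: \<phi> null_def flip: l_sum)
      then have \<phi>V: "\<phi> \<in> V"
        by (simp add: V_def) (simp add: \<phi>_def)
      have "(\<Sum>g\<in>carrier G. b g *\<^sub>C \<rho> g) \<phi> (\<iota> \<one>) = (\<Sum>g\<in>carrier G. b g * l (mc g))"
        using \<phi>V by (simp add: \<rho>_apply \<phi>)
      then show False
        using l(2) z by (simp add: l_sum)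
    qed
  qed
  have "(\<Sum>g\<in>carrier G. b g *\<^sub>C (\<rho> g - id_End V)) = 0 \<longleftrightarrow> (\<Sum>g\<in>carrier G. b g *\<^sub>C mc g) = 0" for b
  proof -
    \<comment> \<open>The projection of \<open>b\<close> to the augmentation ideal, subtracting the
      total at the unit. Neither side of the equivalence notices the change, as
      \<open>mc \<one> = 0\<close> and \<open>\<rho> \<one>\<close> is the identity.\<close>
    define c where "c g = b g - (if g = \<one> then \<Sum>g\<in>carrier G. b g else 0)" for g
    have "(\<Sum>g\<in>carrier G. c g) = 0"
      by (simp add: c_def sum_subtractf)
    moreover have c: "(\<Sum>g\<in>carrier G. c g *\<^sub>C F g) = (\<Sum>g\<in>carrier G. b g *\<^sub>C F g) - (\<Sum>g\<in>carrier G. b g) *\<^sub>C F \<one>"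
      for F :: "'a \<Rightarrow> 'x::complex_vector"
    proof -
      have "(\<Sum>g\<in>carrier G. c g *\<^sub>C F g)
          = (\<Sum>g\<in>carrier G. b g *\<^sub>C F g - (if g = \<one> then (\<Sum>g\<in>carrier G. b g) *\<^sub>C F g else 0))"
        by (intro sum.cong) (auto simp: c_def complex_vec.scale_left_diff_distrib)
      then show ?thesis
        by (simp add: sum_subtractf)
    qed
    have "\<rho> \<one> = id_End V"
      using rep by (simp add: group_rep_def)
    then have "(\<Sum>g\<in>carrier G. c g *\<^sub>C \<rho> g) = (\<Sum>g\<in>carrier G. b g *\<^sub>C (\<rho> g - id_End V))"
      by (simp add: c complex_vec.scale_right_diff_distrib sum_subtractf complex_vec.scale_sum_left)
    moreover have "(\<Sum>g\<in>carrier G. c g *\<^sub>C mc g) = (\<Sum>g\<in>carrier G. b g *\<^sub>C mc g)"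
      by (simp add: c mc_one)
    ultimately show ?thesis
      using kernel[of c] by simp
  qed
  moreover have "finite_dimensional V"
    by (rule finite_dimensional_supported[OF sub, of "\<iota> ` carrier G"]) (auto simp: V_def)
  ultimately show ?thesis
    using rep that by blast
qed

text \<open>In both calculi a relation splits by degree in the same way, and \<open>ker\<close>
  matches the relations within a degree. Equal relations give the map in one direction and its
  injectivity in the other.\<close>

lemma iso_rep_calculus:
  assumes rep: "group_rep G V \<rho>"
    and ker: "\<And>b. (\<Sum>g\<in>carrier G. b g *\<^sub>C (\<rho> g - id_End V)) = 0 \<longleftrightarrow> (\<Sum>g\<in>carrier G. b g *\<^sub>C mc g) = 0"
  shows "calculus_iso (group_algebra G) \<Omega> (rep_calculus G V \<rho>)"
proof -
  interpret R: finite_group_rep G V \<rho>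
    by unfold_locales (rule rep)
  have outside: "(\<Sum>(h, g)\<in>carrier G \<times> carrier G. t (h, g) *\<^sub>C R.rgen h g) x = 0" if "x \<notin> carrier G" for t x
    using that by (subst sum_fun_apply, intro sum.neutral) (auto simp: R.rgen_apply)
  have rel: "(\<Sum>(h, g)\<in>carrier G \<times> carrier G. t (h, g) *\<^sub>C gen h g) = 0
      \<longleftrightarrow> (\<Sum>(h, g)\<in>carrier G \<times> carrier G. t (h, g) *\<^sub>C R.rgen h g) = 0" (is "_ \<longleftrightarrow> ?S = 0") for t
  proof -
    have "?S = 0 \<longleftrightarrow> (\<forall>x\<in>carrier G. ?S x = 0)"
    proof
      assume S: "\<forall>x\<in>carrier G. ?S x = 0"
      show "?S = 0"
      proof
        fix x
        show "?S x = 0 x"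
          using S outside[of x t] by (cases "x \<in> carrier G") simp_all
      qed
    qed simp
    then show ?thesis
      by (simp only: relation_iff ker[symmetric] R.sum_rgen_apply cong: ball_cong)
  qed
  have "\<exists>\<theta>. clinear_on (forms \<Omega>) (forms R.\<Omega>\<rho>) \<theta> \<and>
      (\<forall>h\<in>carrier G. \<forall>g\<in>carrier G. \<theta> (gen h g) = R.rgen h g) \<and>
      (\<forall>t. \<theta> (\<Sum>(h, g)\<in>carrier G \<times> carrier G. t (h, g) *\<^sub>C gen h g)
         = (\<Sum>(h, g)\<in>carrier G \<times> carrier G. t (h, g) *\<^sub>C R.rgen h g))" (is "\<exists>\<theta>. ?lin \<theta> \<and> ?gen \<theta> \<and> ?sum \<theta>")
    by (rule linear_exists) (fact R.subspace_forms_rep R.rgen_in rel[THEN iffD1])+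
  then obtain \<theta> where lin: "?lin \<theta>" and "?gen \<theta>" and "?sum \<theta>"
    by blast
  then have gen: "\<And>h g. h \<in> carrier G \<Longrightarrow> g \<in> carrier G \<Longrightarrow> \<theta> (gen h g) = R.rgen h g"
    and \<theta>: "\<And>t. \<theta> (\<Sum>(h, g)\<in>carrier G \<times> carrier G. t (h, g) *\<^sub>C gen h g)
       = (\<Sum>(h, g)\<in>carrier G \<times> carrier G. t (h, g) *\<^sub>C R.rgen h g)"
    by blast+
  have "bimodule_map (group_algebra G) \<Omega> R.\<Omega>\<rho> (\<lambda>a. a) \<theta>"
  proof (rule bimodule_mapI[OF R.subspace_forms_rep lin])
    show "lact R.\<Omega>\<rho> a w = (\<Sum>g\<in>carrier G. a g *\<^sub>C lact R.\<Omega>\<rho> (bvec g) w)" for a w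
      by (rule R.lact_expand_rep)
    show "ract R.\<Omega>\<rho> w a = (\<Sum>g\<in>carrier G. a g *\<^sub>C ract R.\<Omega>\<rho> w (bvec g))" for a w
      by (rule R.ract_expand_rep)
  qed (simp_all add: R.lact_rep_linear R.ract_rep_linear gen R.lact_rgen R.ract_rgen)
  moreover have "inj_on \<theta> (forms \<Omega>)"
  proof (rule inj_onI)
    fix w w' assume w: "w \<in> forms \<Omega>" "w' \<in> forms \<Omega>" "\<theta> w = \<theta> w'"
    then obtain t where t: "w - w' = (\<Sum>(h, g)\<in>carrier G \<times> carrier G. t (h, g) *\<^sub>C gen h g)"
      using complex_vec.subspace_diff[OF subspace_forms, of w w'] unfolding forms_eq_lincomb by auto
    have "\<theta> (w - w') = 0"
      using w by (simp add: clinear_on_diff[OF lin subspace_forms])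
    then have "w - w' = 0"
      using rel[of t] by (simp add: t \<theta>)
    then show "w = w'" by simp
  qed
  moreover have "forms R.\<Omega>\<rho> \<subseteq> \<theta> ` forms \<Omega>"
  proof
    fix W assume "W \<in> forms R.\<Omega>\<rho>"
    then obtain t where "W = (\<Sum>(h, g)\<in>carrier G \<times> carrier G. t (h, g) *\<^sub>C R.rgen h g)"
      by (rule R.forms_rep_lincomb)
    then have "W = \<theta> (\<Sum>(h, g)\<in>carrier G \<times> carrier G. t (h, g) *\<^sub>C gen h g)"
      by (simp add: \<theta>)
    then show "W \<in> \<theta> ` forms \<Omega>"
      unfolding forms_eq_lincomb by blast
  qed
  then have "\<theta> ` forms \<Omega> = forms R.\<Omega>\<rho>"
    using clinear_onD(1)[OF lin] by auto
  moreover have "\<theta> (dif \<Omega> a) = dif R.\<Omega>\<rho> a" if a: "a \<in> elems (group_algebra G)" for a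
  proof -
    have "dif \<Omega> a = (\<Sum>g\<in>carrier G. a g *\<^sub>C gen \<one> g)"
      using dif_expand[OF calculus _ a] by (simp add: dif_bvec)
    then have "\<theta> (dif \<Omega> a) = (\<Sum>g\<in>carrier G. a g *\<^sub>C R.rgen \<one> g)"
      by (simp add: clinear_on_lincomb[OF lin subspace_forms] gen)
    then show ?thesis
      by (simp add: rep_calculus_def R.rgen_def)
  qed
  ultimately show ?thesis
    unfolding calculus_iso_def bij_betw_def by blast
qed

end

section \<open>Differentiability of the coaction\<close>

lemma bmult_codouble:
  "bmult (codouble G) (f, m) (f', m') = (if f = f' then bvec (f, m \<otimes>\<^bsub>G\<^esub> m') else 0)"
  by (auto simp: codouble_def based_algebra.defs tensor_algebra_def function_algebra_def bvec_apply fun_eq_iff)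

lemma bcomult_codouble:
  "bcomult (codouble G) (g, h) = (\<Sum>f\<in>carrier G.
     bvec ((f, inv\<^bsub>G\<^esub> f \<otimes>\<^bsub>G\<^esub> g \<otimes>\<^bsub>G\<^esub> h \<otimes>\<^bsub>G\<^esub> inv\<^bsub>G\<^esub> g \<otimes>\<^bsub>G\<^esub> f), (inv\<^bsub>G\<^esub> f \<otimes>\<^bsub>G\<^esub> g, h)))"
  by (simp add: codouble_def based_algebra.defs based_hopf_algebra.defs)

context finite_group
begin

text \<open>The summand of \<open>\<Phi>(g)\<close> at \<open>f\<close>. Labelling it by
  \<open>g\<close> instead of the conjugate makes products simple: equal \<open>f\<close> multiply
  the labels, different \<open>f\<close> give 0.\<close>

abbreviation cpt :: "'a \<Rightarrow> 'a \<Rightarrow> 'a \<times> 'a \<Rightarrow> complex" where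
  "cpt f g \<equiv> bvec (f, cj f g)"

lemma codouble_embed_bvec: "g \<in> carrier G \<Longrightarrow> codouble_embed G (bvec g) = (\<Sum>f\<in>carrier G. cpt f g)"
  by (simp add: codouble_embed_def bvec_apply)

lemma codouble_embed_apply:
  assumes "g \<in> carrier G"
  shows "codouble_embed G (bvec g) (k, n) = (if k \<in> carrier G \<and> n = cj k g then 1 else 0)"
proof -
  have "codouble_embed G (bvec g) (k, n) = (\<Sum>f\<in>carrier G. if f = k then (if n = cj k g then 1 else 0) else 0)"
    unfolding codouble_embed_bvec[OF assms] by (subst sum_fun_apply, rule sum.cong) (auto simp: bvec_apply)
  then show ?thesis
    by simp
qed

lemma codouble_embed_expand: "codouble_embed G a = (\<Sum>g\<in>carrier G. a g *\<^sub>C codouble_embed G (bvec g))"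
  unfolding codouble_embed_def[of G a] by (simp add: codouble_embed_bvec)

lemma coaction_bvec:
  "g \<in> carrier G \<Longrightarrow> coaction G (bvec g) = (\<Sum>f\<in>carrier G. bvec ((f, cj f g), cj f g))"
  by (simp add: coaction_def bvec_apply)

lemma coaction_apply:
  assumes "g \<in> carrier G"
  shows "coaction G (bvec g) ((f, n), y) = (if f \<in> carrier G \<and> n = cj f g \<and> y = cj f g then 1 else 0)"
proof -
  have "coaction G (bvec g) ((f, n), y)
      = (\<Sum>f'\<in>carrier G. if f' = f then (if n = cj f g \<and> y = cj f g then 1 else 0) else 0)"
    unfolding coaction_bvec[OF assms] by (subst sum_fun_apply, rule sum.cong) (auto simp: bvec_apply)
  then show ?thesis
    by simp
qed

lemma coaction_expand: "coaction G a = (\<Sum>g\<in>carrier G. a g *\<^sub>C coaction G (bvec g))"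
  unfolding coaction_def[of G a] by (simp add: coaction_bvec)

lemma sum_coaction:
  fixes X :: "'a \<times> 'a \<Rightarrow> 'a \<Rightarrow> 'n::complex_vector"
  assumes "g \<in> carrier G"
  shows "(\<Sum>x\<in>carrier G \<times> carrier G. \<Sum>y\<in>carrier G. coaction G (bvec g) (x, y) *\<^sub>C X x y)
    = (\<Sum>f\<in>carrier G. X (f, cj f g) (cj f g))"
proof -
  have "(\<Sum>x\<in>carrier G \<times> carrier G. \<Sum>y\<in>carrier G. coaction G (bvec g) (x, y) *\<^sub>C X x y)
      = (\<Sum>f\<in>carrier G. \<Sum>n\<in>carrier G. \<Sum>y\<in>carrier G. coaction G (bvec g) ((f, n), y) *\<^sub>C X (f, n) y)"
    by (simp add: sum.cartesian_product')
  also have "\<dots> = (\<Sum>f\<in>carrier G. \<Sum>n\<in>carrier G. if n = cj f g then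
      (\<Sum>y\<in>carrier G. if y = cj f g then X (f, n) y else 0) else 0)"
    using assms by (intro sum.cong refl) (auto simp: coaction_apply intro!: sum.cong sum.neutral)
  finally show ?thesis
    using assms by simp
qed

text \<open>In the coproduct of \<open>\<delta>\<^sub>k \<otimes> k^-1 h k\<close> the conjugations
  by \<open>k\<close> cancel in the first leg, leaving \<open>a^-1 h a\<close>; the second leg keeps
  \<open>k^-1 h k\<close>, where \<open>k = ac\<close>. At \<open>c = \<one>\<close> both group
  entries are \<open>a^-1 h a\<close>, as in the coaction.\<close>

lemma comult_codouble_embed:
  assumes h: "h \<in> carrier G"
  shows "comult (codouble G) (codouble_embed G (bvec h)) ((a, b), (c, d))
    = (if a \<in> carrier G \<and> c \<in> carrier G \<and> b = cj a h \<and> d = cj (a \<otimes> c) h then 1 else 0)"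
proof -
  have "comult (codouble G) (codouble_embed G (bvec h)) ((a, b), (c, d))
      = (\<Sum>k\<in>carrier G. \<Sum>n\<in>carrier G. codouble_embed G (bvec h) (k, n) * bcomult (codouble G) (k, n) ((a, b), (c, d)))"
    by (simp add: comult_def sum.cartesian_product' case_prod_unfold)
  also have "\<dots> = (\<Sum>k\<in>carrier G. \<Sum>n\<in>carrier G. if n = cj k h then bcomult (codouble G) (k, n) ((a, b), (c, d)) else 0)"
    using h by (intro sum.cong refl) (simp add: codouble_embed_apply)
  also have "\<dots> = (\<Sum>k\<in>carrier G. bcomult (codouble G) (k, cj k h) ((a, b), (c, d)))"
    using h by simp
  also have "\<dots> = (\<Sum>k\<in>carrier G. \<Sum>f\<in>carrier G. if f = a then
      (if b = cj a h \<and> c = inv a \<otimes> k \<and> d = cj k h then 1 else 0) else 0)"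
  proof (rule sum.cong[OF refl])
    fix k assume k: "k \<in> carrier G"
    have "inv f \<otimes> k \<otimes> cj k h \<otimes> inv k \<otimes> f = cj f h" if "f \<in> carrier G" for f
      using k h that by (simp add: conj_by_def m_assoc)
    then show "bcomult (codouble G) (k, cj k h) ((a, b), (c, d)) = (\<Sum>f\<in>carrier G. if f = a then
      (if b = cj a h \<and> c = inv a \<otimes> k \<and> d = cj k h then 1 else 0) else 0)"
      unfolding bcomult_codouble by (subst sum_fun_apply, intro sum.cong) (auto simp: bvec_apply)
  qed
  also have "\<dots> = (\<Sum>k\<in>carrier G. if k = a \<otimes> c then
      (if a \<in> carrier G \<and> c \<in> carrier G \<and> b = cj a h \<and> d = cj (a \<otimes> c) h then 1 else 0) else 0)"
    using h by (intro sum.cong refl) auto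
  finally show ?thesis
    by auto
qed

lemma sum_comult_codouble_embed:
  fixes X :: "'a \<times> 'a \<Rightarrow> 'a \<times> 'a \<Rightarrow> 'n::complex_vector"
  assumes h: "h \<in> carrier G"
  shows "(\<Sum>(x, y)\<in>(carrier G \<times> carrier G) \<times> (carrier G \<times> carrier G).
      comult (codouble G) (codouble_embed G (bvec h)) (x, y) *\<^sub>C X x y)
    = (\<Sum>a\<in>carrier G. \<Sum>c\<in>carrier G. X (a, cj a h) (c, cj (a \<otimes> c) h))"
proof -
  have "(\<Sum>(x, y)\<in>(carrier G \<times> carrier G) \<times> (carrier G \<times> carrier G).
      comult (codouble G) (codouble_embed G (bvec h)) (x, y) *\<^sub>C X x y)
    = (\<Sum>a\<in>carrier G. \<Sum>b\<in>carrier G. \<Sum>c\<in>carrier G. \<Sum>d\<in>carrier G.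
      comult (codouble G) (codouble_embed G (bvec h)) ((a, b), (c, d)) *\<^sub>C X (a, b) (c, d))"
    by (simp add: sum.cartesian_product' case_prod_unfold)
  also have "\<dots> = (\<Sum>a\<in>carrier G. \<Sum>b\<in>carrier G. if b = cj a h then
      (\<Sum>c\<in>carrier G. \<Sum>d\<in>carrier G. if d = cj (a \<otimes> c) h then X (a, b) (c, d) else 0) else 0)"
    using h by (intro sum.cong refl) (auto simp: comult_codouble_embed intro!: sum.cong sum.neutral)
  finally show ?thesis
    using h by simp
qed

end

text \<open>Multiplication by \<open>\<delta>\<^sub>f\<close> restricts to the row \<open>f\<close>
  and \<open>k\<close> translates within that row, so the sums reduce to those for the group
  algebra.\<close>

lemma (in finite_group) sum_tens_bmult:
  assumes "k \<in> carrier G" "f \<in> carrier G"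
  shows "(\<Sum>p\<in>carrier G \<times> carrier G. tens (bmult (codouble G) (f, k) p) (F p)) (a, b)
      = (if f = a then if b \<in> carrier G then F (a, inv k \<otimes> b) else 0 else 0)"
    "(\<Sum>p\<in>carrier G \<times> carrier G. tens (bmult (codouble G) p (f, k)) (F p)) (a, b)
      = (if f = a then if b \<in> carrier G then F (a, b \<otimes> inv k) else 0 else 0)"
proof -
  have "(\<Sum>p\<in>carrier G \<times> carrier G. tens (bmult (codouble G) (f, k) p) (F p)) (a, b)
      = (\<Sum>f'\<in>carrier G. if f' = f then if f = a then (\<Sum>m\<in>carrier G. tens (bvec (k \<otimes> m)) (F (f, m))) b else 0 else 0)"
  proof -
    have "(\<Sum>m\<in>carrier G. tens (bmult (codouble G) (f, k) (f', m)) (F (f', m)) (a, b))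
        = (if f' = f then if f = a then (\<Sum>m\<in>carrier G. tens (bvec (k \<otimes> m)) (F (f, m))) b else 0 else 0)" for f'
      by (cases "f' = f"; cases "f = a") (auto simp: bmult_codouble tens_def bvec_apply intro!: sum.cong sum.neutral)
    then show ?thesis
      by (subst sum_fun_apply, simp only: sum.cartesian_product')
  qed
  then show "(\<Sum>p\<in>carrier G \<times> carrier G. tens (bmult (codouble G) (f, k) p) (F p)) (a, b)
      = (if f = a then if b \<in> carrier G then F (a, inv k \<otimes> b) else 0 else 0)"
    unfolding sum_tens_left[OF assms(1)] using assms by auto
  have "(\<Sum>p\<in>carrier G \<times> carrier G. tens (bmult (codouble G) p (f, k)) (F p)) (a, b)
      = (\<Sum>f'\<in>carrier G. if f' = f then if f = a then (\<Sum>m\<in>carrier G. tens (bvec (m \<otimes> k)) (F (f, m))) b else 0 else 0)"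
  proof -
    have "(\<Sum>m\<in>carrier G. tens (bmult (codouble G) (f', m) (f, k)) (F (f', m)) (a, b))
        = (if f' = f then if f = a then (\<Sum>m\<in>carrier G. tens (bvec (m \<otimes> k)) (F (f, m))) b else 0 else 0)" for f'
      by (cases "f' = f"; cases "f = a") (auto simp: bmult_codouble tens_def bvec_apply intro!: sum.cong sum.neutral)
    then show ?thesis
      by (subst sum_fun_apply, simp only: sum.cartesian_product')
  qed
  then show "(\<Sum>p\<in>carrier G \<times> carrier G. tens (bmult (codouble G) p (f, k)) (F p)) (a, b)
      = (if f = a then if b \<in> carrier G then F (a, b \<otimes> inv k) else 0 else 0)"
    unfolding sum_tens_right[OF assms(1)] using assms by auto
qed

text \<open>If the values \<open>v\<close> follow the rules \<open>lg\<close> and \<open>rg\<close>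
  of the generators, a linear map taking these values is a bimodule map automatically, and
  bilinearity extends the values from group elements to all \<open>a db\<close>.\<close>

lemma (in group_calculus) differentiable_map_iff:
  fixes C' :: "('c, 'n::complex_vector) calculus"
  assumes W: "complex_vec.subspace (forms C')"
    and l: "\<And>a w. a \<in> elems (group_algebra G) \<Longrightarrow> w \<in> forms C' \<Longrightarrow>
        lact C' (\<phi> a) w = (\<Sum>g\<in>carrier G. a g *\<^sub>C lact C' (\<phi> (bvec g)) w)"
    and r: "\<And>a w. a \<in> elems (group_algebra G) \<Longrightarrow> w \<in> forms C' \<Longrightarrow>
        ract C' w (\<phi> a) = (\<Sum>g\<in>carrier G. a g *\<^sub>C ract C' w (\<phi> (bvec g)))"
    and ll: "\<And>g. g \<in> carrier G \<Longrightarrow> clinear_on (forms C') (forms C') (lact C' (\<phi> (bvec g)))"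
    and rl: "\<And>g. g \<in> carrier G \<Longrightarrow> clinear_on (forms C') (forms C') (\<lambda>w. ract C' w (\<phi> (bvec g)))"
    and d_in: "\<And>g. g \<in> carrier G \<Longrightarrow> dif C' (\<phi> (bvec g)) \<in> forms C'"
    and d: "\<And>a. a \<in> elems (group_algebra G) \<Longrightarrow> dif C' (\<phi> a) = (\<Sum>g\<in>carrier G. a g *\<^sub>C dif C' (\<phi> (bvec g)))"
    and v: "\<And>h g. h \<in> carrier G \<Longrightarrow> g \<in> carrier G \<Longrightarrow> lact C' (\<phi> (bvec h)) (dif C' (\<phi> (bvec g))) = v h g"
    and lg: "\<And>g h k. g \<in> carrier G \<Longrightarrow> h \<in> carrier G \<Longrightarrow> k \<in> carrier G \<Longrightarrow>
        lact C' (\<phi> (bvec g)) (v h k) = v (g \<otimes> h) k"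
    and rg: "\<And>g h k. g \<in> carrier G \<Longrightarrow> h \<in> carrier G \<Longrightarrow> k \<in> carrier G \<Longrightarrow>
        ract C' (v h k) (\<phi> (bvec g)) = v h (k \<otimes> g) - v (h \<otimes> k) g"
  shows "differentiable_map (group_algebra G) \<Omega> C' \<phi> \<longleftrightarrow>
    (\<exists>\<theta>. clinear_on (forms \<Omega>) (forms C') \<theta> \<and> (\<forall>h\<in>carrier G. \<forall>g\<in>carrier G. \<theta> (gen h g) = v h g))"
proof
  assume "differentiable_map (group_algebra G) \<Omega> C' \<phi>"
  then obtain \<theta> where \<theta>: "bimodule_map (group_algebra G) \<Omega> C' \<phi> \<theta>"
    and val: "\<forall>a\<in>elems (group_algebra G). \<forall>b\<in>elems (group_algebra G). \<theta> (lact \<Omega> a (dif \<Omega> b)) = lact C' (\<phi> a) (dif C' (\<phi> b))"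
    unfolding differentiable_map_def by blast
  have "clinear_on (forms \<Omega>) (forms C') \<theta>"
    using \<theta> by (simp add: bimodule_map_def)
  moreover have "\<theta> (gen h g) = v h g" if "h \<in> carrier G" "g \<in> carrier G" for h g
    using val that by (simp add: gen_def v)
  ultimately show "\<exists>\<theta>. clinear_on (forms \<Omega>) (forms C') \<theta> \<and> (\<forall>h\<in>carrier G. \<forall>g\<in>carrier G. \<theta> (gen h g) = v h g)"
    by blast
next
  assume "\<exists>\<theta>. clinear_on (forms \<Omega>) (forms C') \<theta> \<and> (\<forall>h\<in>carrier G. \<forall>g\<in>carrier G. \<theta> (gen h g) = v h g)"
  then obtain \<theta> where \<theta>: "clinear_on (forms \<Omega>) (forms C') \<theta>"
    and gen: "\<And>h g. h \<in> carrier G \<Longrightarrow> g \<in> carrier G \<Longrightarrow> \<theta> (gen h g) = v h g"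
    by blast
  have "bimodule_map (group_algebra G) \<Omega> C' \<phi> \<theta>"
    by (rule bimodule_mapI[OF W \<theta> l r ll rl]) (simp_all add: gen lg rg)
  moreover have "\<theta> (lact \<Omega> a (dif \<Omega> b)) = lact C' (\<phi> a) (dif C' (\<phi> b))"
    if a: "a \<in> elems (group_algebra G)" and b: "b \<in> elems (group_algebra G)" for a b
  proof -
    have "\<theta> (lact \<Omega> a (dif \<Omega> b)) = \<theta> (\<Sum>i\<in>carrier G \<times> carrier G. (a (fst i) * b (snd i)) *\<^sub>C gen (fst i) (snd i))"
      using lact_dif_expand[OF calculus _ a b] by (simp add: gen_def case_prod_unfold)
    also have "\<dots> = (\<Sum>i\<in>carrier G \<times> carrier G. (a (fst i) * b (snd i)) *\<^sub>C \<theta> (gen (fst i) (snd i)))"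
      by (rule clinear_on_lincomb[OF \<theta> subspace_forms]) auto
    also have "\<dots> = (\<Sum>h\<in>carrier G. a h *\<^sub>C (\<Sum>g\<in>carrier G. b g *\<^sub>C v h g))"
      by (simp add: sum.cartesian_product' gen complex_vec.scale_sum_right)
    also have "\<dots> = (\<Sum>h\<in>carrier G. a h *\<^sub>C lact C' (\<phi> (bvec h)) (dif C' (\<phi> b)))"
      unfolding d[OF b]
      by (intro sum.cong refl, subst clinear_on_lincomb[OF ll W]) (simp_all add: d_in v)
    also have "\<dots> = lact C' (\<phi> a) (dif C' (\<phi> b))"
    proof (rule l[symmetric, OF a])
      show "dif C' (\<phi> b) \<in> forms C'"
        unfolding d[OF b] by (intro complex_vec.subspace_sum complex_vec.subspace_scale W d_in)
    qed
    finally show ?thesis .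
  qed
  ultimately show "differentiable_map (group_algebra G) \<Omega> C' \<phi>"
    unfolding differentiable_map_def by blast
qed

section \<open>Differentiability of the embedding\<close>

locale codouble_calculus = group_calculus G \<Omega>
  for G :: "('g, 'z) monoid_scheme" (structure) and \<Omega> :: "('g, 'm::complex_vector) calculus" +
  fixes \<Omega>D :: "('g \<times> 'g, 'w::complex_vector) calculus"
  assumes calcD: "is_calculus (codouble G) \<Omega>D"
begin

lemmas bimodD = calculusD(1)[OF calcD]

lemmas subspace_formsD = bimoduleD(1)[OF bimodD]


text \<open>A summand of \<open>\<Phi>(h) d\<Phi>(g)\<close>. Two indices remain because
  \<open>\<delta>\<^sub>f d\<delta>\<^sub>f'\<close> need not vanish for different \<open>f\<close>
  and \<open>f'\<close>.\<close>

definition dgen :: "'g \<Rightarrow> 'g \<Rightarrow> 'g \<Rightarrow> 'g \<Rightarrow> 'w" where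
  "dgen f h f' g = lact \<Omega>D (cpt f h) (dif \<Omega>D (cpt f' g))"

lemma cpt_in [simp]: "f \<in> carrier G \<Longrightarrow> g \<in> carrier G \<Longrightarrow> cpt f g \<in> elems (codouble G)"
  by (simp add: bvec_in_elems)

lemma cptl_linear: "f \<in> carrier G \<Longrightarrow> g \<in> carrier G \<Longrightarrow> clinear_on (forms \<Omega>D) (forms \<Omega>D) (lact \<Omega>D (cpt f g))"
  using bimoduleD(2)[OF bimodD] by simp

lemma cptr_linear: "f \<in> carrier G \<Longrightarrow> g \<in> carrier G \<Longrightarrow> clinear_on (forms \<Omega>D) (forms \<Omega>D) (\<lambda>w. ract \<Omega>D w (cpt f g))"
  using bimoduleD(3)[OF bimodD] by simp

lemma dif_cpt_in [simp]: "f \<in> carrier G \<Longrightarrow> g \<in> carrier G \<Longrightarrow> dif \<Omega>D (cpt f g) \<in> forms \<Omega>D"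
  using clinear_onD(1)[OF calculusD(2)[OF calcD]] by simp

lemma cptl_in [simp]:
  "f \<in> carrier G \<Longrightarrow> g \<in> carrier G \<Longrightarrow> w \<in> forms \<Omega>D \<Longrightarrow> lact \<Omega>D (cpt f g) w \<in> forms \<Omega>D"
  using clinear_onD(1)[OF cptl_linear] .

lemma cptr_in [simp]:
  "f \<in> carrier G \<Longrightarrow> g \<in> carrier G \<Longrightarrow> w \<in> forms \<Omega>D \<Longrightarrow> ract \<Omega>D w (cpt f g) \<in> forms \<Omega>D"
  using clinear_onD(1)[OF cptr_linear] .

lemma dgen_in [simp]:
  "f \<in> carrier G \<Longrightarrow> h \<in> carrier G \<Longrightarrow> f' \<in> carrier G \<Longrightarrow> g \<in> carrier G \<Longrightarrow> dgen f h f' g \<in> forms \<Omega>D"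
  by (simp add: dgen_def)

lemma amult_cpt:
  "f \<in> carrier G \<Longrightarrow> h \<in> carrier G \<Longrightarrow> f' \<in> carrier G \<Longrightarrow> g \<in> carrier G \<Longrightarrow>
    amult (codouble G) (cpt f h) (cpt f' g) = (if f = f' then cpt f (h \<otimes> g) else 0)"
  by (simp add: amult_bvec bmult_codouble conj_mult)

lemma lact_zero: "w \<in> forms \<Omega>D \<Longrightarrow> lact \<Omega>D 0 w = 0"
  by (rule clinear_on_zero[OF bimoduleD(4)[OF bimodD] subspace_elems])

lemma cptl_cptl:
  assumes "f \<in> carrier G" "h \<in> carrier G" "f' \<in> carrier G" "g \<in> carrier G" "w \<in> forms \<Omega>D"
  shows "lact \<Omega>D (cpt f h) (lact \<Omega>D (cpt f' g) w) = (if f = f' then lact \<Omega>D (cpt f (h \<otimes> g)) w else 0)"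
  using bimoduleD(8)[OF bimodD, of w "cpt f h" "cpt f' g"] assms by (simp add: amult_cpt lact_zero split: if_splits)

lemma cptl_dgen:
  assumes "f \<in> carrier G" "k \<in> carrier G" "f' \<in> carrier G" "h \<in> carrier G" "f'' \<in> carrier G" "g \<in> carrier G"
  shows "lact \<Omega>D (cpt f k) (dgen f' h f'' g) = (if f = f' then dgen f (k \<otimes> h) f'' g else 0)"
  using assms by (simp add: dgen_def cptl_cptl)

lemma dif_cpt_cptr:
  assumes "f \<in> carrier G" "g \<in> carrier G" "f' \<in> carrier G" "k \<in> carrier G"
  shows "ract \<Omega>D (dif \<Omega>D (cpt f g)) (cpt f' k)
    = (if f = f' then dif \<Omega>D (cpt f (g \<otimes> k)) else 0) - lact \<Omega>D (cpt f g) (dif \<Omega>D (cpt f' k))"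
  using calculusD(3)[OF calcD, of "cpt f g" "cpt f' k"] assms
    clinear_on_zero[OF calculusD(2)[OF calcD] subspace_elems]
  by (simp add: amult_cpt algebra_simps eq_diff_eq split: if_splits)

text \<open>The Leibniz rule again, but orthogonality of the delta functions puts a different
  condition on each term: \<open>f' = f''\<close> for the product under \<open>d\<close>,
  \<open>f = f'\<close> for the product outside. Summing over all indices restores the rule for
  \<open>\<Phi>(h) d\<Phi>(g)\<close>.\<close>

lemma cptr_dgen:
  assumes "f \<in> carrier G" "h \<in> carrier G" "f' \<in> carrier G" "g \<in> carrier G" "f'' \<in> carrier G" "k \<in> carrier G"
  shows "ract \<Omega>D (dgen f h f' g) (cpt f'' k)
    = (if f' = f'' then dgen f h f' (g \<otimes> k) else 0) - (if f = f' then dgen f (h \<otimes> g) f'' k else 0)"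
proof -
  have "ract \<Omega>D (dgen f h f' g) (cpt f'' k) = lact \<Omega>D (cpt f h) (ract \<Omega>D (dif \<Omega>D (cpt f' g)) (cpt f'' k))"
    unfolding dgen_def using bimoduleD(10)[OF bimodD] assms by simp
  also have "\<dots> = lact \<Omega>D (cpt f h) (if f' = f'' then dif \<Omega>D (cpt f' (g \<otimes> k)) else 0)
      - lact \<Omega>D (cpt f h) (lact \<Omega>D (cpt f' g) (dif \<Omega>D (cpt f'' k)))"
    unfolding dif_cpt_cptr[OF assms(3-6)] using assms
    by (intro clinear_on_diff[OF cptl_linear subspace_formsD]) (simp_all add: complex_vec.subspace_0[OF subspace_formsD])
  finally show ?thesis
    using assms by (simp add: dgen_def cptl_cptl clinear_on_zero[OF cptl_linear subspace_formsD])
qed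

definition embed_gen :: "'g \<Rightarrow> 'g \<Rightarrow> 'w" where
  "embed_gen h g = (\<Sum>f\<in>carrier G. \<Sum>f'\<in>carrier G. dgen f h f' g)"

lemma embed_in: "g \<in> carrier G \<Longrightarrow> codouble_embed G (bvec g) \<in> elems (codouble G)"
  by (simp add: codouble_embed_bvec complex_vec.subspace_sum[OF subspace_elems])

lemma lact_embed:
  "g \<in> carrier G \<Longrightarrow> w \<in> forms \<Omega>D \<Longrightarrow>
    lact \<Omega>D (codouble_embed G (bvec g)) w = (\<Sum>f\<in>carrier G. lact \<Omega>D (cpt f g) w)"
  unfolding codouble_embed_bvec by (rule clinear_on_sum[OF bimoduleD(4)[OF bimodD] subspace_elems]) simp_all

lemma ract_embed:
  "g \<in> carrier G \<Longrightarrow> w \<in> forms \<Omega>D \<Longrightarrow>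
    ract \<Omega>D w (codouble_embed G (bvec g)) = (\<Sum>f\<in>carrier G. ract \<Omega>D w (cpt f g))"
  unfolding codouble_embed_bvec by (rule clinear_on_sum[OF bimoduleD(5)[OF bimodD] subspace_elems]) simp_all

lemma dif_embed:
  "g \<in> carrier G \<Longrightarrow> dif \<Omega>D (codouble_embed G (bvec g)) = (\<Sum>f\<in>carrier G. dif \<Omega>D (cpt f g))"
  unfolding codouble_embed_bvec by (rule clinear_on_sum[OF calculusD(2)[OF calcD] subspace_elems]) simp_all

lemma embed_gen_in [simp]: "h \<in> carrier G \<Longrightarrow> g \<in> carrier G \<Longrightarrow> embed_gen h g \<in> forms \<Omega>D"
  unfolding embed_gen_def by (intro complex_vec.subspace_sum subspace_formsD) simp

lemma lact_dif_embed:
  assumes "h \<in> carrier G" "g \<in> carrier G"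
  shows "lact \<Omega>D (codouble_embed G (bvec h)) (dif \<Omega>D (codouble_embed G (bvec g))) = embed_gen h g"
proof -
  have "dif \<Omega>D (codouble_embed G (bvec g)) \<in> forms \<Omega>D"
    using assms by (intro clinear_onD(1)[OF calculusD(2)[OF calcD]] embed_in)
  then have "lact \<Omega>D (codouble_embed G (bvec h)) (dif \<Omega>D (codouble_embed G (bvec g)))
      = (\<Sum>f\<in>carrier G. lact \<Omega>D (cpt f h) (\<Sum>f'\<in>carrier G. dif \<Omega>D (cpt f' g)))"
    using assms by (simp add: lact_embed dif_embed)
  also have "\<dots> = embed_gen h g"
    unfolding embed_gen_def dgen_def using assms
    by (intro sum.cong refl clinear_on_sum[OF cptl_linear subspace_formsD]) auto
  finally show ?thesis .
qed

lemma embed_differentiable_iff: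
  "differentiable_map (group_algebra G) \<Omega> \<Omega>D (codouble_embed G) \<longleftrightarrow>
    (\<exists>\<theta>. clinear_on (forms \<Omega>) (forms \<Omega>D) \<theta> \<and> (\<forall>h\<in>carrier G. \<forall>g\<in>carrier G. \<theta> (gen h g) = embed_gen h g))"
proof (rule differentiable_map_iff[OF subspace_formsD])
  fix a w assume w: "w \<in> forms \<Omega>D"
  show "lact \<Omega>D (codouble_embed G a) w = (\<Sum>g\<in>carrier G. a g *\<^sub>C lact \<Omega>D (codouble_embed G (bvec g)) w)"
    unfolding codouble_embed_expand[of a]
    by (rule clinear_on_lincomb[OF bimoduleD(4)[OF bimodD w] subspace_elems embed_in])
  show "ract \<Omega>D w (codouble_embed G a) = (\<Sum>g\<in>carrier G. a g *\<^sub>C ract \<Omega>D w (codouble_embed G (bvec g)))"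
    unfolding codouble_embed_expand[of a]
    by (rule clinear_on_lincomb[OF bimoduleD(5)[OF bimodD w] subspace_elems embed_in])
next
  fix g assume g: "g \<in> carrier G"
  show "clinear_on (forms \<Omega>D) (forms \<Omega>D) (lact \<Omega>D (codouble_embed G (bvec g)))"
    by (rule bimoduleD(2)[OF bimodD embed_in[OF g]])
  show "clinear_on (forms \<Omega>D) (forms \<Omega>D) (\<lambda>w. ract \<Omega>D w (codouble_embed G (bvec g)))"
    by (rule bimoduleD(3)[OF bimodD embed_in[OF g]])
  show "dif \<Omega>D (codouble_embed G (bvec g)) \<in> forms \<Omega>D"
    by (rule clinear_onD(1)[OF calculusD(2)[OF calcD] embed_in[OF g]])
next
  fix a
  show "dif \<Omega>D (codouble_embed G a) = (\<Sum>g\<in>carrier G. a g *\<^sub>C dif \<Omega>D (codouble_embed G (bvec g)))"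
    unfolding codouble_embed_expand[of a]
    by (rule clinear_on_lincomb[OF calculusD(2)[OF calcD] subspace_elems embed_in])
next
  fix g h k assume G: "g \<in> carrier G" "h \<in> carrier G" "k \<in> carrier G"
  show "lact \<Omega>D (codouble_embed G (bvec g)) (embed_gen h k) = embed_gen (g \<otimes> h) k"
  proof -
    have "lact \<Omega>D (codouble_embed G (bvec g)) (embed_gen h k)
        = (\<Sum>f''\<in>carrier G. lact \<Omega>D (cpt f'' g) (embed_gen h k))"
      using G by (simp add: lact_embed)
    also have "\<dots> = (\<Sum>f''\<in>carrier G. \<Sum>f\<in>carrier G. \<Sum>f'\<in>carrier G. lact \<Omega>D (cpt f'' g) (dgen f h f' k))"
      unfolding embed_gen_def using G
      by (intro sum.cong refl)
        (simp add: clinear_on_sum[OF cptl_linear subspace_formsD] complex_vec.subspace_sum[OF subspace_formsD])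
    also have "\<dots> = (\<Sum>f''\<in>carrier G. \<Sum>f\<in>carrier G. if f'' = f then \<Sum>f'\<in>carrier G. dgen f (g \<otimes> h) f' k else 0)"
      using G by (intro sum.cong refl) (auto simp: cptl_dgen)
    finally show ?thesis
      by (simp add: embed_gen_def)
  qed
  show "ract \<Omega>D (embed_gen h k) (codouble_embed G (bvec g)) = embed_gen h (k \<otimes> g) - embed_gen (h \<otimes> k) g"
  proof -
    have "ract \<Omega>D (embed_gen h k) (codouble_embed G (bvec g))
        = (\<Sum>f''\<in>carrier G. ract \<Omega>D (embed_gen h k) (cpt f'' g))"
      using G by (simp add: ract_embed)
    also have "\<dots> = (\<Sum>f''\<in>carrier G. \<Sum>f\<in>carrier G. \<Sum>f'\<in>carrier G. ract \<Omega>D (dgen f h f' k) (cpt f'' g))"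
      unfolding embed_gen_def using G
      by (intro sum.cong refl)
        (simp add: clinear_on_sum[OF cptr_linear subspace_formsD] complex_vec.subspace_sum[OF subspace_formsD])
    also have "\<dots> = (\<Sum>f''\<in>carrier G. \<Sum>f\<in>carrier G. \<Sum>f'\<in>carrier G. if f' = f'' then dgen f h f' (k \<otimes> g) else 0)
        - (\<Sum>f''\<in>carrier G. \<Sum>f\<in>carrier G. \<Sum>f'\<in>carrier G. if f = f' then dgen f (h \<otimes> k) f'' g else 0)"
      using G by (simp add: cptr_dgen sum_subtractf)
    also have "\<dots> = (\<Sum>f''\<in>carrier G. \<Sum>f\<in>carrier G. dgen f h f'' (k \<otimes> g))
        - (\<Sum>f''\<in>carrier G. \<Sum>f\<in>carrier G. dgen f (h \<otimes> k) f'' g)"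
      by simp
    finally show ?thesis
      \<comment> \<open>The surviving outer index belongs to the differential, which is the inner
        index of \<open>embed_gen\<close>.\<close>
      unfolding embed_gen_def by (simp only:) (intro arg_cong2[where f = minus] sum.swap)
  qed
qed (rule lact_dif_embed)

section \<open>The coaction and the tensor product calculus\<close>

abbreviation "\<Omega>T \<equiv> tensor_calculus (codouble G) \<Omega>D (group_algebra G) \<Omega>"

text \<open>The coefficient at \<open>q\<close> of the part of
  \<open>\<Delta>\<^sub>L(h) d\<Delta>\<^sub>L(g)\<close> whose forms lie on the codouble: the
  codouble legs form \<open>dgen f h f' g\<close>, while the legs in the group algebra
  multiply.\<close>

definition coact1 :: "'g \<Rightarrow> 'g \<Rightarrow> 'g \<Rightarrow> 'w" where
  "coact1 h g q = (\<Sum>f\<in>carrier G. \<Sum>f'\<in>carrier G. if cj f h \<otimes> cj f' g = q then dgen f h f' g else 0)"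

text \<open>The part whose forms lie on the group algebra. Here the codouble legs multiply, which
  forces equal \<open>f\<close>, and the result is the map required by covariance.\<close>

definition coact2 :: "'g \<Rightarrow> 'g \<Rightarrow> 'g \<times> 'g \<Rightarrow> 'm" where
  "coact2 h g = (\<lambda>(f, k). if f \<in> carrier G \<and> cj f (h \<otimes> g) = k then gen (cj f h) (cj f g) else 0)"

lemma forms_tensor:
  "forms \<Omega>T = tensor_space (carrier G) (forms \<Omega>D) \<times> tensor_space (carrier G \<times> carrier G) (forms \<Omega>)"
  by (simp add: tensor_calculus_def)

lemma subspace_forms_tensor: "complex_vec.subspace (forms \<Omega>T)"
proof -
  note subs = subspace_tensor_space[OF subspace_formsD, of "carrier G"]
    subspace_tensor_space[OF subspace_forms, of "carrier G \<times> carrier G"]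
  show ?thesis
    unfolding forms_tensor
    by (rule complex_vec.subspaceI)
      (auto simp: zero_prod_def scaleC_prod_def complex_vec.subspace_0[OF subs(1)] complex_vec.subspace_0[OF subs(2)]
        complex_vec.subspace_add[OF subs(1)] complex_vec.subspace_add[OF subs(2)]
        complex_vec.subspace_scale[OF subs(1)] complex_vec.subspace_scale[OF subs(2)])
qed

text \<open>The action is defined by expansion in the basis, hence it is linear in the acting
  element for all arguments, without membership conditions.\<close>

lemma lact_tensor_lincomb:
  "lact \<Omega>T (\<Sum>i\<in>I. c i *\<^sub>C F i) w = (\<Sum>i\<in>I. c i *\<^sub>C lact \<Omega>T (F i) w)"
proof (cases w)
  case (Pair W Z)
  show ?thesis
    by (simp add: Pair tensor_calculus_def complex_vec.scale_sum_left complex_vec.scale_sum_right del: scaleC_pair)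
      (simp add: sum.swap[of _ I])
qed

lemma ract_tensor_lincomb:
  "ract \<Omega>T w (\<Sum>i\<in>I. c i *\<^sub>C F i) = (\<Sum>i\<in>I. c i *\<^sub>C ract \<Omega>T w (F i))"
proof (cases w)
  case (Pair W Z)
  show ?thesis
    by (simp add: Pair tensor_calculus_def complex_vec.scale_sum_left complex_vec.scale_sum_right del: scaleC_pair)
      (simp add: sum.swap[of _ I])
qed

text \<open>In the first component all \<open>f\<close> contribute, since the codouble leg acts on
  forms; in the second the codouble legs multiply, and the row \<open>f\<close> sees the summand
  with that \<open>f\<close> alone.\<close>

lemma lact_tensor:
  assumes g: "g \<in> carrier G"
  shows "lact \<Omega>T (coaction G (bvec g)) (W, Z) =
    (\<lambda>q. if q \<in> carrier G then \<Sum>f\<in>carrier G. lact \<Omega>D (cpt f g) (W (inv (cj f g) \<otimes> q)) else 0,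
     \<lambda>(f, m). if f \<in> carrier G \<and> m \<in> carrier G then gact (cj f g) (Z (f, inv (cj f g) \<otimes> m)) else 0)"
proof -
  have "lact \<Omega>T (coaction G (bvec g)) (W, Z) = (\<Sum>f\<in>carrier G.
      (\<Sum>q\<in>carrier G. tens (bvec (cj f g \<otimes> q)) (lact \<Omega>D (cpt f g) (W q)),
       \<Sum>p\<in>carrier G \<times> carrier G. tens (bmult (codouble G) (f, cj f g) p) (gact (cj f g) (Z p))))"
    by (simp add: tensor_calculus_def sum_coaction[OF g] del: scaleC_pair)
  also have "\<dots> = (\<Sum>f\<in>carrier G. \<Sum>q\<in>carrier G. tens (bvec (cj f g \<otimes> q)) (lact \<Omega>D (cpt f g) (W q)),
      \<Sum>f\<in>carrier G. \<Sum>p\<in>carrier G \<times> carrier G. tens (bmult (codouble G) (f, cj f g) p) (gact (cj f g) (Z p)))"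
    by (rule sum_prod)
  also have "(\<Sum>f\<in>carrier G. \<Sum>q\<in>carrier G. tens (bvec (cj f g \<otimes> q)) (lact \<Omega>D (cpt f g) (W q))) =
      (\<lambda>q. if q \<in> carrier G then \<Sum>f\<in>carrier G. lact \<Omega>D (cpt f g) (W (inv (cj f g) \<otimes> q)) else 0)"
    by (rule ext, subst sum_fun_apply) (use g in \<open>simp add: sum_tens_left del: sum_fun_apply\<close>)
  also have "(\<Sum>f\<in>carrier G. \<Sum>p\<in>carrier G \<times> carrier G. tens (bmult (codouble G) (f, cj f g) p) (gact (cj f g) (Z p))) =
      (\<lambda>(f, m). if f \<in> carrier G \<and> m \<in> carrier G then gact (cj f g) (Z (f, inv (cj f g) \<otimes> m)) else 0)"
    by (rule ext, subst sum_fun_apply) (use g in \<open>auto simp add: sum_tens_bmult simp del: sum_fun_apply\<close>)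
  finally show ?thesis .
qed

lemma ract_tensor:
  assumes g: "g \<in> carrier G"
  shows "ract \<Omega>T (W, Z) (coaction G (bvec g)) =
    (\<lambda>q. if q \<in> carrier G then \<Sum>f\<in>carrier G. ract \<Omega>D (W (q \<otimes> inv (cj f g))) (cpt f g) else 0,
     \<lambda>(f, m). if f \<in> carrier G \<and> m \<in> carrier G then gactr (Z (f, m \<otimes> inv (cj f g))) (cj f g) else 0)"
proof -
  have "ract \<Omega>T (W, Z) (coaction G (bvec g)) = (\<Sum>f\<in>carrier G.
      (\<Sum>q\<in>carrier G. tens (bvec (q \<otimes> cj f g)) (ract \<Omega>D (W q) (cpt f g)),
       \<Sum>p\<in>carrier G \<times> carrier G. tens (bmult (codouble G) p (f, cj f g)) (gactr (Z p) (cj f g))))"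
    by (simp add: tensor_calculus_def sum_coaction[OF g] del: scaleC_pair)
  also have "\<dots> = (\<Sum>f\<in>carrier G. \<Sum>q\<in>carrier G. tens (bvec (q \<otimes> cj f g)) (ract \<Omega>D (W q) (cpt f g)),
      \<Sum>f\<in>carrier G. \<Sum>p\<in>carrier G \<times> carrier G. tens (bmult (codouble G) p (f, cj f g)) (gactr (Z p) (cj f g)))"
    by (rule sum_prod)
  also have "(\<Sum>f\<in>carrier G. \<Sum>q\<in>carrier G. tens (bvec (q \<otimes> cj f g)) (ract \<Omega>D (W q) (cpt f g))) =
      (\<lambda>q. if q \<in> carrier G then \<Sum>f\<in>carrier G. ract \<Omega>D (W (q \<otimes> inv (cj f g))) (cpt f g) else 0)"
    by (rule ext, subst sum_fun_apply) (use g in \<open>simp add: sum_tens_right del: sum_fun_apply\<close>)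
  also have "(\<Sum>f\<in>carrier G. \<Sum>p\<in>carrier G \<times> carrier G. tens (bmult (codouble G) p (f, cj f g)) (gactr (Z p) (cj f g))) =
      (\<lambda>(f, m). if f \<in> carrier G \<and> m \<in> carrier G then gactr (Z (f, m \<otimes> inv (cj f g))) (cj f g) else 0)"
    by (rule ext, subst sum_fun_apply) (use g in \<open>auto simp add: sum_tens_bmult simp del: sum_fun_apply\<close>)
  finally show ?thesis .
qed

lemma dif_tensor:
  assumes g: "g \<in> carrier G"
  shows "dif \<Omega>T (coaction G (bvec g)) =
    (\<lambda>q. \<Sum>f\<in>carrier G. if cj f g = q then dif \<Omega>D (cpt f g) else 0,
     \<lambda>(f, k). if f \<in> carrier G \<and> cj f g = k then dif \<Omega> (bvec (cj f g)) else 0)"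
proof -
  have "(\<lambda>x. coaction G (bvec g) (x, q)) = (\<Sum>f\<in>carrier G. (if cj f g = q then 1 else 0) *\<^sub>C cpt f g)" for q
    unfolding coaction_bvec[OF g] by (auto simp: fun_eq_iff bvec_apply intro!: sum.cong)
  then have "dif \<Omega>D (\<lambda>x. coaction G (bvec g) (x, q))
      = (\<Sum>f\<in>carrier G. (if cj f g = q then 1 else 0) *\<^sub>C dif \<Omega>D (cpt f g))" for q
    using g by (simp only: clinear_on_lincomb[OF calculusD(2)[OF calcD] subspace_elems] cpt_in)
  moreover have "(\<lambda>y. coaction G (bvec g) ((f, k), y)) = (if f \<in> carrier G \<and> cj f g = k then bvec (cj f g) else 0)" for f k
    by (auto simp: fun_eq_iff coaction_apply[OF g] bvec_apply)
  ultimately show ?thesis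
    by (auto simp: tensor_calculus_def fun_eq_iff clinear_on_zero[OF calculusD(2)[OF calculus] subspace_elems])
qed

lemma coact_in:
  assumes "h \<in> carrier G" "g \<in> carrier G"
  shows "(coact1 h g, coact2 h g) \<in> forms \<Omega>T"
proof -
  have "coact1 h g q \<in> forms \<Omega>D" for q
    unfolding coact1_def using assms
    by (intro complex_vec.subspace_sum subspace_formsD) (auto simp: complex_vec.subspace_0[OF subspace_formsD])
  moreover have "coact1 h g q = 0" if "q \<notin> carrier G" for q
    unfolding coact1_def using assms that by (intro sum.neutral ballI) auto
  ultimately show ?thesis
    using assms by (auto simp: forms_tensor tensor_space_def coact2_def complex_vec.subspace_0[OF subspace_forms])
qed

lemma coact2_apply:
  "coact2 h g (f, k) = (if f \<in> carrier G \<and> cj f (h \<otimes> g) = k then gen (cj f h) (cj f g) else 0)"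
  by (simp add: coact2_def)

lemma lact_coact:
  assumes G: "k \<in> carrier G" "h \<in> carrier G" "g \<in> carrier G"
  shows "lact \<Omega>T (coaction G (bvec k)) (coact1 h g, coact2 h g) = (coact1 (k \<otimes> h) g, coact2 (k \<otimes> h) g)"
proof -
  have e1: "(\<Sum>f\<in>carrier G. lact \<Omega>D (cpt f k) (coact1 h g (inv (cj f k) \<otimes> q))) = coact1 (k \<otimes> h) g q"
    if q: "q \<in> carrier G" for q
  proof -
    have "(\<Sum>f\<in>carrier G. lact \<Omega>D (cpt f k) (coact1 h g (inv (cj f k) \<otimes> q)))
        = (\<Sum>f\<in>carrier G. \<Sum>f'\<in>carrier G. \<Sum>f''\<in>carrier G.
            if cj f' h \<otimes> cj f'' g = inv (cj f k) \<otimes> q then lact \<Omega>D (cpt f k) (dgen f' h f'' g) else 0)"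
      unfolding coact1_def using G
      by (simp add: clinear_on_sum[OF cptl_linear subspace_formsD] complex_vec.subspace_sum[OF subspace_formsD]
          complex_vec.subspace_0[OF subspace_formsD] if_zero_linear[OF cptl_linear subspace_formsD])
    also have "\<dots> = (\<Sum>f\<in>carrier G. \<Sum>f'\<in>carrier G. if f = f' then
        \<Sum>f''\<in>carrier G. if cj f (k \<otimes> h) \<otimes> cj f'' g = q then dgen f (k \<otimes> h) f'' g else 0 else 0)"
      using G q by (intro sum.cong refl)
        (auto simp: cptl_dgen translate_iff conj_mult m_assoc intro!: sum.cong sum.neutral)
    finally show ?thesis
      by (simp add: coact1_def)
  qed
  have o1: "coact1 (k \<otimes> h) g q = 0" if "q \<notin> carrier G" for q
    unfolding coact1_def using G that by (intro sum.neutral ballI) auto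
  have e2: "gact (cj f k) (coact2 h g (f, inv (cj f k) \<otimes> m)) = coact2 (k \<otimes> h) g (f, m)"
    if "f \<in> carrier G" "m \<in> carrier G" for f m
    using G that
    by (simp add: coact2_apply if_zero_linear[OF gact_linear subspace_forms] gact_gen translate_iff conj_mult m_assoc)
  have o2: "coact2 (k \<otimes> h) g (f, m) = 0" if "\<not> (f \<in> carrier G \<and> m \<in> carrier G)" for f m
    using G that by (auto simp: coact2_apply)
  show ?thesis
    unfolding lact_tensor[OF G(1)] by (simp add: fun_eq_iff e1 o1 e2 o2)
qed

lemma ract_coact:
  assumes G: "k \<in> carrier G" "h \<in> carrier G" "g \<in> carrier G"
  shows "ract \<Omega>T (coact1 h g, coact2 h g) (coaction G (bvec k))
    = (coact1 h (g \<otimes> k), coact2 h (g \<otimes> k)) - (coact1 (h \<otimes> g) k, coact2 (h \<otimes> g) k)"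
proof -
  have e1: "(\<Sum>f\<in>carrier G. ract \<Omega>D (coact1 h g (q \<otimes> inv (cj f k))) (cpt f k))
      = coact1 h (g \<otimes> k) q - coact1 (h \<otimes> g) k q"
    if q: "q \<in> carrier G" for q
  proof -
    have "(\<Sum>f\<in>carrier G. ract \<Omega>D (coact1 h g (q \<otimes> inv (cj f k))) (cpt f k))
        = (\<Sum>f\<in>carrier G. \<Sum>f'\<in>carrier G. \<Sum>f''\<in>carrier G.
            if cj f' h \<otimes> cj f'' g = q \<otimes> inv (cj f k) then ract \<Omega>D (dgen f' h f'' g) (cpt f k) else 0)"
      unfolding coact1_def using G
      by (simp add: clinear_on_sum[OF cptr_linear subspace_formsD] complex_vec.subspace_sum[OF subspace_formsD]
          complex_vec.subspace_0[OF subspace_formsD] if_zero_linear[OF cptr_linear subspace_formsD])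
    \<comment> \<open>Under the index condition of each Leibniz term, two adjacent conjugates share
      their index and merge by \<open>conj_mult\<close>, which gives the support condition of the
      corresponding \<open>coact1\<close>.\<close>
    also have "\<dots> = (\<Sum>f\<in>carrier G. \<Sum>f'\<in>carrier G. \<Sum>f''\<in>carrier G.
        (if f'' = f then (if cj f' h \<otimes> cj f (g \<otimes> k) = q then dgen f' h f (g \<otimes> k) else 0) else 0)
        - (if f' = f'' then (if cj f' (h \<otimes> g) \<otimes> cj f k = q then dgen f' (h \<otimes> g) f k else 0) else 0))"
      using G q by (intro sum.cong refl)
        (auto simp: cptr_dgen translate_iff conj_mult m_assoc)
    also have "\<dots> = (\<Sum>f\<in>carrier G. \<Sum>f'\<in>carrier G. if cj f' h \<otimes> cj f (g \<otimes> k) = q then dgen f' h f (g \<otimes> k) else 0)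
        - (\<Sum>f\<in>carrier G. \<Sum>f'\<in>carrier G. if cj f' (h \<otimes> g) \<otimes> cj f k = q then dgen f' (h \<otimes> g) f k else 0)"
      by (simp add: sum_subtractf)
    finally show ?thesis
      unfolding coact1_def by (simp only:) (intro arg_cong2[where f = minus] sum.swap)
  qed
  have o1: "coact1 h (g \<otimes> k) q = 0" "coact1 (h \<otimes> g) k q = 0" if "q \<notin> carrier G" for q
    unfolding coact1_def using G that by (intro sum.neutral ballI; auto)+
  have e2: "gactr (coact2 h g (f, m \<otimes> inv (cj f k))) (cj f k) = coact2 h (g \<otimes> k) (f, m) - coact2 (h \<otimes> g) k (f, m)"
    if "f \<in> carrier G" "m \<in> carrier G" for f m
    using G that
    by (simp add: coact2_apply if_zero_linear[OF gactr_linear subspace_forms] gactr_gen translate_iff conj_mult m_assoc)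
  have o2: "coact2 h (g \<otimes> k) (f, m) = 0" "coact2 (h \<otimes> g) k (f, m) = 0" if "\<not> (f \<in> carrier G \<and> m \<in> carrier G)" for f m
    using G that by (auto simp: coact2_apply)
  show ?thesis
    unfolding ract_tensor[OF G(1)] by (simp add: fun_eq_iff e1 o1 e2 o2)
qed

lemma lact_dif_tensor:
  assumes G: "h \<in> carrier G" "g \<in> carrier G"
  shows "lact \<Omega>T (coaction G (bvec h)) (dif \<Omega>T (coaction G (bvec g))) = (coact1 h g, coact2 h g)"
proof -
  have e1: "(\<Sum>f\<in>carrier G. lact \<Omega>D (cpt f h)
      (\<Sum>f'\<in>carrier G. if cj f' g = inv (cj f h) \<otimes> q then dif \<Omega>D (cpt f' g) else 0)) = coact1 h g q"
    if q: "q \<in> carrier G" for q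
    unfolding coact1_def dgen_def using G q
    by (simp add: clinear_on_sum[OF cptl_linear subspace_formsD] complex_vec.subspace_0[OF subspace_formsD]
        if_zero_linear[OF cptl_linear subspace_formsD] translate_iff)
  have o1: "coact1 h g q = 0" if "q \<notin> carrier G" for q
    unfolding coact1_def using G that by (intro sum.neutral ballI) auto
  have e2: "gact (cj f h) (if cj f g = inv (cj f h) \<otimes> m then dif \<Omega> (bvec (cj f g)) else 0) = coact2 h g (f, m)"
    if "f \<in> carrier G" "m \<in> carrier G" for f m
    using G that
    by (simp add: coact2_apply if_zero_linear[OF gact_linear subspace_forms] gen_def translate_iff conj_mult)
  have o2: "coact2 h g (f, m) = 0" if "\<not> (f \<in> carrier G \<and> m \<in> carrier G)" for f m
    using G that by (auto simp: coact2_apply)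
  show ?thesis
    unfolding dif_tensor[OF G(2)] lact_tensor[OF G(1)] by (simp add: fun_eq_iff e1 o1 e2 o2)
qed

lemma dif_tensor_in:
  assumes g: "g \<in> carrier G"
  shows "dif \<Omega>T (coaction G (bvec g)) \<in> forms \<Omega>T"
proof -
  have "(\<Sum>f\<in>carrier G. if cj f g = q then dif \<Omega>D (cpt f g) else 0) \<in> forms \<Omega>D" for q
    using g by (intro complex_vec.subspace_sum subspace_formsD if_zero_in dif_cpt_in)
  moreover have "(\<Sum>f\<in>carrier G. if cj f g = q then dif \<Omega>D (cpt f g) else 0) = 0" if "q \<notin> carrier G" for q
    using g that by (intro sum.neutral) auto
  ultimately show ?thesis
    using g by (auto simp: dif_tensor forms_tensor tensor_space_def complex_vec.subspace_0[OF subspace_forms])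
qed

lemma dif_tensor_expand:
  "dif \<Omega>T (coaction G a) = (\<Sum>g\<in>carrier G. a g *\<^sub>C dif \<Omega>T (coaction G (bvec g)))"
proof -
  have "(\<lambda>x. coaction G a (x, q)) = (\<Sum>g\<in>carrier G. a g *\<^sub>C (\<lambda>x. coaction G (bvec g) (x, q)))" for q
    unfolding coaction_expand[of a] by (simp add: fun_eq_iff)
  moreover have "(\<lambda>x. coaction G (bvec g) (x, q)) \<in> elems (codouble G)" if "g \<in> carrier G" for g q
    using that by (auto simp: elems_def tensor_space_def coaction_apply)
  ultimately have e1: "dif \<Omega>D (\<lambda>x. coaction G a (x, q))
      = (\<Sum>g\<in>carrier G. a g *\<^sub>C dif \<Omega>D (\<lambda>x. coaction G (bvec g) (x, q)))" for q
    by (simp only: clinear_on_lincomb[OF calculusD(2)[OF calcD] subspace_elems])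
  have "(\<lambda>y. coaction G a (x, y)) = (\<Sum>g\<in>carrier G. a g *\<^sub>C (\<lambda>y. coaction G (bvec g) (x, y)))" for x
    unfolding coaction_expand[of a] by (simp add: fun_eq_iff)
  moreover have "(\<lambda>y. coaction G (bvec g) (x, y)) \<in> elems (group_algebra G)" if "g \<in> carrier G" for g x
    using that by (cases x) (auto simp: elems_def tensor_space_def coaction_apply)
  ultimately have e2: "dif \<Omega> (\<lambda>y. coaction G a (x, y))
      = (\<Sum>g\<in>carrier G. a g *\<^sub>C dif \<Omega> (\<lambda>y. coaction G (bvec g) (x, y)))" for x
    by (simp only: clinear_on_lincomb[OF calculusD(2)[OF calculus] subspace_elems])
  show ?thesis
    by (simp add: tensor_calculus_def e1 e2 sum_prod fun_eq_iff)
qed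

lemma lact_tensor_linear:
  assumes g: "g \<in> carrier G"
  shows "clinear_on (forms \<Omega>T) (forms \<Omega>T) (lact \<Omega>T (coaction G (bvec g)))"
proof -
  have "lact \<Omega>T (coaction G (bvec g)) w \<in> forms \<Omega>T" if "w \<in> forms \<Omega>T" for w
    using g that by (cases w) (auto simp: lact_tensor forms_tensor tensor_space_def
        intro!: complex_vec.subspace_sum subspace_formsD)
  moreover have "lact \<Omega>T (coaction G (bvec g)) (w + w')
      = lact \<Omega>T (coaction G (bvec g)) w + lact \<Omega>T (coaction G (bvec g)) w'"
    if "w \<in> forms \<Omega>T" "w' \<in> forms \<Omega>T" for w w'
    using g that by (cases w; cases w') (auto simp: lact_tensor forms_tensor tensor_space_def fun_eq_iff
        clinear_onD(2)[OF cptl_linear] clinear_onD(2)[OF gact_linear] sum.distrib)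
  moreover have "lact \<Omega>T (coaction G (bvec g)) (c *\<^sub>C w) = c *\<^sub>C lact \<Omega>T (coaction G (bvec g)) w"
    if "w \<in> forms \<Omega>T" for w c
    using g that by (cases w) (auto simp: lact_tensor forms_tensor tensor_space_def fun_eq_iff
        clinear_onD(3)[OF cptl_linear] clinear_onD(3)[OF gact_linear] complex_vec.scale_sum_right)
  ultimately show ?thesis
    by (auto simp: clinear_on_def)
qed

lemma ract_tensor_linear:
  assumes g: "g \<in> carrier G"
  shows "clinear_on (forms \<Omega>T) (forms \<Omega>T) (\<lambda>w. ract \<Omega>T w (coaction G (bvec g)))"
proof -
  have "ract \<Omega>T w (coaction G (bvec g)) \<in> forms \<Omega>T" if "w \<in> forms \<Omega>T" for w
    using g that by (cases w) (auto simp: ract_tensor forms_tensor tensor_space_def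
        intro!: complex_vec.subspace_sum subspace_formsD)
  moreover have "ract \<Omega>T (w + w') (coaction G (bvec g))
      = ract \<Omega>T w (coaction G (bvec g)) + ract \<Omega>T w' (coaction G (bvec g))"
    if "w \<in> forms \<Omega>T" "w' \<in> forms \<Omega>T" for w w'
    using g that by (cases w; cases w') (auto simp: ract_tensor forms_tensor tensor_space_def fun_eq_iff
        clinear_onD(2)[OF cptr_linear] clinear_onD(2)[OF gactr_linear] sum.distrib)
  moreover have "ract \<Omega>T (c *\<^sub>C w) (coaction G (bvec g)) = c *\<^sub>C ract \<Omega>T w (coaction G (bvec g))"
    if "w \<in> forms \<Omega>T" for w c
    using g that by (cases w) (auto simp: ract_tensor forms_tensor tensor_space_def fun_eq_iff
        clinear_onD(3)[OF cptr_linear] clinear_onD(3)[OF gactr_linear] complex_vec.scale_sum_right)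
  ultimately show ?thesis
    by (auto simp: clinear_on_def)
qed

section \<open>Comparison of the two differentiability conditions\<close>

lemma coaction_differentiable_iff:
  "differentiable_map (group_algebra G) \<Omega> \<Omega>T (coaction G) \<longleftrightarrow>
    (\<exists>\<theta>. clinear_on (forms \<Omega>) (forms \<Omega>T) \<theta> \<and>
      (\<forall>h\<in>carrier G. \<forall>g\<in>carrier G. \<theta> (gen h g) = (coact1 h g, coact2 h g)))"
proof (rule differentiable_map_iff[OF subspace_forms_tensor])
  fix a w
  show "lact \<Omega>T (coaction G a) w = (\<Sum>g\<in>carrier G. a g *\<^sub>C lact \<Omega>T (coaction G (bvec g)) w)"
    unfolding coaction_expand[of a] by (rule lact_tensor_lincomb)
  show "ract \<Omega>T w (coaction G a) = (\<Sum>g\<in>carrier G. a g *\<^sub>C ract \<Omega>T w (coaction G (bvec g)))"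
    unfolding coaction_expand[of a] by (rule ract_tensor_lincomb)
qed (rule lact_tensor_linear ract_tensor_linear dif_tensor_in dif_tensor_expand lact_dif_tensor lact_coact ract_coact; assumption)+

text \<open>Applying the counit to the second tensor factor turns the coaction into the embedding.\<close>

lemma embed_differentiable_if:
  assumes "differentiable_map (group_algebra G) \<Omega> \<Omega>T (coaction G)"
  shows "differentiable_map (group_algebra G) \<Omega> \<Omega>D (codouble_embed G)"
proof -
  obtain \<theta> where \<theta>: "clinear_on (forms \<Omega>) (forms \<Omega>T) \<theta>"
    and gen: "\<And>h g. h \<in> carrier G \<Longrightarrow> g \<in> carrier G \<Longrightarrow> \<theta> (gen h g) = (coact1 h g, coact2 h g)"
    using assms unfolding coaction_differentiable_iff by blast
  have "clinear_on (forms \<Omega>) (forms \<Omega>D) (\<lambda>w. fst (\<theta> w) q)" if "q \<in> carrier G" for q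
    using \<theta> that by (auto simp: clinear_on_def forms_tensor tensor_space_def Pi_iff mem_Times_iff scaleC_prod_def)
  then have "clinear_on (forms \<Omega>) (forms \<Omega>D) (\<lambda>w. \<Sum>q\<in>carrier G. fst (\<theta> w) q)"
    by (rule clinear_on_sumI[OF subspace_formsD])
  moreover have "(\<Sum>q\<in>carrier G. coact1 h g q) = embed_gen h g" if "h \<in> carrier G" "g \<in> carrier G" for h g
  proof -
    \<comment> \<open>Each pair \<open>(f, f')\<close> contributes at exactly one \<open>q\<close>,
      so summing over \<open>q\<close> removes the support condition.\<close>
    have "(\<Sum>q\<in>carrier G. coact1 h g q) = (\<Sum>f\<in>carrier G. \<Sum>q\<in>carrier G. \<Sum>f'\<in>carrier G.
        if cj f h \<otimes> cj f' g = q then dgen f h f' g else 0)"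
      unfolding coact1_def by (rule sum.swap)
    also have "\<dots> = (\<Sum>f\<in>carrier G. \<Sum>f'\<in>carrier G. \<Sum>q\<in>carrier G.
        if cj f h \<otimes> cj f' g = q then dgen f h f' g else 0)"
      by (rule sum.cong[OF refl], rule sum.swap)
    finally show ?thesis
      using that by (simp add: embed_gen_def)
  qed
  ultimately show ?thesis
    unfolding embed_differentiable_iff by (auto simp: gen intro!: exI[of _ "\<lambda>w. \<Sum>q\<in>carrier G. fst (\<theta> w) q"])
qed

text \<open>
  Since the embedding \<open>\<Phi>\<close> intertwines \<open>\<Delta>\<close> with the coaction, the coaction can be read off from
  the right coaction of the codouble on \<open>\<Phi>(h) d\<Phi>(g)\<close>: as \<open>\<Phi>\<close> is injective, its first tensor
  factor is recovered as the coefficient at the basis elements \<open>\<delta>\<^sub>e \<otimes> q\<close>.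
\<close>

lemma coaction_differentiable_if:
  assumes cov: "codouble_covariant G \<Omega>" and bicov: "bicovariant (codouble G) \<Omega>D"
    and diff: "differentiable_map (group_algebra G) \<Omega> \<Omega>D (codouble_embed G)"
  shows "differentiable_map (group_algebra G) \<Omega> \<Omega>T (coaction G)"
proof -
  let ?B = "(carrier G \<times> carrier G) \<times> (carrier G \<times> carrier G)"
  obtain K where K_linear: "\<And>f k. f \<in> carrier G \<Longrightarrow> k \<in> carrier G \<Longrightarrow> clinear_on (forms \<Omega>) (forms \<Omega>) (K f k)"
    and K_gen: "\<And>f k h g. f \<in> carrier G \<Longrightarrow> k \<in> carrier G \<Longrightarrow> h \<in> carrier G \<Longrightarrow> g \<in> carrier G \<Longrightarrow>
      K f k (gen h g) = (if cj f (h \<otimes> g) = k then gen (cj f h) (cj f g) else 0)"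
    using cov unfolding covariant_iff by metis
  obtain \<theta> where \<theta>: "clinear_on (forms \<Omega>) (forms \<Omega>D) \<theta>"
    and gen: "\<And>h g. h \<in> carrier G \<Longrightarrow> g \<in> carrier G \<Longrightarrow> \<theta> (gen h g) = embed_gen h g"
    using diff unfolding embed_differentiable_iff by blast
  \<comment> \<open>The map \<open>h dg\<close> to \<open>h_1 dg_1 \<otimes> h_2 g_2\<close>: its
    forms are built from the first legs, which for \<open>\<Phi>(h)\<close> and
    \<open>\<Phi>(g)\<close> are the summands appearing in \<open>dgen\<close>.\<close>
  obtain R where R: "clinear_on (forms \<Omega>D) (tensor_space (carrier G \<times> carrier G) (forms \<Omega>D)) R"
    and R_val: "\<And>h g. h \<in> elems (codouble G) \<Longrightarrow> g \<in> elems (codouble G) \<Longrightarrow> R (lact \<Omega>D h (dif \<Omega>D g)) =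
      (\<Sum>(x, y)\<in>?B. \<Sum>(x', y')\<in>?B. (comult (codouble G) h (x, y) * comult (codouble G) g (x', y')) *\<^sub>C
          tens (bmult (codouble G) y y') (lact \<Omega>D (bvec x) (dif \<Omega>D (bvec x'))))"
    using bicov unfolding bicovariant_def basis_codouble by blast
  \<comment> \<open>The second legs are \<open>\<delta>\<^sub>c\<close> and
    \<open>\<delta>\<^sub>c'\<close> with the conjugates of \<open>h\<close> by \<open>ac\<close>
    and of \<open>g\<close> by \<open>a'c'\<close>. Their product vanishes unless
    \<open>c = c'\<close>, and evaluation at first entry \<open>\<one>\<close> forces both to be
    \<open>\<one>\<close>. What is left is the condition that
    \<open>cj a h \<otimes> cj a' g\<close> equals \<open>q\<close>.\<close>
  have R_gen: "R (embed_gen h g) (\<one>, q) = coact1 h g q"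
    if G: "h \<in> carrier G" "g \<in> carrier G" "q \<in> carrier G" for h g q
  proof -
    let ?t = "\<lambda>x y x' y'. tens (bmult (codouble G) y y') (lact \<Omega>D (bvec x) (dif \<Omega>D (bvec x')))"
    have "R (embed_gen h g) = (\<Sum>(x, y)\<in>?B. \<Sum>(x', y')\<in>?B.
        (comult (codouble G) (codouble_embed G (bvec h)) (x, y) * comult (codouble G) (codouble_embed G (bvec g)) (x', y'))
          *\<^sub>C ?t x y x' y')"
      using R_val[of "codouble_embed G (bvec h)" "codouble_embed G (bvec g)"] G by (simp add: embed_in lact_dif_embed)
    also have "\<dots> = (\<Sum>(x, y)\<in>?B. comult (codouble G) (codouble_embed G (bvec h)) (x, y) *\<^sub>C
        (\<Sum>(x', y')\<in>?B. comult (codouble G) (codouble_embed G (bvec g)) (x', y') *\<^sub>C ?t x y x' y'))"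
      by (simp add: complex_vec.scale_sum_right case_prod_unfold)
    also have "\<dots> = (\<Sum>a\<in>carrier G. \<Sum>c\<in>carrier G. \<Sum>a'\<in>carrier G. \<Sum>c'\<in>carrier G.
        ?t (a, cj a h) (c, cj (a \<otimes> c) h) (a', cj a' g) (c', cj (a' \<otimes> c') g))"
      unfolding sum_comult_codouble_embed[OF G(2)] sum_comult_codouble_embed[OF G(1)] ..
    finally have "R (embed_gen h g) (\<one>, q) = (\<Sum>a\<in>carrier G. \<Sum>c\<in>carrier G. \<Sum>a'\<in>carrier G. \<Sum>c'\<in>carrier G.
        ?t (a, cj a h) (c, cj (a \<otimes> c) h) (a', cj a' g) (c', cj (a' \<otimes> c') g) (\<one>, q))"
      by simp
    also have "\<dots> = (\<Sum>a\<in>carrier G. \<Sum>c\<in>carrier G. \<Sum>a'\<in>carrier G. \<Sum>c'\<in>carrier G. if c' = \<one> then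
        if c = \<one> then if cj a h \<otimes> cj a' g = q then dgen a h a' g else 0 else 0 else 0)"
      using G by (intro sum.cong refl) (auto simp: tens_def bmult_codouble bvec_apply dgen_def)
    also have "\<dots> = (\<Sum>a\<in>carrier G. \<Sum>c\<in>carrier G. if c = \<one> then
        \<Sum>a'\<in>carrier G. if cj a h \<otimes> cj a' g = q then dgen a h a' g else 0 else 0)"
      by (intro sum.cong refl) auto
    finally show ?thesis
      by (simp add: coact1_def)
  qed
  \<comment> \<open>The first component comes from the embedding followed by \<open>R\<close>, the
    second from covariance. Off the bases the values are set to 0, as membership in the tensor
    spaces demands.\<close>
  define \<Theta> where "\<Theta> w = (\<lambda>q. if q \<in> carrier G then R (\<theta> w) (\<one>, q) else 0,
      \<lambda>(f, k). if f \<in> carrier G \<and> k \<in> carrier G then K f k w else 0)" for w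
  have R_lin: "clinear_on (forms \<Omega>) (forms \<Omega>D) (\<lambda>w. R (\<theta> w) (\<one>, q))" if "q \<in> carrier G" for q
  proof -
    have "clinear_on (forms \<Omega>D) (forms \<Omega>D) (\<lambda>w. R w (\<one>, q))"
      using R that by (auto simp: clinear_on_def tensor_space_def Pi_iff)
    from clinear_on_compose[OF \<theta> this] show ?thesis .
  qed
  have "clinear_on (forms \<Omega>) (forms \<Omega>T) \<Theta>"
    unfolding clinear_on_def
  proof (intro conjI ballI allI Pi_I)
    fix w assume w: "w \<in> forms \<Omega>"
    then show "\<Theta> w \<in> forms \<Omega>T"
      using clinear_onD(1)[OF R_lin] clinear_onD(1)[OF K_linear] by (auto simp: \<Theta>_def forms_tensor tensor_space_def)
  qed (auto simp: \<Theta>_def fun_eq_iff clinear_onD(2,3)[OF R_lin] clinear_onD(2,3)[OF K_linear])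
  moreover have "\<Theta> (gen h g) = (coact1 h g, coact2 h g)" if "h \<in> carrier G" "g \<in> carrier G" for h g
  proof -
    have "(coact1 h g, coact2 h g) \<in> forms \<Omega>T"
      using that by (rule coact_in)
    then show ?thesis
      using that by (auto simp: \<Theta>_def fun_eq_iff gen R_gen K_gen forms_tensor tensor_space_def coact2_apply)
  qed
  ultimately show ?thesis
    unfolding coaction_differentiable_iff by blast
qed

end

text \<open>A formula cannot quantify over types, so "some representation" is split: existence is
  claimed on a finite-dimensional space of the fixed type of functions on the natural numbers, while
  the converse is claimed for a subspace of any complex vector space.\<close>

theorem lemma4p4:
  fixes G :: "('g, 'z) monoid_scheme"
    and \<Omega> :: "('g, 'm::complex_vector) calculus"
  assumes "group G" and "finite (carrier G)"
    and "is_calculus (group_algebra G) \<Omega>"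
  shows
    "(codouble_covariant G \<Omega> \<longleftrightarrow>
        (\<exists>(V :: (nat \<Rightarrow> complex) set) \<rho>. finite_dimensional V \<and> group_rep G V \<rho> \<and>
           calculus_iso (group_algebra G) \<Omega> (rep_calculus G V \<rho>))) \<and>
     (\<forall>(V :: 'v::complex_vector set) \<rho>. group_rep G V \<rho> \<longrightarrow>
        calculus_iso (group_algebra G) \<Omega> (rep_calculus G V \<rho>) \<longrightarrow> codouble_covariant G \<Omega>) \<and>
     (codouble_covariant G \<Omega> \<longrightarrow>
        (\<forall>\<Omega>D :: ('g \<times> 'g, 'w::complex_vector) calculus.
           is_calculus (codouble G) \<Omega>D \<longrightarrow> bicovariant (codouble G) \<Omega>D \<longrightarrow>
           (differentiable_map (group_algebra G) \<Omega>
              (tensor_calculus (codouble G) \<Omega>D (group_algebra G) \<Omega>) (coaction G) \<longleftrightarrow>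
            differentiable_map (group_algebra G) \<Omega> \<Omega>D (codouble_embed G))))"
proof -
  interpret group_calculus G \<Omega>
    by (intro group_calculus.intro finite_group.intro finite_group_axioms.intro group_calculus_axioms.intro assms)
  have "\<exists>(V :: (nat \<Rightarrow> complex) set) \<rho>. finite_dimensional V \<and> group_rep G V \<rho> \<and>
      calculus_iso (group_algebra G) \<Omega> (rep_calculus G V \<rho>)" if cov: "codouble_covariant G \<Omega>"
  proof -
    obtain K where "\<And>f k. f \<in> carrier G \<Longrightarrow> k \<in> carrier G \<Longrightarrow> clinear_on (forms \<Omega>) (forms \<Omega>) (K f k)"
      and "\<And>f k h g. f \<in> carrier G \<Longrightarrow> k \<in> carrier G \<Longrightarrow> h \<in> carrier G \<Longrightarrow> g \<in> carrier G \<Longrightarrow>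
        K f k (gen h g) = (if cj f (h \<otimes>\<^bsub>G\<^esub> g) = k then gen (cj f h) (cj f g) else 0)"
      using cov unfolding covariant_iff by metis
    then interpret covariant_group_calculus G \<Omega> K
      by unfold_locales
    show ?thesis
      by (rule rep_exists) (use iso_rep_calculus in blast)
  qed
  moreover have "differentiable_map (group_algebra G) \<Omega>
        (tensor_calculus (codouble G) \<Omega>D (group_algebra G) \<Omega>) (coaction G) \<longleftrightarrow>
      differentiable_map (group_algebra G) \<Omega> \<Omega>D (codouble_embed G)"
    if "codouble_covariant G \<Omega>" "is_calculus (codouble G) \<Omega>D" "bicovariant (codouble G) \<Omega>D"
    for \<Omega>D :: "('g \<times> 'g, 'w) calculus"
  proof -
    interpret codouble_calculus G \<Omega> \<Omega>D
      by unfold_locales fact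
    show ?thesis
      using embed_differentiable_if coaction_differentiable_if that by blast
  qed
  moreover have "codouble_covariant G \<Omega>"
    if "group_rep G V \<rho>" "calculus_iso (group_algebra G) \<Omega> (rep_calculus G V \<rho>)" for V :: "(nat \<Rightarrow> complex) set" and \<rho>
    using that by (rule covariant_if_iso)
  moreover have "codouble_covariant G \<Omega>"
    if "group_rep G V \<rho>" "calculus_iso (group_algebra G) \<Omega> (rep_calculus G V \<rho>)" for V :: "'v set" and \<rho>
    using that by (rule covariant_if_iso)
  ultimately show ?thesis
    by blast
qed

end
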